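(* Let $s=(s_1,\ldots,s_n)$ be a sequence of reflections, $x\in W$ and $\gamma=(\gamma_1,\ldots,\gamma_n)\in\Gamma_{s,x}$. Then the composition $$\mathcal R^{\otimes s}\xrightarrow{\ \theta_s\ }H(s)\xrightarrow{\ i_\gamma^\star\ }\mathcal R_x$$ is given by $$a_1\otimes\cdots\otimes a_{n+1}\mapsto a_1\cup\gamma_1(a_2)\cup\gamma_1\gamma_2(a_3)\cup\cdots\cup\gamma_1\cdots\gamma_n(a_{n+1}).$$
   Context: Standing assumptions: $\Bbbk$ is a commutative ring of finite global dimension in which $2$ is invertible; $G$ is a semisimple compact Lie group, $K$ a maximal torus, $W=N_G(K)/K$ the Weyl group. For a root $\alpha$, $G_\alpha$ is the subgroup of $G$ generated by the image of the root homomorphism $\mathrm{SU}_2\to G$ of $\alpha$ and by $K$; $\omega_\alpha\in W$ is the reflection in the hyperplane perpendicular to $\alpha$, and $G_{\omega_\alpha}:=G_\alpha=G_{-\alpha}$. The elements $\omega_\alpha$ are called reflections. For each $w\in W$ a lifting $\dot w\in N_G(K)$ is chosen, so that $\dot t\in G_t$ for each reflection $t$ and $\dot 1=1$. Universal space: $G$ is a closed subgroup of some $U(\mathfrak n)$; $E=\varinjlim_N E^N$, where $E^N=\{A\in\mathrm{Mat}_{\mathfrak n,N}(\mathbb C):A\bar A^T=I_{\mathfrak n}\}$ with left $G$-action by multiplication and $E^N\subset E^{N'}$ by adding zero columns. $E\to K\backslash E$ is a universal principal $K$-bundle. For a left $K$-space $S$, $S\,{}_K\!\times E=K\backslash(S\times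 E)$ (diagonal action) and $H^\bullet_K(S,\Bbbk)=H^\bullet(S\,{}_K\!\times E,\Bbbk)$. A $K$-equivariant continuous map $f:S\to S'$ induces the equivariant pull-back $f^\star=(f\,{}_K\!\times\mathrm{id})^*:H_K^\bullet(S',\Bbbk)\to H_K^\bullet(S,\Bbbk)$. $\mathrm{pt}$ is the singleton. Put $\mathcal R=H^\bullet_K(\mathrm{pt},\Bbbk)=H^\bullet(K\backslash E,\Bbbk)$. $W$ acts on $\mathcal R$ on the left by $w^{-1}(\mu)=(K\backslash\rho_w)^*(\mu)$, where $K\backslash\rho_w:K\backslash E\to K\backslash E$ is $Ke\mapsto K\dot we$. For a reflection $t$, $\mathcal R^{t}$ is the subring of $t$-invariants. $\mathcal R^{\otimes s}=\mathcal R\otimes_{\mathcal R^{s_1}}\cdots\otimes_{\mathcal R^{s_n}}\mathcal R$ ($n+1$ factors). For $w\in W$, $\mathcal R_w$ is the $\mathcal R$-$\mathcal R$-bimodule equal to $\mathcal R$ as an abelian group, with left action by multiplication and right action $r\cdot_wr''=r\,w(r'')$. Bott–Samelson variety: $\mathrm{BS}(s)=G_{s_1}\times_K\cdots\times_KG_{s_n}/K$ is the quotient of $G_{s_1}\times\cdots\times G_{s_n}$ by $(g_1,\ldots,g_n)\approx(g_1k_1,k_1^{-1}g_2k_2,\ldots,k_{n-1}^{-1}g_nk_n)$, $k_i\in K$; the class is $[g_1:\cdots:g_n]$; for $n=0$ it is $\mathrm{pt}$. $K$ acts on the left through the first factor. $H(s)=H^\bullet_K(\mathrm{BS}(s),\Bbbk)$.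 The isomorphism $\theta_s:\mathcal R^{\otimes s}\to H(s)$ is $\theta_s(a_1\otimes\cdots\otimes a_{n+1})=\phi_s^*(\mathrm{pr}_1^*(a_1)\cup\cdots\cup\mathrm{pr}_{n+1}^*(a_{n+1}))$, where $\phi_s:\mathrm{BS}(s)\,{}_K\!\times E\to(K\backslash E)^{n+1}$ is $K([g_1:\cdots:g_n],e)\mapsto(Ke,Kg_1^{-1}e,\ldots,K(g_1\cdots g_n)^{-1}e)$. $\Gamma_s$ is the set of sequences $\gamma=(\gamma_1,\ldots,\gamma_n)$ with $\gamma_i\in\{s_i,1\}\subset W$ for each $i$, and $\Gamma_{s,x}=\{\gamma\in\Gamma_s:\gamma_1\cdots\gamma_n=x\}$. Each $\gamma$ is identified with the $K$-fixed point $[\dot\gamma_1:\cdots:\dot\gamma_n]$ of $\mathrm{BS}(s)$; $i_\gamma:\mathrm{pt}\hookrightarrow\mathrm{BS}(s)$ is the embedding with value $\gamma$, and $i_\gamma^\star:H(s)\to\mathcal R_x$ is the equivariant pull-back ($\mathcal R_x=\mathcal R=H_K^\bullet(\mathrm{pt},\Bbbk)$ as a left module). *)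

theory Defs
  imports
    "HOL-Homology.Homology"
    "HOL-Algebra.Group_Action"
    "HOL-Algebra.Module"
    "HOL-Algebra.QuotRing"
    "HOL-Algebra.Product_Groups"
    "HOL-Algebra.Free_Abelian_Groups"
    "HOL-Analysis.Analysis"
begin

definition quot_topology :: "'a topology \<Rightarrow> ('a \<Rightarrow> 'b) \<Rightarrow> 'b topology" where
  "quot_topology X q =
     topology (\<lambda>U. U \<subseteq> q ` topspace X \<and> openin X {x \<in> topspace X. q x \<in> U})"

lemma openin_quot_topology:
  "openin (quot_topology X q) U \<longleftrightarrow>
     U \<subseteq> q ` topspace X \<and> openin X {x \<in> topspace X. q x \<in> U}"
proof -
  let ?P = "\<lambda>U. U \<subseteq> q ` topspace X \<and> openin X {x \<in> topspace X. q x \<in> U}"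
  have "istopology ?P"
    unfolding istopology_def
  proof (intro conjI allI impI)
    fix S T assume "?P S" "?P T"
    moreover have "{x \<in> topspace X. q x \<in> S \<inter> T} =
        {x \<in> topspace X. q x \<in> S} \<inter> {x \<in> topspace X. q x \<in> T}" by auto
    ultimately show "S \<inter> T \<subseteq> q ` topspace X" "openin X {x \<in> topspace X. q x \<in> S \<inter> T}"
      by (auto intro: openin_Int)
  next
    fix \<K> assume "\<forall>S\<in>\<K>. ?P S"
    moreover have "{x \<in> topspace X. q x \<in> \<Union>\<K>} = (\<Union>S\<in>\<K>. {x \<in> topspace X. q x \<in> S})" by auto
    ultimately show "\<Union>\<K> \<subseteq> q ` topspace X" "openin X {x \<in> topspace X. q x \<in> \<Union>\<K>}"
      by auto
  qed
  then show ?thesis by (simp add: quot_topology_def topology_inverse')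
qed

lemma quotient_map_quot_topology: "quotient_map X (quot_topology X q) q"
proof -
  have "{x \<in> topspace X. q x \<in> q ` topspace X} = topspace X" by auto
  then have "openin (quot_topology X q) (q ` topspace X)"
    by (simp add: openin_quot_topology)
  then have "topspace (quot_topology X q) = q ` topspace X"
    by (metis openin_quot_topology openin_subset openin_topspace subset_antisym)
  then show ?thesis by (simp add: quotient_map_def openin_quot_topology)
qed

text \<open>Product of a list, in the given order; used for groups and for (noncommutative) rings.\<close>

definition mprod :: "('a, 'b) monoid_scheme \<Rightarrow> 'a list \<Rightarrow> 'a" where
  "mprod M xs = foldr (monoid.mult M) xs \<one>\<^bsub>M\<^esub>"


section \<open>Global dimension\<close>

type_synonym 'k kmodule = "('k, 'k list) module"

definition scalar_ring :: "'k::comm_ring_1 ring" where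
  "scalar_ring = \<lparr>carrier = UNIV, monoid.mult = (*), one = 1, zero = 0, add = (+)\<rparr>"

definition kmodule :: "('k::comm_ring_1) kmodule \<Rightarrow> bool" where
  "kmodule M \<longleftrightarrow> Module.module scalar_ring M"

definition kmodule_hom :: "('k::comm_ring_1) kmodule \<Rightarrow> 'k kmodule \<Rightarrow> ('k list \<Rightarrow> 'k list) set" where
  "kmodule_hom M N =
     {f \<in> hom (add_monoid M) (add_monoid N).
        \<forall>r. \<forall>x\<in>carrier M. f (r \<odot>\<^bsub>M\<^esub> x) = r \<odot>\<^bsub>N\<^esub> f x}"

definition projective_kmodule :: "('k::comm_ring_1) kmodule \<Rightarrow> bool" where
  "projective_kmodule P \<longleftrightarrow> kmodule P \<and>
     (\<forall>M N g f. kmodule M \<longrightarrow> kmodule N \<longrightarrow>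
        g \<in> kmodule_hom M N \<longrightarrow> g ` carrier M = carrier N \<longrightarrow> f \<in> kmodule_hom P N \<longrightarrow>
        (\<exists>h\<in>kmodule_hom P M. \<forall>x\<in>carrier P. g (h x) = f x))"

primrec proj_dim_le :: "nat \<Rightarrow> ('k::comm_ring_1) kmodule \<Rightarrow> bool" where
  "proj_dim_le 0 M \<longleftrightarrow> projective_kmodule M"
| "proj_dim_le (Suc d) M \<longleftrightarrow>
     (\<exists>P g. projective_kmodule P \<and> g \<in> kmodule_hom P M \<and> g ` carrier P = carrier M \<and>
        proj_dim_le d (P\<lparr>carrier := {x \<in> carrier P. g x = \<zero>\<^bsub>M\<^esub>}\<rparr>))"

text \<open>All modules occurring here have their carrier inside the type \<open>'k list\<close>, whose cardinality
  is the maximum of \<open>|'k|\<close> and \<open>\<aleph>\<^sub>0\<close>. Up to isomorphism these include all cyclic modules and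
  their projective resolutions by free modules of such cardinality, and the
  global dimension is the supremum of the projective dimensions of the cyclic modules
  (Auslander), so the size bound is harmless.\<close>

definition finite_global_dimension :: "'k::comm_ring_1 itself \<Rightarrow> bool" where
  "finite_global_dimension _ \<longleftrightarrow> (\<exists>d. \<forall>M :: 'k kmodule. kmodule M \<longrightarrow> proj_dim_le d M)"


section \<open>Singular cohomology ring\<close>

text \<open>An element of the total cochain complex \<open>\<Oplus>\<^sub>p C\<^sup>p(X)\<close> assigns to \<open>p\<close> a function
  on singular \<open>p\<close>-simplices; it is extended by zero off the singular simplices of \<open>X\<close>.\<close>

type_synonym ('a, 'k) cochain = "nat \<Rightarrow> ((nat \<Rightarrow> real) \<Rightarrow> 'a) \<Rightarrow> 'k"

definition cochains :: "'a topology \<Rightarrow> ('a, 'k::comm_ring_1) cochain set" where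
  "cochains X = {c. (\<forall>p \<sigma>. \<not> singular_simplex p X \<sigma> \<longrightarrow> c p \<sigma> = 0) \<and>
                    finite {p. \<exists>\<sigma>. c p \<sigma> \<noteq> 0}}"

definition coboundary :: "'a topology \<Rightarrow> ('a, 'k::comm_ring_1) cochain \<Rightarrow> ('a, 'k) cochain" where
  "coboundary X c = (\<lambda>p \<sigma>. if p > 0 \<and> singular_simplex p X \<sigma>
     then (\<Sum>i\<le>p. (-1) ^ i * c (p - 1) (singular_face p i \<sigma>)) else 0)"

text \<open>Restrictions of a singular simplex to the faces \<open>[v\<^sub>0,\<dots>,v\<^sub>p]\<close> and \<open>[v\<^sub>p,\<dots>,v\<^sub>p\<^sub>+\<^sub>q]\<close>.\<close>

definition front_face :: "nat \<Rightarrow> ((nat \<Rightarrow> real) \<Rightarrow> 'a) \<Rightarrow> (nat \<Rightarrow> real) \<Rightarrow> 'a" where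
  "front_face p \<sigma> = restrict \<sigma> (standard_simplex p)"

definition back_face :: "nat \<Rightarrow> nat \<Rightarrow> ((nat \<Rightarrow> real) \<Rightarrow> 'a) \<Rightarrow> (nat \<Rightarrow> real) \<Rightarrow> 'a" where
  "back_face p q \<sigma> =
     restrict (\<lambda>x. \<sigma> (\<lambda>i. if i < p then 0 else x (i - p))) (standard_simplex q)"

definition cup :: "'a topology \<Rightarrow> ('a, 'k::comm_ring_1) cochain \<Rightarrow> ('a, 'k) cochain \<Rightarrow> ('a, 'k) cochain" where
  "cup X c d = (\<lambda>n \<sigma>. if singular_simplex n X \<sigma>
     then (\<Sum>p\<le>n. c p (front_face p \<sigma>) * d (n - p) (back_face p (n - p) \<sigma>)) else 0)"

definition cochain_ring :: "'a topology \<Rightarrow> ('a, 'k::comm_ring_1) cochain ring" where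
  "cochain_ring X =
     \<lparr>carrier = cochains X, monoid.mult = cup X,
      one = (\<lambda>p \<sigma>. if p = 0 \<and> singular_simplex 0 X \<sigma> then 1 else 0),
      zero = (\<lambda>p \<sigma>. 0), add = (\<lambda>c d p \<sigma>. c p \<sigma> + d p \<sigma>)\<rparr>"

definition cocycle_ring :: "'a topology \<Rightarrow> ('a, 'k::comm_ring_1) cochain ring" where
  "cocycle_ring X =
     (cochain_ring X)\<lparr>carrier := {c \<in> cochains X. coboundary X c = (\<lambda>p \<sigma>. 0)}\<rparr>"

definition coboundaries :: "'a topology \<Rightarrow> ('a, 'k::comm_ring_1) cochain set" where
  "coboundaries X = coboundary X ` cochains X"

text \<open>\<open>H\<^sup>\<bullet>(X, 'k)\<close>, the direct sum over all degrees with the cup product.\<close>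

definition cohomology :: "'a topology \<Rightarrow> ('a, 'k::comm_ring_1) cochain set ring" where
  "cohomology X = cocycle_ring X Quot coboundaries X"

definition cochain_pullback ::
    "'a topology \<Rightarrow> ('a \<Rightarrow> 'b) \<Rightarrow> ('b, 'k::comm_ring_1) cochain \<Rightarrow> ('a, 'k) cochain" where
  "cochain_pullback X f c = (\<lambda>p \<sigma>. if singular_simplex p X \<sigma> then c p (simplex_map p f \<sigma>) else 0)"

text \<open>The map \<open>f\<^sup>*\<close> induced on cohomology by a continuous map \<open>f\<close> with domain \<open>X\<close>. Here and below,
  a map out of a quotient is the union of its values (which are sets) over all representatives.\<close>

definition pullback ::
    "'a topology \<Rightarrow> ('a \<Rightarrow> 'b) \<Rightarrow> ('b, 'k::comm_ring_1) cochain set \<Rightarrow> ('a, 'k) cochain set" where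
  "pullback X f A = (\<Union>c\<in>A. coboundaries X +>\<^bsub>cocycle_ring X\<^esub> cochain_pullback X f c)"


section \<open>Compact Lie groups as closed subgroups of the unitary group\<close>

type_synonym 'n cmat = "complex^'n^'n"

definition mat_group :: "'n::finite cmat set \<Rightarrow> 'n cmat monoid" where
  "mat_group S = \<lparr>carrier = S, monoid.mult = (**), one = mat 1\<rparr>"

definition ctranspose :: "'n::finite cmat \<Rightarrow> 'n cmat" where
  "ctranspose A = map_matrix cnj (transpose A)"

definition unitary_matrices :: "'n::finite cmat set" where
  "unitary_matrices = {A. A ** ctranspose A = mat 1}"

definition compact_matrix_group :: "'n::finite cmat set \<Rightarrow> bool" where
  "compact_matrix_group G \<longleftrightarrow> subgroup G (mat_group unitary_matrices) \<and> closed G"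

definition mexp :: "'n::finite cmat \<Rightarrow> 'n cmat" where
  "mexp X = suminf (\<lambda>m. (((**) X ^^ m) (mat 1)) /\<^sub>R fact m)"

definition lie_algebra :: "'n::finite cmat set \<Rightarrow> 'n cmat set" where
  "lie_algebra G = {X. \<forall>t::real. mexp (t *\<^sub>R X) \<in> G}"

definition bracket :: "'n::finite cmat \<Rightarrow> 'n cmat \<Rightarrow> 'n cmat" where
  "bracket X Y = X ** Y - Y ** X"

definition lie_ideal :: "'n::finite cmat set \<Rightarrow> 'n cmat set \<Rightarrow> bool" where
  "lie_ideal I L \<longleftrightarrow> subspace I \<and> I \<subseteq> L \<and> (\<forall>X\<in>L. \<forall>Y\<in>I. bracket X Y \<in> I)"

definition derived_algebra :: "'n::finite cmat set \<Rightarrow> 'n cmat set" where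
  "derived_algebra L = span {bracket X Y |X Y. X \<in> L \<and> Y \<in> L}"

definition solvable_lie_algebra :: "'n::finite cmat set \<Rightarrow> bool" where
  "solvable_lie_algebra L \<longleftrightarrow> (\<exists>m. (derived_algebra ^^ m) L = {0})"

definition semisimple_lie_algebra :: "'n::finite cmat set \<Rightarrow> bool" where
  "semisimple_lie_algebra L \<longleftrightarrow> (\<forall>I. lie_ideal I L \<and> solvable_lie_algebra I \<longrightarrow> I = {0})"

definition semisimple_group :: "'n::finite cmat set \<Rightarrow> bool" where
  "semisimple_group G \<longleftrightarrow> connected G \<and> semisimple_lie_algebra (lie_algebra G)"

definition circle_group :: "complex monoid" where
  "circle_group = \<lparr>carrier = sphere 0 1, monoid.mult = (*), one = 1\<rparr>"

definition torus :: "'n::finite cmat set \<Rightarrow> bool" where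
  "torus T \<longleftrightarrow> (\<exists>r::nat. \<exists>f.
     f \<in> iso (product_group {..<r} (\<lambda>_. circle_group)) (mat_group T) \<and>
     homeomorphic_map (product_topology (\<lambda>_. top_of_set (sphere 0 1)) {..<r}) (top_of_set T) f)"

definition maximal_torus :: "'n::finite cmat set \<Rightarrow> 'n cmat set \<Rightarrow> bool" where
  "maximal_torus K G \<longleftrightarrow> torus K \<and> K \<subseteq> G \<and> (\<forall>T. torus T \<and> T \<subseteq> G \<and> K \<subseteq> T \<longrightarrow> T = K)"

definition Weyl :: "'n::finite cmat set \<Rightarrow> 'n cmat set \<Rightarrow> 'n cmat set monoid" where
  "Weyl G K = (mat_group G)\<lparr>carrier := normalizer (mat_group G) K\<rparr> Mod K"


section \<open>Roots, reflections and the groups they determine\<close>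

text \<open>As \<open>L = lie_algebra G\<close> consists of skew-Hermitian matrices, \<open>L \<inter> \<i> L = 0\<close>, so the
  complexification of \<open>L\<close> is \<open>L + \<i> L\<close>.\<close>

definition complexified_lie_algebra :: "'n::finite cmat set \<Rightarrow> 'n cmat set" where
  "complexified_lie_algebra G =
     {X + map_matrix ((*) \<i>) Y |X Y. X \<in> lie_algebra G \<and> Y \<in> lie_algebra G}"

definition root_space :: "'n::finite cmat set \<Rightarrow> 'n cmat set \<Rightarrow> ('n cmat \<Rightarrow> complex) \<Rightarrow> 'n cmat set" where
  "root_space G K \<alpha> = {X \<in> complexified_lie_algebra G.
     \<forall>k\<in>K. k ** X ** matrix_inv k = map_matrix ((*) (\<alpha> k)) X}"

text \<open>Roots are taken as global characters of the maximal torus.\<close>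

definition roots :: "'n::finite cmat set \<Rightarrow> 'n cmat set \<Rightarrow> ('n cmat \<Rightarrow> complex) set" where
  "roots G K = {\<alpha> \<in> extensional K.
     \<alpha> \<in> hom (mat_group K) circle_group \<and> continuous_on K \<alpha> \<and>
     (\<exists>k\<in>K. \<alpha> k \<noteq> 1) \<and> (\<exists>X\<in>root_space G K \<alpha>. X \<noteq> 0)}"

definition SU2 :: "2 cmat set" where
  "SU2 = {A \<in> unitary_matrices. det A = 1}"

definition differential_at_one :: "(2 cmat \<Rightarrow> 'n::finite cmat) \<Rightarrow> 2 cmat \<Rightarrow> 'n cmat" where
  "differential_at_one \<phi> A = vector_derivative (\<lambda>t. \<phi> (mexp (t *\<^sub>R A))) (at 0)"

text \<open>The complexified differential of \<open>\<phi>\<close> maps \<open>E = [[0,1],[0,0]]\<close> to a root vector of \<open>\<alpha>\<close>.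
  Here \<open>E = (A - \<i> B) / 2\<close> with \<open>A = [[0,1],[-1,0]]\<close> and \<open>B = [[0,\<i>],[\<i>,0]]\<close> in the Lie algebra
  of \<open>SU2\<close>. This determines \<open>\<phi>\<close> up to conjugation by an element of \<open>K\<close>.\<close>

definition root_homomorphism ::
    "'n::finite cmat set \<Rightarrow> 'n cmat set \<Rightarrow> ('n cmat \<Rightarrow> complex) \<Rightarrow> (2 cmat \<Rightarrow> 'n cmat) \<Rightarrow> bool" where
  "root_homomorphism G K \<alpha> \<phi> \<longleftrightarrow>
     \<phi> \<in> hom (mat_group SU2) (mat_group G) \<and> continuous_on SU2 \<phi> \<and>
     (let E\<alpha> = (1/2) *\<^sub>R
          (differential_at_one \<phi> (vector [vector [0, 1], vector [-1, 0]]) -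
           map_matrix ((*) \<i>) (differential_at_one \<phi> (vector [vector [0, \<i>], vector [\<i>, 0]])))
      in E\<alpha> \<in> root_space G K \<alpha> \<and> E\<alpha> \<noteq> 0)"

text \<open>By the remark above, the group does not change if a single root homomorphism of \<open>\<alpha>\<close> is used.\<close>

definition root_subgroup :: "'n::finite cmat set \<Rightarrow> 'n cmat set \<Rightarrow> ('n cmat \<Rightarrow> complex) \<Rightarrow> 'n cmat set" where
  "root_subgroup G K \<alpha> =
     generate (mat_group G) (K \<union> (\<Union>\<phi>\<in>{\<phi>. root_homomorphism G K \<alpha> \<phi>}. \<phi> ` SU2))"

text \<open>The kernel of the differential of \<open>\<alpha>\<close>. The inner product used for \<open>reflection_of\<close>
  is \<open>Re tr(X Y\<^sup>*)\<close>, which is invariant under conjugation by unitary matrices.\<close>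

definition root_hyperplane :: "'n::finite cmat set \<Rightarrow> ('n cmat \<Rightarrow> complex) \<Rightarrow> 'n cmat set" where
  "root_hyperplane K \<alpha> = lie_algebra {k \<in> K. \<alpha> k = 1}"

definition reflection_of ::
    "'n::finite cmat set \<Rightarrow> 'n cmat set \<Rightarrow> ('n cmat \<Rightarrow> complex) \<Rightarrow> 'n cmat set \<Rightarrow> bool" where
  "reflection_of G K \<alpha> w \<longleftrightarrow> w \<in> carrier (Weyl G K) \<and>
     (\<forall>g\<in>w. \<forall>X\<in>lie_algebra K.
        (X \<in> root_hyperplane K \<alpha> \<longrightarrow> g ** X ** matrix_inv g = X) \<and>
        ((\<forall>Y\<in>root_hyperplane K \<alpha>. X \<bullet> Y = 0) \<longrightarrow> g ** X ** matrix_inv g = - X))"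

definition reflections :: "'n::finite cmat set \<Rightarrow> 'n cmat set \<Rightarrow> 'n cmat set set" where
  "reflections G K = {t. \<exists>\<alpha>\<in>roots G K. reflection_of G K \<alpha> t}"

text \<open>The root with a given reflection is unique up to sign, and both signs give the same group.\<close>

definition reflection_subgroup :: "'n::finite cmat set \<Rightarrow> 'n cmat set \<Rightarrow> 'n cmat set \<Rightarrow> 'n cmat set" where
  "reflection_subgroup G K t =
     root_subgroup G K (SOME \<alpha>. \<alpha> \<in> roots G K \<and> reflection_of G K \<alpha> t)"

definition lifting :: "'n::finite cmat set \<Rightarrow> 'n cmat set \<Rightarrow> ('n cmat set \<Rightarrow> 'n cmat) \<Rightarrow> bool" where
  "lifting G K lift \<longleftrightarrow>
     (\<forall>w\<in>carrier (Weyl G K). lift w \<in> w) \<and>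
     (\<forall>t\<in>reflections G K. lift t \<in> reflection_subgroup G K t) \<and>
     lift \<one>\<^bsub>Weyl G K\<^esub> = mat 1"


section \<open>The universal space and equivariant cohomology\<close>

text \<open>A matrix with countably many columns is the sequence of its columns.\<close>

definition Stiefel :: "nat \<Rightarrow> (nat \<Rightarrow> complex^'n::finite) set" where
  "Stiefel N = {A. (\<forall>j\<ge>N. A j = 0) \<and>
     (\<forall>i i'. (\<Sum>j<N. A j $ i * cnj (A j $ i')) = (if i = i' then 1 else 0))}"

definition E_top :: "(nat \<Rightarrow> complex^'n::finite) topology" where
  "E_top = topology (\<lambda>U. U \<subseteq> (\<Union>N. Stiefel N) \<and>
     (\<forall>N. openin (top_of_set (Stiefel N)) (U \<inter> Stiefel N)))"

lemma openin_E_top: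
  fixes U :: "(nat \<Rightarrow> complex^'n::finite) set"
  shows "openin E_top U \<longleftrightarrow> U \<subseteq> (\<Union>N. Stiefel N) \<and>
     (\<forall>N. openin (top_of_set (Stiefel N)) (U \<inter> Stiefel N))"
proof -
  have "istopology (\<lambda>U. U \<subseteq> (\<Union>N. Stiefel N :: (nat \<Rightarrow> complex^'n) set) \<and>
     (\<forall>N. openin (top_of_set (Stiefel N)) (U \<inter> Stiefel N)))" (is "istopology ?P")
    unfolding istopology_def
  proof (intro conjI allI impI)
    fix S T N assume P: "?P S" "?P T"
    then show "S \<inter> T \<subseteq> (\<Union>N. Stiefel N)" by blast
    have "S \<inter> T \<inter> Stiefel N = (S \<inter> Stiefel N) \<inter> (T \<inter> Stiefel N)" by auto
    then show "openin (top_of_set (Stiefel N)) (S \<inter> T \<inter> Stiefel N)"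
      using P by (auto intro: openin_Int)
  next
    fix \<K> N assume P: "\<forall>S\<in>\<K>. ?P S"
    then show "\<Union>\<K> \<subseteq> (\<Union>N. Stiefel N)" by blast
    have "\<Union>\<K> \<inter> Stiefel N = (\<Union>S\<in>\<K>. S \<inter> Stiefel N)" by auto
    moreover have "openin (top_of_set (Stiefel N)) (\<Union>S\<in>\<K>. S \<inter> Stiefel N)"
      using P by (intro openin_Union) blast
    ultimately show "openin (top_of_set (Stiefel N)) (\<Union>\<K> \<inter> Stiefel N)"
      by (simp only:)
  qed
  then show ?thesis unfolding E_top_def by (rule topology_inverse' [THEN fun_cong])
qed

definition E_act :: "'n::finite cmat \<Rightarrow> (nat \<Rightarrow> complex^'n) \<Rightarrow> (nat \<Rightarrow> complex^'n)" where
  "E_act g A = (\<lambda>j. g *v A j)"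

definition E_orbit :: "'n::finite cmat set \<Rightarrow> (nat \<Rightarrow> complex^'n) \<Rightarrow> (nat \<Rightarrow> complex^'n) set" where
  "E_orbit K e = {E_act k e |k. k \<in> K}"

definition KE :: "'n::finite cmat set \<Rightarrow> (nat \<Rightarrow> complex^'n) set topology" where
  "KE K = quot_topology E_top (E_orbit K)"

definition borel_orbit :: "'n::finite cmat set \<Rightarrow> ('n cmat \<Rightarrow> 's \<Rightarrow> 's) \<Rightarrow>
    's \<times> (nat \<Rightarrow> complex^'n) \<Rightarrow> ('s \<times> (nat \<Rightarrow> complex^'n)) set" where
  "borel_orbit K act = (\<lambda>(x, e). {(act k x, E_act k e) |k. k \<in> K})"

definition borel_space :: "'n::finite cmat set \<Rightarrow> 's topology \<Rightarrow> ('n cmat \<Rightarrow> 's \<Rightarrow> 's) \<Rightarrow>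
    ('s \<times> (nat \<Rightarrow> complex^'n)) set topology" where
  "borel_space K S act = quot_topology (prod_topology S E_top) (borel_orbit K act)"

definition eq_cohomology :: "'n::finite cmat set \<Rightarrow> 's topology \<Rightarrow> ('n cmat \<Rightarrow> 's \<Rightarrow> 's) \<Rightarrow>
    (('s \<times> (nat \<Rightarrow> complex^'n)) set, 'k::comm_ring_1) cochain set ring" where
  "eq_cohomology K S act = cohomology (borel_space K S act)"

definition borel_map :: "'n::finite cmat set \<Rightarrow> ('n cmat \<Rightarrow> 't \<Rightarrow> 't) \<Rightarrow> ('s \<Rightarrow> 't) \<Rightarrow>
    ('s \<times> (nat \<Rightarrow> complex^'n)) set \<Rightarrow> ('t \<times> (nat \<Rightarrow> complex^'n)) set" where
  "borel_map K act' f Q = (\<Union>(x, e)\<in>Q. borel_orbit K act' (f x, e))"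

text \<open>The equivariant pull-back along \<open>f\<close>, a map from the \<open>K\<close>-space \<open>(S, act)\<close> to a space
  with \<open>K\<close>-action \<open>act'\<close>.\<close>

definition eq_pullback :: "'n::finite cmat set \<Rightarrow> 's topology \<Rightarrow> ('n cmat \<Rightarrow> 's \<Rightarrow> 's) \<Rightarrow>
    ('n cmat \<Rightarrow> 't \<Rightarrow> 't) \<Rightarrow> ('s \<Rightarrow> 't) \<Rightarrow>
    (('t \<times> (nat \<Rightarrow> complex^'n)) set, 'k::comm_ring_1) cochain set \<Rightarrow>
    (('s \<times> (nat \<Rightarrow> complex^'n)) set, 'k) cochain set" where
  "eq_pullback K S act act' f = pullback (borel_space K S act) (borel_map K act' f)"

definition pt_top :: "unit topology" where
  "pt_top = discrete_topology {()}"

definition pt_act :: "'n::finite cmat \<Rightarrow> unit \<Rightarrow> unit" where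
  "pt_act k x = x"

type_synonym ('n, 'k) Rclass = "((nat \<Rightarrow> complex^'n) set, 'k) cochain set"

definition Rring :: "'n::finite cmat set \<Rightarrow> ('n, 'k::comm_ring_1) Rclass ring" where
  "Rring K = cohomology (KE K)"

text \<open>The identification of \<open>H\<^sub>K(pt)\<close> with \<open>H(K\E)\<close>, induced by the homeomorphism
  \<open>Ke \<mapsto> K(pt, e)\<close>.\<close>

definition pt_identification :: "'n::finite cmat set \<Rightarrow>
    ((unit \<times> (nat \<Rightarrow> complex^'n)) set, 'k::comm_ring_1) cochain set \<Rightarrow> ('n, 'k) Rclass" where
  "pt_identification K = pullback (KE K) (\<lambda>Q. \<Union>e\<in>Q. borel_orbit K pt_act ((), e))"

definition rho :: "'n::finite cmat set \<Rightarrow> ('n cmat set \<Rightarrow> 'n cmat) \<Rightarrow> 'n cmat set \<Rightarrow>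
    (nat \<Rightarrow> complex^'n) set \<Rightarrow> (nat \<Rightarrow> complex^'n) set" where
  "rho K lift w Q = (\<Union>e\<in>Q. E_orbit K (E_act (lift w) e))"

text \<open>The left action satisfies \<open>w\<^sup>-\<^sup>1(\<mu>) = rho(w)\<^sup>*(\<mu>)\<close>, whence the inverse below.\<close>

definition Weyl_act :: "'n::finite cmat set \<Rightarrow> 'n cmat set \<Rightarrow> ('n cmat set \<Rightarrow> 'n cmat) \<Rightarrow>
    'n cmat set \<Rightarrow> ('n, 'k::comm_ring_1) Rclass \<Rightarrow> ('n, 'k) Rclass" where
  "Weyl_act G K lift w = pullback (KE K) (rho K lift (inv\<^bsub>Weyl G K\<^esub> w))"

definition Weyl_invariants :: "'n::finite cmat set \<Rightarrow> 'n cmat set \<Rightarrow> ('n cmat set \<Rightarrow> 'n cmat) \<Rightarrow>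
    'n cmat set \<Rightarrow> ('n, 'k::comm_ring_1) Rclass set" where
  "Weyl_invariants G K lift t = {r \<in> carrier (Rring K). Weyl_act G K lift t r = r}"


section \<open>The tensor product\<close>

definition Rtuples :: "'n::finite cmat set \<Rightarrow> nat \<Rightarrow> ('n, 'k::comm_ring_1) Rclass list set" where
  "Rtuples K m = {a. length a = m \<and> set a \<subseteq> carrier (Rring K)}"

text \<open>Additivity in every slot, and \<open>\<dots> \<otimes> a\<^sub>i r \<otimes> a\<^sub>i\<^sub>+\<^sub>1 \<otimes> \<dots> = \<dots> \<otimes> a\<^sub>i \<otimes> r a\<^sub>i\<^sub>+\<^sub>1 \<otimes> \<dots>\<close> for \<open>r\<close> invariant
  under \<open>s\<^sub>i\<close>.\<close>

definition tensor_relations :: "'n::finite cmat set \<Rightarrow> 'n cmat set \<Rightarrow> ('n cmat set \<Rightarrow> 'n cmat) \<Rightarrow>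
    'n cmat set list \<Rightarrow> (('n, 'k::comm_ring_1) Rclass list \<Rightarrow>\<^sub>0 int) set" where
  "tensor_relations G K lift s =
     {frag_of (a[i := b \<oplus>\<^bsub>Rring K\<^esub> c]) - frag_of (a[i := b]) - frag_of (a[i := c]) |a i b c.
        a \<in> Rtuples K (Suc (length s)) \<and> i < Suc (length s) \<and>
        b \<in> carrier (Rring K) \<and> c \<in> carrier (Rring K)} \<union>
     {frag_of (a[i := a ! i \<otimes>\<^bsub>Rring K\<^esub> r]) - frag_of (a[Suc i := r \<otimes>\<^bsub>Rring K\<^esub> a ! Suc i]) |a i r.
        a \<in> Rtuples K (Suc (length s)) \<and> i < length s \<and> r \<in> Weyl_invariants G K lift (s ! i)}"

definition tensor_kernel :: "'n::finite cmat set \<Rightarrow> 'n cmat set \<Rightarrow> ('n cmat set \<Rightarrow> 'n cmat) \<Rightarrow>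
    'n cmat set list \<Rightarrow> (('n, 'k::comm_ring_1) Rclass list \<Rightarrow>\<^sub>0 int) set" where
  "tensor_kernel G K lift s =
     generate (free_Abelian_group (Rtuples K (Suc (length s)))) (tensor_relations G K lift s)"

definition tensor_product :: "'n::finite cmat set \<Rightarrow> 'n cmat set \<Rightarrow> ('n cmat set \<Rightarrow> 'n cmat) \<Rightarrow>
    'n cmat set list \<Rightarrow> (('n, 'k::comm_ring_1) Rclass list \<Rightarrow>\<^sub>0 int) set monoid" where
  "tensor_product G K lift s =
     free_Abelian_group (Rtuples K (Suc (length s))) Mod tensor_kernel G K lift s"

definition pure_tensor :: "'n::finite cmat set \<Rightarrow> 'n cmat set \<Rightarrow> ('n cmat set \<Rightarrow> 'n cmat) \<Rightarrow>
    'n cmat set list \<Rightarrow> ('n, 'k::comm_ring_1) Rclass list \<Rightarrow>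
    (('n, 'k) Rclass list \<Rightarrow>\<^sub>0 int) set" where
  "pure_tensor G K lift s a =
     tensor_kernel G K lift s #>\<^bsub>free_Abelian_group (Rtuples K (Suc (length s)))\<^esub> frag_of a"


section \<open>Bott-Samelson varieties\<close>

text \<open>Indices start at \<open>0\<close>: the tuple \<open>(g\<^sub>1,\<dots>,g\<^sub>n)\<close> is an extensional function on \<open>{..<n}\<close>.\<close>

definition BS_class :: "'n::finite cmat set \<Rightarrow> nat \<Rightarrow> (nat \<Rightarrow> 'n cmat) \<Rightarrow> (nat \<Rightarrow> 'n cmat) set" where
  "BS_class K n g =
     {\<lambda>i\<in>{..<n}. (if i = 0 then mat 1 else matrix_inv (\<kappa> (i - 1))) ** g i ** \<kappa> i |\<kappa>.
        \<kappa> \<in> {..<n} \<rightarrow> K}"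

definition BS_top :: "'n::finite cmat set \<Rightarrow> 'n cmat set \<Rightarrow> 'n cmat set list \<Rightarrow>
    (nat \<Rightarrow> 'n cmat) set topology" where
  "BS_top G K s = quot_topology
     (product_topology (\<lambda>i. top_of_set (reflection_subgroup G K (s ! i))) {..<length s})
     (BS_class K (length s))"

definition BS_act :: "nat \<Rightarrow> 'n::finite cmat \<Rightarrow> (nat \<Rightarrow> 'n cmat) set \<Rightarrow> (nat \<Rightarrow> 'n cmat) set" where
  "BS_act n k X = (\<lambda>g. \<lambda>i\<in>{..<n}. if i = 0 then k ** g i else g i) ` X"

type_synonym ('n, 'k) Hclass =
  "(((nat \<Rightarrow> 'n cmat) set \<times> (nat \<Rightarrow> complex^'n)) set, 'k) cochain set"

definition Hring :: "'n::finite cmat set \<Rightarrow> 'n cmat set \<Rightarrow> 'n cmat set list \<Rightarrow>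
    ('n, 'k::comm_ring_1) Hclass ring" where
  "Hring G K s = eq_cohomology K (BS_top G K s) (BS_act (length s))"

definition phi :: "'n::finite cmat set \<Rightarrow> nat \<Rightarrow>
    ((nat \<Rightarrow> 'n cmat) set \<times> (nat \<Rightarrow> complex^'n)) set \<Rightarrow> nat \<Rightarrow> (nat \<Rightarrow> complex^'n) set" where
  "phi K n Q = (\<lambda>i\<in>{..n}. \<Union>(X, e)\<in>Q. \<Union>g\<in>X.
     E_orbit K (E_act (matrix_inv (mprod (mat_group UNIV) (map g [0..<i]))) e))"

definition theta_tuple :: "'n::finite cmat set \<Rightarrow> 'n cmat set \<Rightarrow> 'n cmat set list \<Rightarrow>
    ('n, 'k::comm_ring_1) Rclass list \<Rightarrow> ('n, 'k) Hclass" where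
  "theta_tuple G K s a =
     (let P = product_topology (\<lambda>_. KE K) {..length s} in
      pullback (borel_space K (BS_top G K s) (BS_act (length s))) (phi K (length s))
        (mprod (cohomology P) (map (\<lambda>i. pullback P (\<lambda>x. x i) (a ! i)) [0..<Suc (length s)])))"

text \<open>The additive extension of \<open>theta_tuple\<close> to formal \<open>\<int>\<close>-combinations of tuples.\<close>

definition theta_free :: "'n::finite cmat set \<Rightarrow> 'n cmat set \<Rightarrow> 'n cmat set list \<Rightarrow>
    (('n, 'k::comm_ring_1) Rclass list \<Rightarrow>\<^sub>0 int) \<Rightarrow> ('n, 'k) Hclass" where
  "theta_free G K s u =
     (\<Oplus>\<^bsub>Hring G K s\<^esub>a\<in>Poly_Mapping.keys u.
        [Poly_Mapping.lookup u a] \<cdot>\<^bsub>Hring G K s\<^esub> theta_tuple G K s a)"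

definition theta :: "'n::finite cmat set \<Rightarrow> 'n cmat set \<Rightarrow> 'n cmat set list \<Rightarrow>
    (('n, 'k::comm_ring_1) Rclass list \<Rightarrow>\<^sub>0 int) set \<Rightarrow> ('n, 'k) Hclass" where
  "theta G K s \<xi> = (\<Union>u\<in>\<xi>. theta_free G K s u)"

definition Gamma_seqs :: "'n::finite cmat set \<Rightarrow> 'n cmat set \<Rightarrow> 'n cmat set list \<Rightarrow> 'n cmat set list set" where
  "Gamma_seqs G K s = {\<gamma>. length \<gamma> = length s \<and> (\<forall>i<length s. \<gamma> ! i \<in> {s ! i, \<one>\<^bsub>Weyl G K\<^esub>})}"

definition Gamma_at :: "'n::finite cmat set \<Rightarrow> 'n cmat set \<Rightarrow> 'n cmat set list \<Rightarrow> 'n cmat set \<Rightarrow>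
    'n cmat set list set" where
  "Gamma_at G K s x = {\<gamma> \<in> Gamma_seqs G K s. mprod (Weyl G K) \<gamma> = x}"

definition BS_point :: "'n::finite cmat set \<Rightarrow> ('n cmat set \<Rightarrow> 'n cmat) \<Rightarrow> 'n cmat set list \<Rightarrow>
    (nat \<Rightarrow> 'n cmat) set" where
  "BS_point K lift \<gamma> = BS_class K (length \<gamma>) (\<lambda>i\<in>{..<length \<gamma>}. lift (\<gamma> ! i))"

text \<open>The pull-back to the fixed point \<open>\<gamma>\<close>, with values in \<open>H(K\E)\<close>. Only the right module structure of
  the target \<open>\<R>\<^sub>x\<close> depends on \<open>x\<close>.\<close>

definition fixed_point_pullback :: "'n::finite cmat set \<Rightarrow> ('n cmat set \<Rightarrow> 'n cmat) \<Rightarrow>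
    'n cmat set list \<Rightarrow> ('n, 'k::comm_ring_1) Hclass \<Rightarrow> ('n, 'k) Rclass" where
  "fixed_point_pullback K lift \<gamma> h =
     pt_identification K
       (eq_pullback K pt_top pt_act (BS_act (length \<gamma>)) (\<lambda>_. BS_point K lift \<gamma>) h)"

end

theory Submission
  imports Defs "HOL-Algebra.Zassenhaus"
begin

text \<open>The pull-back to the fixed point, composed with \<open>\<phi>\<^sub>s\<close>, is induced by the map
  \<open>Ke \<mapsto> (Ke, K\<gamma>\<^sub>1\<^sup>-\<^sup>1e, \<dots>, K(\<gamma>\<^sub>1\<dots>\<gamma>\<^sub>n)\<^sup>-\<^sup>1e)\<close> from \<open>K\E\<close> to
  \<open>(K\E)\<^sup>n\<^sup>+\<^sup>1\<close>, whose components are the maps \<open>\<rho>\<^sub>w\<close> with \<open>w = (\<gamma>\<^sub>1\<dots>\<gamma>\<^sub>i)\<^sup>-\<^sup>1\<close>, on the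
  nose and not only up to homotopy. So the formula follows from functoriality and multiplicativity of
  pull-backs on pure tensors. That \<open>\<theta>\<^sub>s\<close> respects the tensor relations is not needed on \<open>H(s)\<close>
  itself: a map out of a quotient is the union over all representatives, so it is enough that the
  composite respects them, and there an \<open>s\<^sub>i\<close>-invariant \<open>r\<close> moves across the \<open>i\<close>-th tensor sign
  because \<open>\<gamma>\<^sub>i \<in> {s\<^sub>i, 1}\<close> fixes it.\<close>


section \<open>Cochains\<close>

text \<open>Functoriality is strict already for cochains: front and back faces commute with
  composition by a map, so \<open>cochain_pullback\<close> respects cup products before passing to
  classes. The topological obstacle is the continuity of \<open>phi\<close>. Its source is a
  quotient of a product one factor of which is itself a quotient, and the product of a quotient map
  with an identity need not be a quotient map. It is one here because BS(s) is the quotient of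
  tuples by a group acting by homeomorphisms, so \<open>BS_class\<close> is open; continuity can
  then be tested on tuples of matrices times E, where only multiplication, inversion and the action
  on E occur. Liftings are not multiplicative, but all representatives of a class in W induce the
  same map on the orbit space of E, so a product of liftings can stand for the lifting of a product.
  Products are kept in order throughout: cup products commute only up to sign, and the balancing
  relation moves r between neighbouring factors, which respects the order.\<close>

definition simplex_shift :: "nat \<Rightarrow> (nat \<Rightarrow> real) \<Rightarrow> nat \<Rightarrow> real" where
  "simplex_shift p x = (\<lambda>i. if i < p then 0 else x (i - p))"

text \<open>Points of a simplex are sequences over all naturals that vanish past the dimension, so a
  smaller standard simplex is a subset of a larger one. The inequality, in place of n = p + q, makes
  room for back faces that stop before the last vertex.\<close>

lemma simplex_shift_in_standard_simplex:
  assumes "x \<in> standard_simplex q" "p + q \<le> n"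
  shows "simplex_shift p x \<in> standard_simplex n"
proof -
  have "simplex_shift p x \<in> standard_simplex (p + q)"
  proof -
    have "(\<Sum>i\<le>p+q. simplex_shift p x i) = (\<Sum>i=p..p+q. simplex_shift p x i)"
      by (rule sum.mono_neutral_right) (auto simp: simplex_shift_def)
    also have "\<dots> = (\<Sum>i\<le>q. x i)"
      by (rule sum.reindex_bij_witness[where i="\<lambda>i. i + p" and j="\<lambda>i. i - p"])
        (auto simp: simplex_shift_def)
    finally show ?thesis
      using assms(1) by (auto simp: standard_simplex_def simplex_shift_def)
  qed
  then show ?thesis
    using standard_simplex_mono[OF assms(2)] by blast
qed

lemma back_face_eq: "back_face p q \<sigma> = restrict (\<sigma> \<circ> simplex_shift p) (standard_simplex q)"
  by (simp add: back_face_def simplex_shift_def o_def)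

lemma singular_simplex_front_face:
  assumes "singular_simplex n X \<sigma>" "p \<le> n"
  shows "singular_simplex p X (front_face p \<sigma>)"
  using assms continuous_map_from_subtopology_mono[OF _ standard_simplex_mono[OF assms(2)]]
  by (auto simp: singular_simplex_def front_face_def)

lemma singular_simplex_back_face:
  assumes "singular_simplex n X \<sigma>" "p + q \<le> n"
  shows "singular_simplex q X (back_face p q \<sigma>)"
proof -
  let ?S = "\<lambda>m. subtopology (powertop_real UNIV) (standard_simplex m)"
  have "continuous_map (?S q) (?S n) (simplex_shift p)"
  proof -
    have "continuous_map (?S q) euclideanreal (\<lambda>x. simplex_shift p x i)" for i
      by (cases "i < p")
        (auto simp: simplex_shift_def
          intro: continuous_map_from_subtopology continuous_map_product_projection)
    then show ?thesis
      using assms(2)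
      by (auto simp: continuous_map_in_subtopology continuous_map_componentwise
          intro: simplex_shift_in_standard_simplex)
  qed
  then show ?thesis
    using assms(1) continuous_map_compose
    by (auto simp: singular_simplex_def back_face_eq)
qed

lemma front_face_front_face: "p \<le> q \<Longrightarrow> front_face p (front_face q \<sigma>) = front_face p \<sigma>"
  using standard_simplex_mono[of p q] by (auto simp: front_face_def restrict_def fun_eq_iff)

lemma back_face_front_face:
  "p + q \<le> n \<Longrightarrow> back_face p q (front_face n \<sigma>) = back_face p q \<sigma>"
  by (auto simp: front_face_def back_face_eq restrict_def simplex_shift_in_standard_simplex)

lemma front_face_back_face: "p \<le> q \<Longrightarrow> front_face p (back_face r q \<sigma>) = back_face r p \<sigma>"
  using standard_simplex_mono[of p q]
  by (auto simp: front_face_def back_face_eq restrict_def fun_eq_iff)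

lemma simplex_shift_simplex_shift:
  "simplex_shift p (simplex_shift r x) = simplex_shift (p + r) x"
  by (auto simp: simplex_shift_def fun_eq_iff)

lemma back_face_back_face:
  "r + q \<le> m \<Longrightarrow> back_face r q (back_face p m \<sigma>) = back_face (p + r) q \<sigma>"
  by (auto simp: back_face_eq restrict_def simplex_shift_in_standard_simplex
      simplex_shift_simplex_shift)

text \<open>This and the next three lemmas sort the faces for the Leibniz rule: deleting vertex i of
  an (n+1)-simplex changes the front p-face when i \<le> p and affects only the back part when i >
  p.\<close>

lemma front_face_singular_face_le:
  assumes "i \<le> p" "p \<le> n"
  shows "front_face p (singular_face (Suc n) i \<sigma>) = singular_face (Suc p) i (front_face (Suc p) \<sigma>)"
  using assms standard_simplex_mono[OF assms(2)] simplical_face_in_standard_simplex[of "Suc p" i]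
  by (auto simp: front_face_def singular_face_def restrict_def fun_eq_iff)

lemma front_face_singular_face_gt:
  assumes "p < i" "p \<le> n"
  shows "front_face p (singular_face (Suc n) i \<sigma>) = front_face p \<sigma>"
proof -
  have *: "simplical_face i x = x" if "x \<in> standard_simplex p" for x
    using that assms(1) by (auto simp: simplical_face_def standard_simplex_def)
  show ?thesis
    unfolding fun_eq_iff using standard_simplex_mono[OF assms(2)]
    by (auto simp: front_face_def singular_face_def restrict_def *)
qed

lemma back_face_singular_face_le:
  assumes "i \<le> p" "p + q \<le> n"
  shows "back_face p q (singular_face (Suc n) i \<sigma>) = back_face (Suc p) q \<sigma>"
proof -
  have "simplical_face i (simplex_shift p x) = simplex_shift (Suc p) x" for x
    using assms(1) by (intro ext) (auto simp: simplical_face_def simplex_shift_def)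
  then show ?thesis
    using assms(2)
    by (auto simp: back_face_eq singular_face_def restrict_def simplex_shift_in_standard_simplex)
qed

lemma back_face_singular_face_ge:
  assumes "p + q \<le> n" "j \<le> Suc q"
  shows "back_face p q (singular_face (Suc n) (p + j) \<sigma>) =
    singular_face (Suc q) j (back_face p (Suc q) \<sigma>)"
proof -
  have "simplical_face (p + j) (simplex_shift p x) = simplex_shift p (simplical_face j x)" for x
    by (rule ext) (auto simp: simplical_face_def simplex_shift_def)
  then show ?thesis
    using assms simplical_face_in_standard_simplex[of "Suc q" j]
    by (auto simp: back_face_eq singular_face_def restrict_def simplex_shift_in_standard_simplex)
qed

lemma singular_face_front_face_last:
  "singular_face (Suc p) (Suc p) (front_face (Suc p) \<sigma>) = front_face p \<sigma>"
proof -
  have *: "simplical_face (Suc p) x = x" if "x \<in> standard_simplex p" for x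
    using that by (auto simp: simplical_face_def standard_simplex_def)
  show ?thesis
    unfolding fun_eq_iff using standard_simplex_mono[of p "Suc p"]
    by (auto simp: front_face_def singular_face_def restrict_def *)
qed

text \<open>At face p the ranges of \<open>back_face_singular_face_le\<close> and
  \<open>back_face_singular_face_ge\<close> overlap; comparing the two descriptions gives the
  claim.\<close>

lemma singular_face_back_face_zero:
  "singular_face (Suc q) 0 (back_face p (Suc q) \<sigma>) = back_face (Suc p) q \<sigma>"
  using back_face_singular_face_ge[of p q "p + q" 0 \<sigma>] back_face_singular_face_le[of p p q "p+q" \<sigma>]
  by simp

section \<open>Coboundary, Leibniz rule and associativity of the cup product\<close>

lemma coboundary_Suc:
  "singular_simplex (Suc n) X \<sigma> \<Longrightarrow>
    coboundary X c (Suc n) \<sigma> = (\<Sum>i\<le>Suc n. (-1) ^ i * c n (singular_face (Suc n) i \<sigma>))"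
  by (simp add: coboundary_def)

text \<open>A cochain carries all degrees at once, so the sign (-1)^p of the Leibniz rule is not a
  scalar factor and is encoded as the grading involution.\<close>

definition alternate :: "('a, 'k::comm_ring_1) cochain \<Rightarrow> ('a, 'k) cochain" where
  "alternate c = (\<lambda>p \<sigma>. (-1) ^ p * c p \<sigma>)"

abbreviation cochain_add ::
    "('a, 'k::comm_ring_1) cochain \<Rightarrow> ('a, 'k) cochain \<Rightarrow> ('a, 'k) cochain" where
  "cochain_add c d \<equiv> (\<lambda>p \<sigma>. c p \<sigma> + d p \<sigma>)"

lemma cochains_coboundary:
  assumes "c \<in> cochains X"
  shows "coboundary X c \<in> cochains X"
proof -
  have "{p. \<exists>\<sigma>. coboundary X c p \<sigma> \<noteq> 0} \<subseteq> Suc ` {p. \<exists>\<sigma>. c p \<sigma> \<noteq> 0}"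
  proof clarify
    fix p \<sigma> assume *: "coboundary X c p \<sigma> \<noteq> 0"
    then obtain n where n: "p = Suc n" "singular_simplex (Suc n) X \<sigma>"
      by (cases p) (auto simp: coboundary_def split: if_splits)
    with * have "(\<Sum>i\<le>Suc n. (-1) ^ i * c n (singular_face (Suc n) i \<sigma>)) \<noteq> 0"
      by (simp add: coboundary_def)
    then obtain i where "c n (singular_face (Suc n) i \<sigma>) \<noteq> 0"
      by (metis (no_types, lifting) mult_zero_right sum.neutral)
    with n show "p \<in> Suc ` {p. \<exists>\<sigma>. c p \<sigma> \<noteq> 0}" by auto
  qed
  then show ?thesis
    using assms finite_subset[of "{p. \<exists>\<sigma>. coboundary X c p \<sigma> \<noteq> 0}"]
    by (simp add: cochains_def) (simp add: coboundary_def)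
qed

lemma cochains_add: "c \<in> cochains X \<Longrightarrow> d \<in> cochains X \<Longrightarrow> cochain_add c d \<in> cochains X"
  unfolding cochains_def
  by (auto intro!: finite_subset[of "{p. \<exists>\<sigma>. c p \<sigma> + d p \<sigma> \<noteq> 0}" "{p. \<exists>\<sigma>. c p \<sigma> \<noteq> 0} \<union> {p. \<exists>\<sigma>. d p \<sigma> \<noteq> 0}"])

lemma cochains_uminus: "c \<in> cochains X \<Longrightarrow> (\<lambda>p \<sigma>. - c p \<sigma>) \<in> cochains X"
  by (simp add: cochains_def)

lemma cochains_alternate: "c \<in> cochains X \<Longrightarrow> alternate c \<in> cochains X"
  by (auto simp: cochains_def alternate_def elim!: rev_finite_subset)
    (metis mult_zero_right)

lemma cochains_cup:
  assumes "c \<in> cochains X" "d \<in> cochains X"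
  shows "cup X c d \<in> cochains X"
proof -
  let ?P = "{p. \<exists>\<sigma>. c p \<sigma> \<noteq> 0}" and ?Q = "{p. \<exists>\<sigma>. d p \<sigma> \<noteq> 0}"
  have "{n. \<exists>\<sigma>. cup X c d n \<sigma> \<noteq> 0} \<subseteq> (\<lambda>(p, q). p + q) ` (?P \<times> ?Q)"
  proof clarify
    fix n \<sigma> assume *: "cup X c d n \<sigma> \<noteq> 0"
    then have "(\<Sum>p\<le>n. c p (front_face p \<sigma>) * d (n - p) (back_face p (n - p) \<sigma>)) \<noteq> 0"
      by (auto simp: cup_def split: if_splits)
    then obtain p where p: "p \<le> n" "c p (front_face p \<sigma>) * d (n - p) (back_face p (n - p) \<sigma>) \<noteq> 0"
      by (meson sum.neutral atMost_iff)
    then have "p \<in> ?P" "n - p \<in> ?Q"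
      by (metis (mono_tags) mem_Collect_eq mult_zero_left, metis (mono_tags) mem_Collect_eq mult_zero_right)
    with p(1) show "n \<in> (\<lambda>(p, q). p + q) ` (?P \<times> ?Q)"
      by (intro image_eqI[where x="(p, n - p)"]) auto
  qed
  moreover have "finite ((\<lambda>(p, q). p + q) ` (?P \<times> ?Q))"
    using assms by (auto simp: cochains_def)
  ultimately show ?thesis
    using finite_subset[of "{n. \<exists>\<sigma>. cup X c d n \<sigma> \<noteq> 0}"]
    by (simp add: cochains_def) (simp add: cup_def)
qed

text \<open>Both sides sum over the ways to cut the vertices into three consecutive faces sharing
  endpoints. The change of summation order is that of the associativity of Cauchy products, whence
  the lemma on formal power series.\<close>

lemma cup_assoc: "cup X (cup X c d) e = cup X c (cup X d e)"
proof (intro ext)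
  fix n \<sigma>
  show "cup X (cup X c d) e n \<sigma> = cup X c (cup X d e) n \<sigma>"
  proof (cases "singular_simplex n X \<sigma>")
    case True
    define f where "f r q m = c r (front_face r \<sigma>) * d q (back_face r q \<sigma>) *
      e m (back_face (r + q) m \<sigma>)" for r q m
    have "cup X (cup X c d) e n \<sigma> = (\<Sum>p=0..n. \<Sum>r=0..p. f r (p - r) (n - p))"
      using True
      by (auto simp: cup_def f_def singular_simplex_front_face front_face_front_face
          back_face_front_face sum_distrib_right atLeast0AtMost intro!: sum.cong)
    also have "\<dots> = (\<Sum>r=0..n. \<Sum>q=0..n - r. f r q (n - r - q))"
      by (rule fps_mult_assoc_lemma)
    also have "\<dots> = cup X c (cup X d e) n \<sigma>"
      using True
      by (auto simp: cup_def f_def singular_simplex_back_face front_face_back_face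
          back_face_back_face sum_distrib_left atLeast0AtMost mult.assoc intro!: sum.cong)
    finally show ?thesis .
  qed (simp add: cup_def)
qed

text \<open>In the p-th summand of the cup product, face i of the simplex acts on the front factor
  when i \<le> p (terms \<open>L\<close>) and on the back factor when i = p + j with j > 0 (terms
  \<open>R\<close>). The sign of \<open>R\<close> splits into (-1)^p from \<open>alternate\<close>
  and (-1)^j from the coboundary of d.\<close>

lemma coboundary_cup:
  "coboundary X (cup X c d) =
    cochain_add (cup X (coboundary X c) d) (cup X (alternate c) (coboundary X d))"
proof (intro ext)
  fix m \<sigma>
  show "coboundary X (cup X c d) m \<sigma> =
    cup X (coboundary X c) d m \<sigma> + cup X (alternate c) (coboundary X d) m \<sigma>"
  proof (cases "m > 0 \<and> singular_simplex m X \<sigma>")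
    case False
    then show ?thesis
      by (auto simp: coboundary_def cup_def)
  next
    case True
    then obtain n where m: "m = Suc n" and \<sigma>: "singular_simplex (Suc n) X \<sigma>"
      by (auto simp: gr0_conv_Suc)
    define L where "L p i = (-1) ^ i * c p (singular_face (Suc p) i (front_face (Suc p) \<sigma>)) *
      d (n - p) (back_face (Suc p) (n - p) \<sigma>)" for p i
    define R where "R p j = (-1) ^ (p + j) * c p (front_face p \<sigma>) *
      d (n - p) (singular_face (Suc (n - p)) j (back_face p (Suc (n - p)) \<sigma>))" for p j
    have faces: "singular_simplex n X (singular_face (Suc n) i \<sigma>)" if "i \<le> Suc n" for i
      using singular_simplex_singular_face[OF \<sigma>, of i] that by simp
    have "coboundary X (cup X c d) m \<sigma> = (\<Sum>i\<le>Suc n. \<Sum>p\<le>n. (-1) ^ i *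
        (c p (front_face p (singular_face (Suc n) i \<sigma>)) *
         d (n - p) (back_face p (n - p) (singular_face (Suc n) i \<sigma>))))"
      unfolding m coboundary_Suc[OF \<sigma>]
      by (intro sum.cong refl) (simp add: cup_def faces sum_distrib_left)
    also have "\<dots> = (\<Sum>p\<le>n. \<Sum>i\<le>Suc n. (-1) ^ i *
        (c p (front_face p (singular_face (Suc n) i \<sigma>)) *
         d (n - p) (back_face p (n - p) (singular_face (Suc n) i \<sigma>))))"
      by (rule sum.swap)
    also have "\<dots> = (\<Sum>p\<le>n. (\<Sum>i\<le>p. L p i) + (\<Sum>j=1..Suc (n - p). R p j))"
    proof (intro sum.cong refl)
      fix p assume "p \<in> {..n}"
      then have p: "p \<le> n" by simp
      let ?f = "\<lambda>i. (-1) ^ i * (c p (front_face p (singular_face (Suc n) i \<sigma>)) *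
         d (n - p) (back_face p (n - p) (singular_face (Suc n) i \<sigma>)))"
      have "{..Suc n} = {..p} \<union> {Suc p..Suc n}"
        using p by auto
      then have "(\<Sum>i\<le>Suc n. ?f i) = (\<Sum>i\<le>p. ?f i) + (\<Sum>i=Suc p..Suc n. ?f i)"
        by (simp add: sum.union_disjoint)
      moreover have "(\<Sum>i\<le>p. ?f i) = (\<Sum>i\<le>p. L p i)"
        using p by (intro sum.cong refl)
          (simp add: L_def front_face_singular_face_le back_face_singular_face_le mult.assoc)
      moreover have "(\<Sum>i=Suc p..Suc n. ?f i) = (\<Sum>j=1..Suc (n - p). ?f (p + j))"
        using p by (intro sum.reindex_bij_witness[where i="\<lambda>j. p + j" and j="\<lambda>i. i - p"]) auto
      moreover have "(\<Sum>j=1..Suc (n - p). ?f (p + j)) = (\<Sum>j=1..Suc (n - p). R p j)"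
        using p by (intro sum.cong refl)
          (simp add: R_def front_face_singular_face_gt back_face_singular_face_ge mult.assoc)
      ultimately show "(\<Sum>i\<le>Suc n. ?f i) = (\<Sum>i\<le>p. L p i) + (\<Sum>j=1..Suc (n - p). R p j)"
        by simp
    qed
    also have "\<dots> = (\<Sum>p\<le>n. (\<Sum>i\<le>Suc p. L p i) + (\<Sum>j\<le>Suc (n - p). R p j))"
    proof (intro sum.cong refl)
      fix p
      \<comment> \<open>These are the terms missing from the two full coboundaries: the last face of
        the front part and the zeroth face of the back part give the same product with opposite
        signs, so both may be added.\<close>
      have "L p (Suc p) = - R p 0"
        by (simp add: L_def R_def singular_face_front_face_last singular_face_back_face_zero)
      moreover have "{..Suc (n - p)} = insert 0 {1..Suc (n - p)}" by auto
      ultimately show "(\<Sum>i\<le>p. L p i) + (\<Sum>j=1..Suc (n - p). R p j) =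
          (\<Sum>i\<le>Suc p. L p i) + (\<Sum>j\<le>Suc (n - p). R p j)"
        by simp
    qed
    also have "\<dots> = (\<Sum>p\<le>n. \<Sum>i\<le>Suc p. L p i) + (\<Sum>p\<le>n. \<Sum>j\<le>Suc (n - p). R p j)"
      by (rule sum.distrib)
    also have "(\<Sum>p\<le>n. \<Sum>i\<le>Suc p. L p i) = cup X (coboundary X c) d m \<sigma>"
    proof -
      have "cup X (coboundary X c) d m \<sigma> = (\<Sum>p\<le>Suc n. coboundary X c p (front_face p \<sigma>) *
          d (Suc n - p) (back_face p (Suc n - p) \<sigma>))"
        using \<sigma> by (simp add: cup_def m)
      \<comment> \<open>The term p = 0 drops out because a coboundary vanishes in degree 0; in the
        other half the term p = Suc n drops out for the same reason.\<close>
      also have "\<dots> = (\<Sum>p\<le>n. coboundary X c (Suc p) (front_face (Suc p) \<sigma>) *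
          d (n - p) (back_face (Suc p) (n - p) \<sigma>))"
        by (subst sum.atMost_Suc_shift) (simp add: coboundary_def)
      also have "\<dots> = (\<Sum>p\<le>n. \<Sum>i\<le>Suc p. L p i)"
        using \<sigma> by (intro sum.cong refl)
          (simp only: atMost_iff coboundary_Suc singular_simplex_front_face Suc_le_mono
            sum_distrib_right L_def)
      finally show ?thesis by simp
    qed
    also have "(\<Sum>p\<le>n. \<Sum>j\<le>Suc (n - p). R p j) = cup X (alternate c) (coboundary X d) m \<sigma>"
    proof -
      have "cup X (alternate c) (coboundary X d) m \<sigma> = (\<Sum>p\<le>Suc n. alternate c p (front_face p \<sigma>) *
          coboundary X d (Suc n - p) (back_face p (Suc n - p) \<sigma>))"
        using \<sigma> by (simp add: cup_def m)
      also have "\<dots> = (\<Sum>p\<le>n. alternate c p (front_face p \<sigma>) *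
          coboundary X d (Suc n - p) (back_face p (Suc n - p) \<sigma>))"
        by (simp add: coboundary_def)
      also have "\<dots> = (\<Sum>p\<le>n. \<Sum>j\<le>Suc (n - p). R p j)"
      proof (intro sum.cong refl)
        fix p assume "p \<in> {..n}"
        then have p: "Suc n - p = Suc (n - p)" "p + Suc (n - p) \<le> Suc n" by auto
        show "alternate c p (front_face p \<sigma>) *
            coboundary X d (Suc n - p) (back_face p (Suc n - p) \<sigma>) = (\<Sum>j\<le>Suc (n - p). R p j)"
          unfolding p(1) coboundary_Suc[OF singular_simplex_back_face[OF \<sigma> p(2)]] sum_distrib_left
          by (intro sum.cong refl) (simp add: R_def alternate_def power_add mult_ac)
      qed
      finally show ?thesis by simp
    qed
    finally show ?thesis .
  qed
qed

lemma singular_face_singular_face':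
  assumes "j \<le> i" "i \<le> Suc n"
  shows "singular_face (Suc n) j (singular_face (Suc (Suc n)) (Suc i) \<sigma>) =
    singular_face (Suc n) i (singular_face (Suc (Suc n)) j \<sigma>)"
proof -
  have *: "simplical_face (Suc i) (simplical_face j x) = simplical_face j (simplical_face i x)"
    for x :: "nat \<Rightarrow> real"
    using assms(1) by (auto simp: simplical_face_def fun_eq_iff)
  show ?thesis
    unfolding fun_eq_iff using assms simplical_face_in_standard_simplex[of "Suc n"]
    by (auto simp: singular_face_def restrict_def *)
qed

text \<open>Pairs (i, j) of successive faces split into those with j < i and those with i \<le> j.
  By the simplicial identity a pair (i, j) of the first kind gives the same face as the pair (j, i -
  1) of the second kind, and the exponents differ by one.\<close>

lemma coboundary_coboundary: "coboundary X (coboundary X c) = (\<lambda>p \<sigma>. 0)"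
proof (intro ext)
  fix m \<sigma>
  show "coboundary X (coboundary X c) m \<sigma> = 0"
  proof (cases "singular_simplex m X \<sigma> \<and> m > 1")
    case False
    have 0: "coboundary X c 0 = (\<lambda>\<tau>. 0)" by (simp add: coboundary_def)
    from False have "m - 1 = 0 \<or> \<not> singular_simplex m X \<sigma>" by linarith
    then show ?thesis
      unfolding coboundary_def[of X "coboundary X c"] using 0 by auto
  next
    case True
    then obtain n where m: "m = Suc (Suc n)"
      using less_imp_Suc_add[of 1 m] by auto
    with True have \<sigma>: "singular_simplex (Suc (Suc n)) X \<sigma>" by simp
    define F where "F i j = (-1) ^ (i + j) *
      c n (singular_face (Suc n) j (singular_face (Suc (Suc n)) i \<sigma>))" for i j
    let ?A = "{..Suc (Suc n)} \<times> {..Suc n}"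
    let ?B = "?A \<inter> {(i, j). j < i}" and ?C = "?A - {(i, j). j < i}"
    have "coboundary X (coboundary X c) m \<sigma> = (\<Sum>i\<le>Suc (Suc n). \<Sum>j\<le>Suc n. F i j)"
      unfolding m coboundary_Suc[OF \<sigma>]
    proof (intro sum.cong refl)
      fix i assume "i \<in> {..Suc (Suc n)}"
      then have "singular_simplex (Suc n) X (singular_face (Suc (Suc n)) i \<sigma>)"
        using singular_simplex_singular_face[OF \<sigma>, of i] by simp
      then show "(-1) ^ i * coboundary X c (Suc n) (singular_face (Suc (Suc n)) i \<sigma>) =
          (\<Sum>j\<le>Suc n. F i j)"
        by (simp only: coboundary_Suc sum_distrib_left F_def power_add mult.assoc)
    qed
    also have "\<dots> = (\<Sum>(i, j)\<in>?A. F i j)"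
      by (rule sum.cartesian_product)
    also have "\<dots> = (\<Sum>(i, j)\<in>?B. F i j) + (\<Sum>(i, j)\<in>?C. F i j)"
      by (rule sum.Int_Diff) (intro finite_cartesian_product finite_atMost)
    also have "(\<Sum>(i, j)\<in>?B. F i j) = (\<Sum>(i, j)\<in>?C. - F i j)"
    proof (rule sum.reindex_bij_witness[where i="\<lambda>(i, j). (Suc j, i)" and j="\<lambda>(i, j). (j, i - 1)"])
      fix x assume "x \<in> ?B"
      then obtain i' j where *: "x = (i', j)" "i' \<le> Suc (Suc n)" "j < i'"
        by (cases x) (simp only: Int_iff mem_Sigma_iff atMost_iff mem_Collect_eq prod.case)
      then have x: "x = (Suc (i' - 1), j)" "j \<le> i' - 1" "i' - 1 \<le> Suc n" by simp_all
      show "(case (case x of (i, j) \<Rightarrow> (j, i - 1)) of (i, j) \<Rightarrow> - F i j) = (case x of (i, j) \<Rightarrow> F i j)"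
        using x by (simp only: F_def singular_face_singular_face' prod.case add.commute diff_Suc_1
            power_add power_Suc mult_minus1 mult_minus_left mult_minus_right minus_minus mult.commute)
          simp
      show "(case (case x of (i, j) \<Rightarrow> (j, i - 1)) of (i, j) \<Rightarrow> (Suc j, i)) = x"
        "(case x of (i, j) \<Rightarrow> (j, i - 1)) \<in> ?C"
        using x by (simp_all only: prod.case diff_Suc_1) simp
    next
      fix x assume "x \<in> ?C"
      then obtain i j where x: "x = (i, j)" "i \<le> j" "j \<le> Suc n"
        by (cases x) (simp only: Diff_iff mem_Sigma_iff atMost_iff mem_Collect_eq prod.case not_less)
      show "(case (case x of (i, j) \<Rightarrow> (Suc j, i)) of (i, j) \<Rightarrow> (j, i - 1)) = x"
        "(case x of (i, j) \<Rightarrow> (Suc j, i)) \<in> ?B"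
        using x by (simp_all only: prod.case diff_Suc_1) simp
    qed
    finally show ?thesis
      by (simp add: sum_negf case_prod_unfold)
  qed
qed

lemma coboundary_add:
  "coboundary X (cochain_add c d) = cochain_add (coboundary X c) (coboundary X d)"
  by (auto simp: coboundary_def fun_eq_iff sum.distrib distrib_left)

lemma coboundary_uminus: "coboundary X (\<lambda>p \<sigma>. - c p \<sigma>) = (\<lambda>p \<sigma>. - coboundary X c p \<sigma>)"
  by (auto simp: coboundary_def fun_eq_iff sum_negf)

text \<open>The coboundary raises the degree by one, which costs one sign. In particular
  \<open>alternate\<close> preserves cocycles, as used when a cocycle is multiplied by a coboundary
  from the right.\<close>

lemma coboundary_alternate:
  "coboundary X (alternate c) = (\<lambda>p \<sigma>. - alternate (coboundary X c) p \<sigma>)"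
proof (intro ext)
  fix p \<sigma>
  show "coboundary X (alternate c) p \<sigma> = - alternate (coboundary X c) p \<sigma>"
    by (cases p) (simp_all add: coboundary_def alternate_def sum_distrib_left mult_ac power_Suc
        del: sum.atMost_Suc flip: sum_negf)
qed

section \<open>Cohomology rings and pull-backs\<close>

abbreviation cochain_one :: "'a topology \<Rightarrow> ('a, 'k::comm_ring_1) cochain" where
  "cochain_one X \<equiv> (\<lambda>p \<sigma>. if p = 0 \<and> singular_simplex 0 X \<sigma> then 1 else 0)"

lemma cocycle_ring_simps [simp]:
  "carrier (cocycle_ring X) = {c \<in> cochains X. coboundary X c = (\<lambda>p \<sigma>. 0)}"
  "c \<otimes>\<^bsub>cocycle_ring X\<^esub> d = cup X c d"
  "c \<oplus>\<^bsub>cocycle_ring X\<^esub> d = cochain_add c d"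
  "\<zero>\<^bsub>cocycle_ring X\<^esub> = (\<lambda>p \<sigma>. 0)"
  "\<one>\<^bsub>cocycle_ring X\<^esub> = (cochain_one X)"
  by (simp_all add: cocycle_ring_def cochain_ring_def)

lemma front_face_self: "singular_simplex n X \<sigma> \<Longrightarrow> front_face n \<sigma> = \<sigma>"
  by (auto simp: singular_simplex_def front_face_def extensional_restrict)

lemma back_face_self: "singular_simplex n X \<sigma> \<Longrightarrow> back_face 0 n \<sigma> = \<sigma>"
  by (auto simp: singular_simplex_def back_face_def extensional_restrict)

lemma cup_one_left:
  assumes "c \<in> cochains X"
  shows "cup X (cochain_one X) c = c"
proof (intro ext)
  fix n \<sigma>
  show "cup X (cochain_one X) c n \<sigma> = c n \<sigma>"
  proof (cases "singular_simplex n X \<sigma>")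
    case True
    have "(\<Sum>p\<le>n. (if p = 0 \<and> singular_simplex 0 X (front_face p \<sigma>) then 1 else 0) *
        c (n - p) (back_face p (n - p) \<sigma>)) = (\<Sum>p\<in>{0}. c (n - p) (back_face p (n - p) \<sigma>))"
      using singular_simplex_front_face[OF True, of 0] by (intro sum.mono_neutral_cong_right) auto
    then show ?thesis
      using True by (simp add: cup_def back_face_self)
  qed (use assms in \<open>simp add: cup_def cochains_def\<close>)
qed

lemma cup_one_right:
  assumes "c \<in> cochains X"
  shows "cup X c (cochain_one X) = c"
proof (intro ext)
  fix n \<sigma>
  show "cup X c (cochain_one X) n \<sigma> = c n \<sigma>"
  proof (cases "singular_simplex n X \<sigma>")
    case True
    have "(\<Sum>p\<le>n. c p (front_face p \<sigma>) *
        (if n - p = 0 \<and> singular_simplex 0 X (back_face p (n - p) \<sigma>) then 1 else 0)) =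
        (\<Sum>p\<in>{n}. c p (front_face p \<sigma>))"
      using singular_simplex_back_face[OF True, of n 0] by (intro sum.mono_neutral_cong_right) auto
    then show ?thesis
      using True by (simp add: cup_def front_face_self)
  qed (use assms in \<open>simp add: cup_def cochains_def\<close>)
qed

lemma cup_add_left: "cup X (cochain_add c d) e = cochain_add (cup X c e) (cup X d e)"
  by (auto simp: cup_def fun_eq_iff distrib_right sum.distrib)

lemma cup_add_right: "cup X c (cochain_add d e) = cochain_add (cup X c d) (cup X c e)"
  by (auto simp: cup_def fun_eq_iff distrib_left sum.distrib)

lemma cup_zero_left: "cup X (\<lambda>p \<sigma>. 0) c = (\<lambda>p \<sigma>. 0)"
  by (auto simp: cup_def fun_eq_iff)

lemma cup_zero_right: "cup X c (\<lambda>p \<sigma>. 0) = (\<lambda>p \<sigma>. 0)"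
  by (auto simp: cup_def fun_eq_iff)

lemma cochains_zero: "(\<lambda>p \<sigma>. 0) \<in> cochains X"
  by (simp add: cochains_def)

lemma coboundary_zero: "coboundary X (\<lambda>p \<sigma>. 0) = (\<lambda>p \<sigma>. 0)"
  by (auto simp: coboundary_def fun_eq_iff)

lemma cochains_one: "(cochain_one X :: ('a, 'k::comm_ring_1) cochain) \<in> cochains X"
proof -
  have "{p. \<exists>\<sigma>. (cochain_one X :: ('a, 'k) cochain) p \<sigma> \<noteq> 0} \<subseteq> {0}"
    by auto
  then show ?thesis
    using finite_subset by (force simp: cochains_def)
qed

text \<open>Only degree 1 is at issue: both endpoints of a path take the value 1 and enter with
  opposite signs.\<close>

lemma coboundary_one:
  "coboundary X (cochain_one X :: ('a, 'k::comm_ring_1) cochain) = (\<lambda>p \<sigma>. 0)"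
proof (intro ext)
  fix p \<sigma>
  show "coboundary X (cochain_one X :: ('a, 'k) cochain) p \<sigma> = 0"
  proof (cases "p = Suc 0 \<and> singular_simplex p X \<sigma>")
    case True
    then have "singular_simplex 0 X (singular_face (Suc 0) i \<sigma>)" if "i \<le> Suc 0" for i
      using singular_simplex_singular_face[of "Suc 0" X \<sigma> i] that by auto
    with True show ?thesis by (simp add: coboundary_def)
  next
    case False
    then show ?thesis by (cases "p = 0"; cases "p = Suc 0") (auto simp: coboundary_def)
  qed
qed

lemma ring_cocycle_ring: "ring (cocycle_ring X)"
proof (rule ringI)
  show "abelian_group (cocycle_ring X)"
  proof (rule abelian_groupI)
    fix c assume c: "c \<in> carrier (cocycle_ring X)"
    show "\<exists>d\<in>carrier (cocycle_ring X). d \<oplus>\<^bsub>cocycle_ring X\<^esub> c = \<zero>\<^bsub>cocycle_ring X\<^esub>"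
      using c by (intro bexI[where x="\<lambda>p \<sigma>. - c p \<sigma>"])
        (auto simp: cochains_uminus coboundary_uminus fun_eq_iff)
  qed (auto simp: cochains_add coboundary_add cochains_zero coboundary_zero fun_eq_iff algebra_simps)
  show "monoid (cocycle_ring X)"
    by (rule monoidI) (auto simp: cochains_cup coboundary_cup cochains_one coboundary_one
        cup_zero_left cup_zero_right cup_assoc cup_one_left cup_one_right)
qed (auto simp: cup_add_left cup_add_right)

lemma ideal_coboundaries:
  "ideal (coboundaries X) (cocycle_ring X :: ('a, 'k::comm_ring_1) cochain ring)"
proof (rule idealI)
  interpret ring "cocycle_ring X :: ('a, 'k) cochain ring" by (rule ring_cocycle_ring)
  show "ring (cocycle_ring X :: ('a, 'k) cochain ring)" by (rule ring_axioms)
  show "subgroup (coboundaries X) (add_monoid (cocycle_ring X :: ('a, 'k) cochain ring))"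
  proof (rule add.subgroupI)
    show "coboundaries X \<subseteq> carrier (cocycle_ring X :: ('a, 'k) cochain ring)"
      by (auto simp: coboundaries_def cochains_coboundary coboundary_coboundary)
    show "coboundaries X \<noteq> ({} :: ('a, 'k) cochain set)"
      using cochains_zero by (auto simp: coboundaries_def)
    fix a :: "('a, 'k) cochain" assume "a \<in> coboundaries X"
    then obtain c where c: "c \<in> cochains X" "a = coboundary X c"
      by (auto simp: coboundaries_def)
    have "\<ominus>\<^bsub>cocycle_ring X\<^esub> a = (\<lambda>p \<sigma>. - a p \<sigma>)"
      by (rule minus_equality)
        (auto simp: c cochains_coboundary coboundary_coboundary cochains_uminus coboundary_uminus)
    then show "\<ominus>\<^bsub>cocycle_ring X\<^esub> a \<in> coboundaries X"
      using c cochains_uminus[OF c(1)] by (auto simp: coboundaries_def simp flip: coboundary_uminus)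
  next
    fix a b :: "('a, 'k) cochain" assume "a \<in> coboundaries X" "b \<in> coboundaries X"
    then show "a \<oplus>\<^bsub>cocycle_ring X\<^esub> b \<in> coboundaries X"
      by (auto simp: coboundaries_def simp flip: coboundary_add intro: cochains_add)
  qed
next
  fix a x :: "('a, 'k) cochain" assume "a \<in> coboundaries X" and x: "x \<in> carrier (cocycle_ring X)"
  then obtain c where c: "c \<in> cochains X" "a = coboundary X c"
    by (auto simp: coboundaries_def)
  \<comment> \<open>The Leibniz rule applies \<open>alternate\<close> to its left factor, so the
    sign is put on x in advance and cancels.\<close>
  have "coboundary X (cup X (alternate x) c) = cup X x a"
  proof -
    have "alternate (alternate x) = x"
      by (simp add: alternate_def flip: power_add mult.assoc)
    moreover have "coboundary X (alternate x) = (\<lambda>p \<sigma>. 0)"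
      using x by (simp add: coboundary_alternate) (simp add: alternate_def)
    ultimately show ?thesis
      by (simp add: coboundary_cup cup_zero_left c)
  qed
  moreover have "cup X (alternate x) c \<in> cochains X"
    using x c by (simp add: cochains_cup cochains_alternate)
  ultimately show "x \<otimes>\<^bsub>cocycle_ring X\<^esub> a \<in> coboundaries X"
    unfolding coboundaries_def cocycle_ring_simps by (rule image_eqI[OF sym])
  have "coboundary X (cup X c x) = cup X a x"
    using x by (simp add: coboundary_cup cup_zero_right c)
  moreover have "cup X c x \<in> cochains X"
    using x c by (simp add: cochains_cup)
  ultimately show "a \<otimes>\<^bsub>cocycle_ring X\<^esub> x \<in> coboundaries X"
    unfolding coboundaries_def cocycle_ring_simps by (rule image_eqI[OF sym])
qed

lemma ring_cohomology: "ring (cohomology X)"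
  unfolding cohomology_def by (rule ideal.quotient_is_ring[OF ideal_coboundaries])

text \<open>Maps out of a quotient are unions over representatives. Two representatives differ by an
  element of I, whose image lies in J, so the union runs over copies of a single coset, and it is
  nonempty because a represents its own coset.\<close>

lemma Union_coset_ring_hom:
  assumes I: "ideal I R" and J: "ideal J S" and h: "h \<in> ring_hom R S" "h ` I \<subseteq> J"
    and a: "a \<in> carrier R"
  shows "(\<Union>c\<in>I +>\<^bsub>R\<^esub> a. J +>\<^bsub>S\<^esub> h c) = J +>\<^bsub>S\<^esub> h a"
proof -
  interpret I: ideal I R by fact
  interpret J: ideal J S by fact
  have "J +>\<^bsub>S\<^esub> h c = J +>\<^bsub>S\<^esub> h a" if c: "c \<in> I +>\<^bsub>R\<^esub> a" for c
  proof -
    obtain i where i: "i \<in> I" "c = i \<oplus>\<^bsub>R\<^esub> a"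
      using c by (auto simp: a_r_coset_def r_coset_def)
    then have "h c = h i \<oplus>\<^bsub>S\<^esub> h a"
      using h(1) a I.a_Hcarr by (simp add: ring_hom_add)
    moreover have "h i \<in> J" using h(2) i by auto
    ultimately have "h c \<in> J +>\<^bsub>S\<^esub> h a"
      by (auto simp: a_r_coset_def r_coset_def)
    then show ?thesis
      using J.a_repr_independence' h(1) a by (simp add: ring_hom_closed)
  qed
  moreover have "a \<in> I +>\<^bsub>R\<^esub> a"
    using a by (rule I.a_rcos_self)
  ultimately show ?thesis by blast
qed

lemma ring_hom_Quot:
  assumes I: "ideal I R" and J: "ideal J S" and h: "h \<in> ring_hom R S" "h ` I \<subseteq> J"
  shows "(\<lambda>A. \<Union>c\<in>A. J +>\<^bsub>S\<^esub> h c) \<in> ring_hom (R Quot I) (S Quot J)"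
proof -
  interpret I: ideal I R by fact
  interpret J: ideal J S by fact
  interpret QJ: ring "S Quot J" by (rule J.quotient_is_ring)
  note U = Union_coset_ring_hom[OF I J h]
  note homI = I.rcos_ring_hom and homJ = J.rcos_ring_hom
  have rep: "\<exists>a\<in>carrier R. A = I +>\<^bsub>R\<^esub> a" if "A \<in> carrier (R Quot I)" for A
    using that by (auto simp: FactRing_simps)
  have *: "(\<Union>c\<in>(I +>\<^bsub>R\<^esub> a) \<otimes>\<^bsub>R Quot I\<^esub> (I +>\<^bsub>R\<^esub> b). J +>\<^bsub>S\<^esub> h c) =
      (J +>\<^bsub>S\<^esub> h a) \<otimes>\<^bsub>S Quot J\<^esub> (J +>\<^bsub>S\<^esub> h b)"
    "(\<Union>c\<in>(I +>\<^bsub>R\<^esub> a) \<oplus>\<^bsub>R Quot I\<^esub> (I +>\<^bsub>R\<^esub> b). J +>\<^bsub>S\<^esub> h c) =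
      (J +>\<^bsub>S\<^esub> h a) \<oplus>\<^bsub>S Quot J\<^esub> (J +>\<^bsub>S\<^esub> h b)"
    if "a \<in> carrier R" "b \<in> carrier R" for a b
    using that h(1)
    by (simp_all flip: ring_hom_mult[OF homI] ring_hom_add[OF homI] ring_hom_mult[OF homJ]
        ring_hom_add[OF homJ] add: U ring_hom_closed ring_hom_mult ring_hom_add)
  have one: "(\<Union>c\<in>\<one>\<^bsub>R Quot I\<^esub>. J +>\<^bsub>S\<^esub> h c) = \<one>\<^bsub>S Quot J\<^esub>"
    using h(1) by (simp flip: ring_hom_one[OF homI] ring_hom_one[OF homJ] add: U ring_hom_one)
  show ?thesis
  proof (rule ring_hom_memI)
    fix A assume "A \<in> carrier (R Quot I)"
    then obtain a where "a \<in> carrier R" "A = I +>\<^bsub>R\<^esub> a" using rep by blast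
    then show "(\<Union>c\<in>A. J +>\<^bsub>S\<^esub> h c) \<in> carrier (S Quot J)"
      using h(1) by (simp add: U ring_hom_closed ring_hom_closed[OF homJ])
  next
    fix A B assume "A \<in> carrier (R Quot I)" "B \<in> carrier (R Quot I)"
    then obtain a b where "a \<in> carrier R" "A = I +>\<^bsub>R\<^esub> a" "b \<in> carrier R" "B = I +>\<^bsub>R\<^esub> b"
      using rep by blast
    then show "(\<Union>c\<in>A \<otimes>\<^bsub>R Quot I\<^esub> B. J +>\<^bsub>S\<^esub> h c) =
        (\<Union>c\<in>A. J +>\<^bsub>S\<^esub> h c) \<otimes>\<^bsub>S Quot J\<^esub> (\<Union>c\<in>B. J +>\<^bsub>S\<^esub> h c)"
      "(\<Union>c\<in>A \<oplus>\<^bsub>R Quot I\<^esub> B. J +>\<^bsub>S\<^esub> h c) =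
        (\<Union>c\<in>A. J +>\<^bsub>S\<^esub> h c) \<oplus>\<^bsub>S Quot J\<^esub> (\<Union>c\<in>B. J +>\<^bsub>S\<^esub> h c)"
      using * by (simp_all add: U)
  qed (rule one)
qed

section \<open>Functoriality of pull-backs\<close>

lemma simplex_map_front_face:
  "p \<le> n \<Longrightarrow> front_face p (simplex_map n f \<sigma>) = simplex_map p f (front_face p \<sigma>)"
  unfolding fun_eq_iff using standard_simplex_mono[of p n]
  by (auto simp: front_face_def simplex_map_def restrict_def)

lemma simplex_map_back_face:
  "p + q \<le> n \<Longrightarrow> back_face p q (simplex_map n f \<sigma>) = simplex_map q f (back_face p q \<sigma>)"
  unfolding fun_eq_iff
  by (auto simp: back_face_eq simplex_map_def restrict_def simplex_shift_in_standard_simplex)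

lemma simplex_map_singular_face:
  "i \<le> Suc n \<Longrightarrow> singular_face (Suc n) i (simplex_map (Suc n) f \<sigma>) =
    simplex_map n f (singular_face (Suc n) i \<sigma>)"
  unfolding fun_eq_iff using simplical_face_in_standard_simplex[of "Suc n" i]
  by (auto simp: singular_face_def simplex_map_def restrict_def)

lemma cochain_pullback_in_cochains:
  assumes "c \<in> cochains Y"
  shows "cochain_pullback X f c \<in> cochains X"
proof -
  have "{p. \<exists>\<sigma>. cochain_pullback X f c p \<sigma> \<noteq> 0} \<subseteq> {p. \<exists>\<sigma>. c p \<sigma> \<noteq> 0}"
    by (auto simp: cochain_pullback_def split: if_splits)
  then show ?thesis
    using assms finite_subset[of "{p. \<exists>\<sigma>. cochain_pullback X f c p \<sigma> \<noteq> 0}"]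
    by (simp add: cochains_def) (simp add: cochain_pullback_def)
qed

lemma cochain_pullback_coboundary:
  assumes f: "continuous_map X Y f"
  shows "cochain_pullback X f (coboundary Y c) = coboundary X (cochain_pullback X f c)"
proof (intro ext)
  fix m \<sigma>
  show "cochain_pullback X f (coboundary Y c) m \<sigma> = coboundary X (cochain_pullback X f c) m \<sigma>"
  proof (cases "0 < m \<and> singular_simplex m X \<sigma>")
    case True
    then obtain n where m: "m = Suc n" by (auto simp: gr0_conv_Suc)
    with True have \<sigma>: "singular_simplex (Suc n) X \<sigma>" by simp
    have "singular_simplex n X (singular_face (Suc n) i \<sigma>)" if "i \<le> Suc n" for i
      using singular_simplex_singular_face[OF \<sigma>, of i] that by simp
    with \<sigma> show ?thesis
      unfolding m coboundary_Suc[OF \<sigma>]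
      by (simp add: cochain_pullback_def coboundary_Suc[OF singular_simplex_simplex_map[OF \<sigma> f]]
          simplex_map_singular_face del: sum.atMost_Suc)
  qed (auto simp: cochain_pullback_def coboundary_def)
qed

lemma cochain_pullback_cup:
  assumes f: "continuous_map X Y f"
  shows "cochain_pullback X f (cup Y c d) = cup X (cochain_pullback X f c) (cochain_pullback X f d)"
proof (intro ext)
  fix n \<sigma>
  show "cochain_pullback X f (cup Y c d) n \<sigma> =
    cup X (cochain_pullback X f c) (cochain_pullback X f d) n \<sigma>"
    by (auto simp: cochain_pullback_def cup_def singular_simplex_simplex_map[OF _ f]
        simplex_map_front_face simplex_map_back_face singular_simplex_front_face
        singular_simplex_back_face)
qed

lemma ring_hom_cochain_pullback:
  assumes f: "continuous_map X Y f"
  shows "cochain_pullback X f \<in> ring_hom (cocycle_ring Y) (cocycle_ring X)"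
proof (rule ring_hom_memI)
  have zero: "cochain_pullback X f (\<lambda>p \<sigma>. 0) = (\<lambda>p \<sigma>. 0)"
    by (simp add: cochain_pullback_def fun_eq_iff)
  show "cochain_pullback X f c \<in> carrier (cocycle_ring X)" if "c \<in> carrier (cocycle_ring Y)" for c
    using that zero
    by (auto simp: cochain_pullback_in_cochains simp flip: cochain_pullback_coboundary[OF f])
  show "cochain_pullback X f \<one>\<^bsub>cocycle_ring Y\<^esub> = \<one>\<^bsub>cocycle_ring X\<^esub>"
    using singular_simplex_simplex_map[OF _ f] by (auto simp: cochain_pullback_def fun_eq_iff)
qed (auto simp: cochain_pullback_cup[OF f], auto simp: cochain_pullback_def fun_eq_iff)

lemma cochain_pullback_coboundaries:
  assumes f: "continuous_map X Y f"
  shows "cochain_pullback X f ` coboundaries Y \<subseteq> coboundaries X"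
  by (auto simp: coboundaries_def cochain_pullback_coboundary[OF f] intro: cochain_pullback_in_cochains)

lemma ring_hom_pullback:
  assumes f: "continuous_map X Y f"
  shows "pullback X f \<in> ring_hom
    (cohomology Y :: ('b, 'k::comm_ring_1) cochain set ring) (cohomology X)"
proof -
  have "(pullback X f :: ('b, 'k) cochain set \<Rightarrow> _) =
      (\<lambda>A. \<Union>c\<in>A. coboundaries X +>\<^bsub>cocycle_ring X\<^esub> cochain_pullback X f c)"
    by (intro ext) (simp add: pullback_def)
  then show ?thesis
    unfolding cohomology_def
    using ring_hom_Quot[OF ideal_coboundaries ideal_coboundaries ring_hom_cochain_pullback[OF f]
        cochain_pullback_coboundaries[OF f]]
    by simp
qed

lemma pullback_coset:
  assumes f: "continuous_map X Y f" and c: "c \<in> carrier (cocycle_ring Y)"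
  shows "pullback X f (coboundaries Y +>\<^bsub>cocycle_ring Y\<^esub> c) =
    coboundaries X +>\<^bsub>cocycle_ring X\<^esub> cochain_pullback X f c"
  unfolding pullback_def
  by (rule Union_coset_ring_hom[OF ideal_coboundaries ideal_coboundaries
        ring_hom_cochain_pullback[OF f] cochain_pullback_coboundaries[OF f] c])

lemma carrier_cohomologyE:
  assumes "A \<in> carrier (cohomology X)"
  obtains c where "c \<in> carrier (cocycle_ring X)" "A = coboundaries X +>\<^bsub>cocycle_ring X\<^esub> c"
  using assms that unfolding cohomology_def FactRing_def A_RCOSETS_def' by auto

text \<open>Singular simplices take values in the space, so only these count. This matters for maps
  such as \<open>rho\<close>, which are described by a representative only on sets that are
  orbits.\<close>

lemma pullback_cong:
  assumes "\<And>x. x \<in> topspace X \<Longrightarrow> f x = g x"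
  shows "pullback X f A = pullback X g A"
proof -
  have "cochain_pullback X f c = cochain_pullback X g c" for c :: "('b, 'c) cochain"
    unfolding cochain_pullback_def using simplex_map_eq[of _ X _ f g] assms by (intro ext) simp
  then show ?thesis by (simp add: pullback_def)
qed

text \<open>On an arbitrary set of cochains \<open>pullback\<close> is a union of cosets; on a class
  it is the single coset of a pulled back representative, and representatives compose
  strictly.\<close>

lemma pullback_compose:
  assumes f: "continuous_map X Y f" and g: "continuous_map Y Z g"
    and A: "A \<in> carrier (cohomology Z)"
  shows "pullback X f (pullback Y g A) = pullback X (g \<circ> f) A"
proof -
  obtain c where c: "c \<in> carrier (cocycle_ring Z)" "A = coboundaries Z +>\<^bsub>cocycle_ring Z\<^esub> c"
    using A by (rule carrier_cohomologyE)
  have "cochain_pullback X f (cochain_pullback Y g c) = cochain_pullback X (g \<circ> f) c"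
    using singular_simplex_simplex_map[OF _ f]
    by (auto simp: cochain_pullback_def fun_eq_iff simplex_map_compose)
  moreover have "cochain_pullback Y g c \<in> carrier (cocycle_ring Y)"
    using ring_hom_closed[OF ring_hom_cochain_pullback[OF g] c(1)] .
  ultimately show ?thesis
    using c f g by (simp only: pullback_coset continuous_map_compose)
qed

lemma pullback_ident:
  assumes "\<And>x. x \<in> topspace X \<Longrightarrow> f x = x" and A: "A \<in> carrier (cohomology X)"
  shows "pullback X f A = A"
proof -
  obtain c where c: "c \<in> carrier (cocycle_ring X)" "A = coboundaries X +>\<^bsub>cocycle_ring X\<^esub> c"
    using A by (rule carrier_cohomologyE)
  have "cochain_pullback X (\<lambda>x. x) c = c"
    unfolding cochain_pullback_def using c(1) simplex_map_id_gen[of _ X _ "\<lambda>x. x"]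
    by (intro ext) (simp add: cochains_def)
  then have "pullback X (\<lambda>x. x) A = A"
    using c by (simp only: pullback_coset continuous_map_id[unfolded id_def])
  then show ?thesis
    using pullback_cong[of X f "\<lambda>x. x" A] assms(1) by simp
qed

section \<open>The action of the unitary group on the universal space\<close>

lemma ctranspose_mult: "ctranspose (A ** B) = ctranspose B ** ctranspose A"
  by (simp add: ctranspose_def map_matrix_def transpose_def matrix_matrix_mult_def vec_eq_iff
      mult.commute)

lemma matrix_inv_eqI:
  fixes A :: "'n::finite cmat"
  assumes "A ** B = mat 1"
  shows "matrix_inv A = B"
proof -
  have BA: "B ** A = mat 1" using assms matrix_left_right_inverse by blast
  then have "A ** matrix_inv A = mat 1"
    unfolding matrix_inv_def using assms by (metis (mono_tags, lifting) someI)
  then have "B ** (A ** matrix_inv A) = B" by simp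
  then show ?thesis by (simp add: matrix_mul_assoc BA)
qed

lemma unitary_matrices_inv:
  assumes "A \<in> unitary_matrices"
  shows "matrix_inv A = ctranspose A" "A ** matrix_inv A = mat 1" "matrix_inv A ** A = mat 1"
    "matrix_inv A \<in> unitary_matrices"
proof -
  show 1: "matrix_inv A = ctranspose A"
    using assms by (intro matrix_inv_eqI) (simp add: unitary_matrices_def)
  show 2: "A ** matrix_inv A = mat 1"
    using assms by (simp add: 1 unitary_matrices_def)
  show 3: "matrix_inv A ** A = mat 1"
    using 2 matrix_left_right_inverse by blast
  have "ctranspose (ctranspose A) = A"
    by (simp add: ctranspose_def map_matrix_def transpose_def vec_eq_iff)
  with 1 3 show "matrix_inv A \<in> unitary_matrices"
    by (simp add: unitary_matrices_def)
qed

lemma unitary_matrices_mult: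
  assumes "A \<in> unitary_matrices" "B \<in> unitary_matrices"
  shows "A ** B \<in> unitary_matrices"
proof -
  have "A ** B ** ctranspose (A ** B) = A ** (B ** ctranspose B) ** ctranspose A"
    by (simp add: ctranspose_mult matrix_mul_assoc)
  then show ?thesis using assms by (simp add: unitary_matrices_def)
qed

lemma unitary_matrices_one: "mat 1 \<in> unitary_matrices"
proof -
  have "ctranspose (mat 1) = mat 1"
    by (simp add: ctranspose_def map_matrix_def transpose_def mat_def vec_eq_iff)
  then show ?thesis by (simp add: unitary_matrices_def)
qed

lemma matrix_inv_mult:
  assumes "A \<in> unitary_matrices" "B \<in> unitary_matrices"
  shows "matrix_inv (A ** B) = matrix_inv B ** matrix_inv A"
  using assms by (simp add: unitary_matrices_inv(1) unitary_matrices_mult ctranspose_mult)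

lemma continuous_on_matrix_mult [continuous_intros]:
  fixes f g :: "'a::topological_space \<Rightarrow> 'n::finite cmat"
  assumes "continuous_on S f" "continuous_on S g"
  shows "continuous_on S (\<lambda>x. f x ** g x)"
  unfolding matrix_matrix_mult_def by (intro continuous_intros assms)

lemma continuous_on_ctranspose [continuous_intros]:
  fixes f :: "'a::topological_space \<Rightarrow> 'n::finite cmat"
  assumes "continuous_on S f"
  shows "continuous_on S (\<lambda>x. ctranspose (f x))"
  unfolding ctranspose_def map_matrix_def transpose_def
  by (simp, intro continuous_intros assms)

lemma closed_unitary_matrices: "closed (unitary_matrices :: 'n::finite cmat set)"
proof -
  have "continuous_on UNIV (\<lambda>A :: 'n cmat. A ** ctranspose A)"
    by (intro continuous_intros)
  then have "closed ((\<lambda>A :: 'n cmat. A ** ctranspose A) -` {mat 1})"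
    by (intro continuous_closed_vimage) (auto simp: continuous_on_eq_continuous_at)
  then show ?thesis by (simp add: unitary_matrices_def vimage_def)
qed

lemma continuous_on_matrix_inv_unitary: "continuous_on unitary_matrices matrix_inv"
  by (rule continuous_on_eq[of _ ctranspose]) (auto intro!: continuous_intros simp: unitary_matrices_inv)

lemma E_act_mult: "E_act (A ** B) e = E_act A (E_act B e)"
  by (simp add: E_act_def matrix_vector_mul_assoc)

lemma E_act_one [simp]: "E_act (mat 1) e = e"
  by (simp add: E_act_def)

lemma topspace_E_top: "topspace E_top = (\<Union>N. Stiefel N)"
proof -
  have "openin E_top (\<Union>N. Stiefel N :: (nat \<Rightarrow> complex^'n::finite) set)"
  proof -
    have "(\<Union>N. Stiefel N) \<inter> Stiefel M = (Stiefel M :: (nat \<Rightarrow> complex^'n) set)" for M by auto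
    then show ?thesis by (simp add: openin_E_top)
  qed
  then show ?thesis
    by (metis openin_E_top openin_subset openin_topspace subset_antisym)
qed

text \<open>In matrix form, with ' for the conjugate transpose, this is (gA)(gA)' = g(AA')g' = gg' =
  1. It is carried out in coordinates because A is a sequence of columns.\<close>

lemma E_act_Stiefel:
  assumes g: "g \<in> unitary_matrices" and e: "e \<in> Stiefel N"
  shows "E_act g e \<in> Stiefel N"
proof -
  have "(\<Sum>j<N. E_act g e j $ i * cnj (E_act g e j $ i')) = (if i = i' then 1 else 0)" for i i'
  proof -
    have "(\<Sum>j<N. E_act g e j $ i * cnj (E_act g e j $ i')) =
        (\<Sum>j<N. \<Sum>k\<in>UNIV. \<Sum>l\<in>UNIV. g $ i $ k * cnj (g $ i' $ l) * (e j $ k * cnj (e j $ l)))"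
      by (simp add: E_act_def matrix_vector_mult_def sum_product mult_ac)
    also have "\<dots> = (\<Sum>k\<in>UNIV. \<Sum>j<N. \<Sum>l\<in>UNIV. g $ i $ k * cnj (g $ i' $ l) * (e j $ k * cnj (e j $ l)))"
      by (rule sum.swap)
    also have "\<dots> = (\<Sum>k\<in>UNIV. \<Sum>l\<in>UNIV. \<Sum>j<N. g $ i $ k * cnj (g $ i' $ l) * (e j $ k * cnj (e j $ l)))"
      by (intro sum.cong refl sum.swap)
    also have "\<dots> = (\<Sum>k\<in>UNIV. \<Sum>l\<in>UNIV. g $ i $ k * cnj (g $ i' $ l) * (if k = l then 1 else 0))"
      using e by (simp add: Stiefel_def flip: sum_distrib_left)
    also have "\<dots> = (\<Sum>k\<in>UNIV. g $ i $ k * cnj (g $ i' $ k))"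
      by (simp add: if_distrib[of "\<lambda>x. _ * x"] cong: if_cong)
    also have "\<dots> = (g ** ctranspose g) $ i $ i'"
      by (simp add: matrix_matrix_mult_def ctranspose_def map_matrix_def transpose_def)
    also have "\<dots> = (if i = i' then 1 else 0)"
      using g by (simp add: unitary_matrices_def mat_def)
    finally show ?thesis .
  qed
  moreover have "E_act g e j = 0" if "j \<ge> N" for j
    using e that by (simp add: E_act_def Stiefel_def)
  ultimately show ?thesis by (simp add: Stiefel_def)
qed

text \<open>Sequences of columns carry the product topology here, and each column of the result
  depends on g and on one column of e only, so continuity is checked entry by entry.\<close>

lemma continuous_on_E_act: "continuous_on S (\<lambda>(g, e). E_act (g :: 'n::finite cmat) e)"
proof -
  have "continuous_on UNIV (\<lambda>p :: 'n cmat \<times> (nat \<Rightarrow> complex^'n). E_act (fst p) (snd p))"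
    unfolding E_act_def matrix_vector_mult_def
  proof (intro continuous_on_coordinatewise_then_product continuous_on_vec_lambda continuous_on_sum
      continuous_on_mult continuous_on_component)
    show "continuous_on UNIV (\<lambda>p :: 'n cmat \<times> (nat \<Rightarrow> complex^'n). snd p j)" for j
      by (rule continuous_on_product_then_coordinatewise[OF continuous_on_snd]) (rule continuous_on_id)
  qed (intro continuous_intros)
  then show ?thesis
    unfolding case_prod_unfold by (rule continuous_on_subset) simp
qed

text \<open>The colimit topology commutes with products only over locally compact factors; here this enters
  through the tube lemma for a compact neighbourhood of a unitary matrix.\<close>

lemma continuous_map_E_act:
  "continuous_map (prod_topology (top_of_set unitary_matrices) E_top) E_top
    (\<lambda>(g, e). E_act (g :: 'n::finite cmat) e)"
  unfolding continuous_map_def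
proof (intro conjI allI impI)
  let ?U = "unitary_matrices :: 'n cmat set"
  let ?T = "prod_topology (top_of_set ?U) E_top"
  show "(\<lambda>(g, e). E_act g e) \<in> topspace ?T \<rightarrow> topspace E_top"
    by (auto simp: topspace_E_top intro: E_act_Stiefel)
  fix W :: "(nat \<Rightarrow> complex^'n) set" assume W: "openin E_top W"
  show "openin ?T {p \<in> topspace ?T. (case p of (g, e) \<Rightarrow> E_act g e) \<in> W}"
    unfolding openin_prod_topology_alt
  proof (intro allI impI)
    fix g0 e0 assume "(g0, e0) \<in> {p \<in> topspace ?T. (case p of (g, e) \<Rightarrow> E_act g e) \<in> W}"
    then obtain N0 where g0: "g0 \<in> ?U" and e0: "e0 \<in> Stiefel N0" and w0: "E_act g0 e0 \<in> W"
      by (auto simp: topspace_E_top)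
    have W_Stiefel: "openin (top_of_set (Stiefel N)) (W \<inter> Stiefel N)" for N
      using W by (simp add: openin_E_top)
    have cont: "continuous_map (top_of_set (S \<times> Stiefel N)) (top_of_set (Stiefel N))
        (\<lambda>(g, e). E_act g e)" if "S \<subseteq> ?U" for S N
      using that by (auto simp: continuous_on_E_act E_act_Stiefel)
    have "openin (top_of_set ?U) {g \<in> ?U. E_act g e0 \<in> W \<inter> Stiefel N0}"
    proof -
      have "continuous_map (top_of_set ?U) (top_of_set (?U \<times> Stiefel N0)) (\<lambda>g. (g, e0))"
        using e0 by (auto intro!: continuous_intros)
      from continuous_map_compose[OF this cont[OF subset_refl]]
      have "continuous_map (top_of_set ?U) (top_of_set (Stiefel N0)) (\<lambda>g. E_act g e0)"
        by (simp add: o_def)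
      from openin_continuous_map_preimage[OF this W_Stiefel] show ?thesis by simp
    qed
    moreover have "g0 \<in> {g \<in> ?U. E_act g e0 \<in> W \<inter> Stiefel N0}"
      using g0 e0 w0 E_act_Stiefel by auto
    ultimately obtain r where r: "r > 0" "cball g0 r \<inter> ?U \<subseteq> {g \<in> ?U. E_act g e0 \<in> W \<inter> Stiefel N0}"
      unfolding openin_contains_cball by blast
    \<comment> \<open>The closed ball makes C compact. C is found at the stage N0 of e0 and then
      kept fixed, independently of the stage N at which openness of V is tested.\<close>
    define C where "C = cball g0 r \<inter> ?U"
    define V where "V = {e \<in> topspace E_top. \<forall>g\<in>C. E_act g e \<in> W}"
    have "openin E_top V"
      unfolding openin_E_top
    proof (intro conjI allI)
      show "V \<subseteq> (\<Union>N. Stiefel N)" by (auto simp: V_def topspace_E_top)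
      fix N
      \<comment> \<open>The bad pairs at stage N form a closed set. Projection along the compact C
        is a closed map, so the points spoiled by some g in C form a closed set, and its complement
        is V at stage N.\<close>
      define B where "B = {p \<in> C \<times> Stiefel N. (case p of (g, e) \<Rightarrow> E_act g e) \<in> Stiefel N - W \<inter> Stiefel N}"
      have "closedin (top_of_set (C \<times> Stiefel N)) B"
      proof -
        have "closedin (top_of_set (Stiefel N)) (Stiefel N - W \<inter> Stiefel N)"
          using W_Stiefel[of N] by (auto intro: closedin_diff)
        from closedin_continuous_map_preimage[OF cont[of C N] this] show ?thesis
          unfolding B_def C_def by simp
      qed
      moreover have "compact_space (top_of_set C)"
        unfolding C_def by (intro compact_space_subtopology)
          (simp add: compact_Int_closed closed_unitary_matrices)
      then have "closed_map (prod_topology (top_of_set C) (top_of_set (Stiefel N)))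
          (top_of_set (Stiefel N :: (nat \<Rightarrow> complex^'n) set)) snd"
        by (rule Abstract_Topological_Spaces.closed_map_snd)
      ultimately have "closedin (top_of_set (Stiefel N)) (snd ` B)"
        by (simp add: closed_map_def)
      then have "openin (top_of_set (Stiefel N)) (Stiefel N - snd ` B)"
        by (intro openin_diff) auto
      moreover have "V \<inter> Stiefel N = Stiefel N - snd ` B"
      proof -
        have "e \<in> snd ` B \<longleftrightarrow> (\<exists>g\<in>C. E_act g e \<notin> W)" if e: "e \<in> Stiefel N" for e
        proof
          show "\<exists>g\<in>C. E_act g e \<notin> W" if "e \<in> snd ` B"
            using that by (auto simp: B_def)
          show "e \<in> snd ` B" if ex: "\<exists>g\<in>C. E_act g e \<notin> W"
          proof -
            obtain g where g: "g \<in> C" "E_act g e \<notin> W" using ex by blast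
            moreover have "E_act g e \<in> Stiefel N"
              using g(1) e E_act_Stiefel by (auto simp: C_def)
            ultimately have "(g, e) \<in> B" using e by (simp add: B_def)
            then show ?thesis by (metis image_eqI snd_conv)
          qed
        qed
        then show ?thesis by (auto simp: V_def topspace_E_top)
      qed
      ultimately show "openin (top_of_set (Stiefel N)) (V \<inter> Stiefel N)" by simp
    qed
    moreover have "openin (top_of_set ?U) (ball g0 r \<inter> ?U)"
      by (metis Int_commute open_ball openin_open_Int)
    moreover have "g0 \<in> ball g0 r \<inter> ?U" "e0 \<in> V"
      using r g0 e0 by (auto simp: V_def C_def topspace_E_top)
    moreover have "(ball g0 r \<inter> ?U) \<times> V \<subseteq> {p \<in> topspace ?T. (case p of (g, e) \<Rightarrow> E_act g e) \<in> W}"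
      by (auto simp: V_def C_def)
    ultimately show "\<exists>A B. openin (top_of_set ?U) A \<and> openin E_top B \<and> g0 \<in> A \<and> e0 \<in> B \<and>
        A \<times> B \<subseteq> {p \<in> topspace ?T. (case p of (g, e) \<Rightarrow> E_act g e) \<in> W}"
      by blast
  qed
qed

lemma continuous_map_E_act_compose:
  assumes f: "continuous_map X (top_of_set unitary_matrices) f" and h: "continuous_map X E_top h"
  shows "continuous_map X E_top (\<lambda>x. E_act (f x) (h x))"
proof -
  have "continuous_map X (prod_topology (top_of_set unitary_matrices) E_top) (\<lambda>x. (f x, h x))"
    using f h by (simp add: continuous_map_pairedI)
  from continuous_map_compose[OF this continuous_map_E_act] show ?thesis
    by (simp add: o_def)
qed

section \<open>Quotient topologies and products\<close>

lemma topspace_quot_topology: "topspace (quot_topology X q) = q ` topspace X"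
  using quotient_map_quot_topology[of X q] by (simp add: quotient_imp_surjective_map)

lemma continuous_map_quot_topology: "continuous_map X (quot_topology X q) q"
  by (rule quotient_imp_continuous_map[OF quotient_map_quot_topology])

text \<open>Openness of f is inherited by the product with an identity, and an open continuous
  surjection is a quotient map; for a general quotient map the product can fail to be one. This is
  applied to \<open>BS_class\<close>, with the universal space as second factor.\<close>

lemma quotient_map_prod_id:
  assumes f: "continuous_map X X' f" "open_map X X' f" "f ` topspace X = topspace X'"
  shows "quotient_map (prod_topology X Y) (prod_topology X' Y) (\<lambda>(x, y). (f x, y))"
proof (rule continuous_open_imp_quotient_map)
  show "continuous_map (prod_topology X Y) (prod_topology X' Y) (\<lambda>(x, y). (f x, y))"
    using f(1) by (auto simp: case_prod_unfold
        intro!: continuous_map_pairedI continuous_map_compose[OF continuous_map_fst, unfolded o_def]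
          continuous_map_snd)
  show "(\<lambda>(x, y). (f x, y)) ` topspace (prod_topology X Y) = topspace (prod_topology X' Y)"
    using f(3) by force
  show "open_map (prod_topology X Y) (prod_topology X' Y) (\<lambda>(x, y). (f x, y))"
    unfolding open_map_def
  proof (intro allI impI)
    fix U assume U: "openin (prod_topology X Y) U"
    show "openin (prod_topology X' Y) ((\<lambda>(x, y). (f x, y)) ` U)"
      unfolding openin_prod_topology_alt
    proof (intro allI impI)
      fix x' y assume "(x', y) \<in> (\<lambda>(x, y). (f x, y)) ` U"
      then obtain x where x: "(x, y) \<in> U" "x' = f x" by auto
      from U[unfolded openin_prod_topology_alt, rule_format, OF x(1)]
      obtain A B where AB: "openin X A" "openin Y B" "x \<in> A" "y \<in> B" "A \<times> B \<subseteq> U"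
        by (elim exE conjE)
      show "\<exists>A B. openin X' A \<and> openin Y B \<and> x' \<in> A \<and> y \<in> B \<and>
          A \<times> B \<subseteq> (\<lambda>(x, y). (f x, y)) ` U"
      proof (intro exI conjI)
        show "openin X' (f ` A)" using f(2) AB(1) by (simp add: open_map_def)
        show "(f ` A) \<times> B \<subseteq> (\<lambda>(x, y). (f x, y)) ` U" using AB(5) by force
      qed (use AB x in auto)
    qed
  qed
qed

section \<open>Bott-Samelson varieties\<close>

lemma mat_group_simps [simp]:
  "carrier (mat_group S) = S" "x \<otimes>\<^bsub>mat_group S\<^esub> y = x ** y" "\<one>\<^bsub>mat_group S\<^esub> = mat 1"
  by (simp_all add: mat_group_def)

lemma mprod_Nil [simp]: "mprod M [] = \<one>\<^bsub>M\<^esub>"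
  by (simp add: mprod_def)

lemma mprod_Cons [simp]: "mprod M (x # xs) = x \<otimes>\<^bsub>M\<^esub> mprod M xs"
  by (simp add: mprod_def)

lemma (in monoid) mprod_closed: "set xs \<subseteq> carrier G \<Longrightarrow> mprod G xs \<in> carrier G"
  by (induction xs) auto

lemma (in monoid) mprod_append:
  "set xs \<subseteq> carrier G \<Longrightarrow> set ys \<subseteq> carrier G \<Longrightarrow> mprod G (xs @ ys) = mprod G xs \<otimes> mprod G ys"
  by (induction xs) (auto simp: mprod_closed m_assoc)

lemma group_unitary_matrices: "group (mat_group unitary_matrices)"
  by (rule groupI)
    (auto simp: unitary_matrices_mult unitary_matrices_one matrix_mul_assoc
      intro: unitary_matrices_inv)

lemma inv_unitary_matrices:
  "A \<in> unitary_matrices \<Longrightarrow> inv\<^bsub>mat_group unitary_matrices\<^esub> A = matrix_inv A"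
  by (rule group.inv_equality[OF group_unitary_matrices])
    (simp_all only: mat_group_simps unitary_matrices_inv(3,4))

text \<open>All groups are compared inside the one unitary group, where the group inverse is
  \<open>matrix_inv\<close>.\<close>

abbreviation unitary_subgroup :: "'n::finite cmat set \<Rightarrow> bool" where
  "unitary_subgroup H \<equiv> subgroup H (mat_group unitary_matrices)"

lemma unitary_subgroupD:
  assumes "unitary_subgroup H"
  shows "H \<subseteq> unitary_matrices" "mat 1 \<in> H" "\<And>x y. x \<in> H \<Longrightarrow> y \<in> H \<Longrightarrow> x ** y \<in> H"
    "\<And>x. x \<in> H \<Longrightarrow> matrix_inv x \<in> H"
proof -
  show 1: "H \<subseteq> unitary_matrices" using subgroup.subset[OF assms] by simp
  show "mat 1 \<in> H" using subgroup.one_closed[OF assms] by simp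
  show "x ** y \<in> H" if "x \<in> H" "y \<in> H" for x y
    using subgroup.m_closed[OF assms that] by simp
  show "matrix_inv x \<in> H" if "x \<in> H" for x
    using subgroup.m_inv_closed[OF assms that] that 1 by (metis inv_unitary_matrices subsetD)
qed

lemma unitary_subgroupI:
  assumes "H \<subseteq> unitary_matrices" "mat 1 \<in> H" "\<And>x y. x \<in> H \<Longrightarrow> y \<in> H \<Longrightarrow> x ** y \<in> H"
    "\<And>x. x \<in> H \<Longrightarrow> matrix_inv x \<in> H"
  shows "unitary_subgroup H"
proof (rule subgroup.intro)
  fix x assume "x \<in> H"
  then show "inv\<^bsub>mat_group unitary_matrices\<^esub> x \<in> H"
    using assms by (metis inv_unitary_matrices subsetD)
qed (use assms in auto)

lemma unitary_inv_cancel: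
  assumes "A \<in> unitary_matrices"
  shows "matrix_inv A ** (A ** B) = B" "A ** (matrix_inv A ** B) = B"
    "B ** A ** matrix_inv A = B" "B ** matrix_inv A ** A = B"
  using unitary_matrices_inv[OF assms]
  by (simp_all add: matrix_mul_assoc) (simp_all flip: matrix_mul_assoc)

lemma E_orbit_E_act:
  assumes K: "unitary_subgroup K" and k: "k \<in> K"
  shows "E_orbit K (E_act k e) = E_orbit K e"
proof -
  note D = unitary_subgroupD[OF K]
  have "E_act l e \<in> E_orbit K (E_act k e)" if "l \<in> K" for l
  proof -
    have "E_act l e = E_act (l ** matrix_inv k) (E_act k e)"
      using unitary_inv_cancel[of k] k D(1) by (auto simp flip: E_act_mult)
    moreover have "l ** matrix_inv k \<in> K" using that k D by simp
    ultimately show ?thesis unfolding E_orbit_def by blast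
  qed
  moreover have "E_act l (E_act k e) \<in> E_orbit K e" if "l \<in> K" for l
    using D(3)[OF that k] unfolding E_orbit_def E_act_mult[symmetric] by blast
  ultimately show ?thesis unfolding E_orbit_def[of K e] E_orbit_def[of K "E_act k e"] by blast
qed

text \<open>The action law is asked for at the point x alone; at a fixed point it follows from
  fixedness and the closure of K under products.\<close>

lemma borel_orbit_act:
  assumes K: "unitary_subgroup K" and k: "k \<in> K"
    and act: "\<And>k l. k \<in> K \<Longrightarrow> l \<in> K \<Longrightarrow> act k (act l x) = act (k ** l) x"
  shows "borel_orbit K act (act k x, E_act k e) = borel_orbit K act (x, e)"
proof -
  note D = unitary_subgroupD[OF K]
  have *: "act l (act k x) = act (l ** k) x" "E_act l (E_act k e) = E_act (l ** k) e" if "l \<in> K" for l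
    using act[OF that k] by (simp_all add: E_act_mult)
  have "(act l (act k x), E_act l (E_act k e)) \<in> borel_orbit K act (x, e)" if "l \<in> K" for l
    using D(3)[OF that k] by (auto simp: borel_orbit_def *[OF that])
  moreover have "(act l x, E_act l e) \<in> borel_orbit K act (act k x, E_act k e)" if "l \<in> K" for l
  proof -
    have l: "(l ** matrix_inv k) ** k = l" "l ** matrix_inv k \<in> K"
      using unitary_inv_cancel(4)[of k l] k that D by auto
    show ?thesis
      unfolding borel_orbit_def using *[OF l(2)] l by (auto intro!: exI[of _ "l ** matrix_inv k"])
  qed
  ultimately show ?thesis
    by (auto simp: borel_orbit_def)
qed

lemma E_orbit_self: "unitary_subgroup K \<Longrightarrow> e \<in> E_orbit K e"
  unfolding E_orbit_def using unitary_subgroupD(2)[of K] by (auto intro!: exI[of _ "mat 1"])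

text \<open>For g normalizing K one has g k = (g k g^-1) g, so g carries K-orbits to K-orbits and
  the union is over equal sets. With g a lifting this evaluates \<open>rho\<close>.\<close>

lemma Union_E_orbit:
  assumes K: "unitary_subgroup K"
    and g: "g \<in> unitary_matrices" "\<And>k. k \<in> K \<Longrightarrow> g ** k ** matrix_inv g \<in> K"
  shows "(\<Union>e'\<in>E_orbit K e. E_orbit K (E_act g e')) = E_orbit K (E_act g e)"
proof -
  have "E_orbit K (E_act g (E_act k e)) = E_orbit K (E_act g e)" if "k \<in> K" for k
  proof -
    have "E_act g (E_act k e) = E_act (g ** k ** matrix_inv g) (E_act g e)"
      using unitary_inv_cancel[OF g(1)] by (simp flip: E_act_mult)
    then show ?thesis using E_orbit_E_act[OF K g(2)[OF that]] by simp
  qed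
  then have "\<forall>e'\<in>E_orbit K e. E_orbit K (E_act g e') = E_orbit K (E_act g e)"
    unfolding E_orbit_def[of K e] by blast
  then show ?thesis using E_orbit_self[OF K, of e] by blast
qed

text \<open>The matrix whose inverse gives the component of \<open>phi\<close> with index i. It is
  formed among all matrices, so that its recursion holds without membership conditions.\<close>

definition prefix_prod :: "nat \<Rightarrow> (nat \<Rightarrow> 'n::finite cmat) \<Rightarrow> 'n cmat" where
  "prefix_prod i g = mprod (mat_group UNIV) (map g [0..<i])"

lemma prefix_prod_0 [simp]: "prefix_prod 0 g = mat 1"
  by (simp add: prefix_prod_def)

lemma prefix_prod_Suc [simp]: "prefix_prod (Suc i) g = prefix_prod i g ** g i"
proof -
  interpret monoid "mat_group UNIV :: 'a cmat monoid"
    by (rule monoidI) (auto simp: matrix_mul_assoc)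
  show ?thesis by (simp add: prefix_prod_def mprod_append)
qed

text \<open>The action of \<open>K\<^sup>n\<close> on \<open>n\<close>-tuples whose quotient is the Bott-Samelson variety.\<close>

definition bs_twist :: "nat \<Rightarrow> (nat \<Rightarrow> 'n::finite cmat) \<Rightarrow> (nat \<Rightarrow> 'n cmat) \<Rightarrow> nat \<Rightarrow> 'n cmat" where
  "bs_twist n \<kappa> g = (\<lambda>i\<in>{..<n}. (if i = 0 then mat 1 else matrix_inv (\<kappa> (i - 1))) ** g i ** \<kappa> i)"

lemma BS_class_eq: "BS_class K n g = {bs_twist n \<kappa> g |\<kappa>. \<kappa> \<in> {..<n} \<rightarrow> K}"
  by (simp add: BS_class_def bs_twist_def)

text \<open>Isolates what the topology of BS(s) depends on: unitary groups with a common subgroup K.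
  Roots enter when \<open>H i\<close> is specialised to the subgroup of the i-th reflection.\<close>

locale bott_samelson =
  fixes K :: "'n::finite cmat set" and H :: "nat \<Rightarrow> 'n cmat set" and n :: nat
  assumes K: "unitary_subgroup K"
    and H: "\<And>i. i < n \<Longrightarrow> unitary_subgroup (H i)"
    and K_sub: "\<And>i. i < n \<Longrightarrow> K \<subseteq> H i"
begin

abbreviation tuples :: "(nat \<Rightarrow> 'n cmat) topology" where
  "tuples \<equiv> product_topology (\<lambda>i. top_of_set (H i)) {..<n}"

abbreviation variety :: "(nat \<Rightarrow> 'n cmat) set topology" where
  "variety \<equiv> quot_topology tuples (BS_class K n)"

lemma K_unitary: "k \<in> K \<Longrightarrow> k \<in> unitary_matrices"
  using unitary_subgroupD(1)[OF K] by blast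

lemma tuples_unitary: "g \<in> topspace tuples \<Longrightarrow> i < n \<Longrightarrow> g i \<in> unitary_matrices"
  using unitary_subgroupD(1)[OF H] by (auto simp: PiE_def)

lemma bs_twist_in_tuples:
  assumes "\<kappa> \<in> {..<n} \<rightarrow> K" "g \<in> topspace tuples"
  shows "bs_twist n \<kappa> g \<in> topspace tuples"
proof -
  have "(if i = 0 then mat 1 else matrix_inv (\<kappa> (i - 1))) ** g i ** \<kappa> i \<in> H i" if i: "i < n" for i
  proof -
    note D = unitary_subgroupD[OF H[OF i]]
    have "\<kappa> i \<in> H i" using assms(1) i K_sub[OF i] by auto
    moreover have "matrix_inv (\<kappa> (i - 1)) \<in> H i"
      using assms(1) i K_sub[OF i] by (intro D(4)) auto
    moreover have "g i \<in> H i" using assms(2) i by auto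
    ultimately show ?thesis using D(2,3) by auto
  qed
  then show ?thesis by (auto simp: bs_twist_def)
qed

lemma continuous_map_bs_twist:
  assumes "\<kappa> \<in> {..<n} \<rightarrow> K"
  shows "continuous_map tuples tuples (bs_twist n \<kappa>)"
  unfolding continuous_map_componentwise
proof (intro conjI ballI)
  show "bs_twist n \<kappa> ` topspace tuples \<subseteq> extensional {..<n}"
    by (auto simp: bs_twist_def)
  fix i assume i: "i \<in> {..<n}"
  let ?f = "\<lambda>x. (if i = 0 then mat 1 else matrix_inv (\<kappa> (i - 1))) ** x ** \<kappa> i"
  have "continuous_map tuples euclidean (\<lambda>g. ?f (g i))"
  proof -
    have "continuous_map (top_of_set (H i)) euclidean ?f"
      by (auto intro!: continuous_intros)
    from continuous_map_compose[OF
        continuous_map_product_projection[OF i, where X="\<lambda>i. top_of_set (H i)"] this]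
    show ?thesis by (simp add: o_def)
  qed
  moreover have "bs_twist n \<kappa> g i \<in> H i" if "g \<in> topspace tuples" for g
    using bs_twist_in_tuples[OF assms that] i by auto
  ultimately show "continuous_map tuples (top_of_set (H i)) (\<lambda>g. bs_twist n \<kappa> g i)"
    using i by (auto simp: continuous_map_in_subtopology bs_twist_def)
qed

lemma bs_twist_one: "g \<in> topspace tuples \<Longrightarrow> bs_twist n (\<lambda>_. mat 1) g = g"
proof -
  assume g: "g \<in> topspace tuples"
  have "matrix_inv (mat 1) = (mat 1 :: 'n cmat)"
    by (rule matrix_inv_eqI) simp
  then show ?thesis
    using g by (auto simp: bs_twist_def PiE_def extensional_def)
qed

lemma bs_twist_bs_twist:
  assumes "\<kappa> \<in> {..<n} \<rightarrow> K" "\<kappa>' \<in> {..<n} \<rightarrow> K"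
  shows "bs_twist n \<kappa>' (bs_twist n \<kappa> g) = bs_twist n (\<lambda>i. \<kappa> i ** \<kappa>' i) g"
proof (rule ext)
  fix i
  show "bs_twist n \<kappa>' (bs_twist n \<kappa> g) i = bs_twist n (\<lambda>i. \<kappa> i ** \<kappa>' i) g i"
  proof (cases "i < n")
    case True
    \<comment> \<open>For i = 0 the truncated index i - 1 is again 0, which is below n because i <
      n.\<close>
    then have "\<kappa> (i - 1) \<in> unitary_matrices" "\<kappa>' (i - 1) \<in> unitary_matrices"
      using assms K_unitary by (auto simp: Pi_iff)
    with True show ?thesis
      by (simp add: bs_twist_def matrix_inv_mult matrix_mul_assoc)
  qed (simp add: bs_twist_def)
qed

lemma BS_class_bs_twist:
  assumes \<kappa>: "\<kappa> \<in> {..<n} \<rightarrow> K"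
  shows "BS_class K n (bs_twist n \<kappa> g) = BS_class K n g"
proof (intro equalityI subsetI)
  note D = unitary_subgroupD[OF K]
  fix h assume "h \<in> BS_class K n (bs_twist n \<kappa> g)"
  then obtain \<kappa>' where "\<kappa>' \<in> {..<n} \<rightarrow> K" "h = bs_twist n \<kappa>' (bs_twist n \<kappa> g)"
    by (auto simp: BS_class_eq)
  then show "h \<in> BS_class K n g"
    using \<kappa> D(3) by (auto simp: BS_class_eq bs_twist_bs_twist Pi_iff)
next
  note D = unitary_subgroupD[OF K]
  fix h assume "h \<in> BS_class K n g"
  then obtain \<kappa>' where k': "\<kappa>' \<in> {..<n} \<rightarrow> K" "h = bs_twist n \<kappa>' g"
    by (auto simp: BS_class_eq)
  \<comment> \<open>Solves \<kappa> l = \<kappa>' entrywise, so that twisting by \<kappa> and then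
    by l is twisting by \<kappa>'.\<close>
  let ?l = "\<lambda>i. matrix_inv (\<kappa> i) ** \<kappa>' i"
  have l: "?l \<in> {..<n} \<rightarrow> K" using \<kappa> k'(1) D(3,4) by (auto simp: Pi_iff)
  have "\<kappa> i ** ?l i = \<kappa>' i" if "i < n" for i
    using \<kappa> that K_unitary by (simp add: unitary_inv_cancel Pi_iff)
  then have "bs_twist n (\<lambda>i. \<kappa> i ** ?l i) g = h"
    unfolding k'(2) by (auto simp: bs_twist_def)
  then show "h \<in> BS_class K n (bs_twist n \<kappa> g)"
    using l bs_twist_bs_twist[OF \<kappa> l] by (auto simp: BS_class_eq intro!: exI[of _ ?l])
qed

lemma BS_class_self: "g \<in> topspace tuples \<Longrightarrow> g \<in> BS_class K n g"
proof -
  assume "g \<in> topspace tuples"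
  then have "g = bs_twist n (\<lambda>_. mat 1) g" by (simp only: bs_twist_one)
  moreover have "(\<lambda>_. mat 1) \<in> {..<n} \<rightarrow> K" using unitary_subgroupD(2)[OF K] by simp
  ultimately show ?thesis unfolding BS_class_eq by blast
qed

text \<open>As for any quotient by a group of homeomorphisms, the saturation of an open set is the
  union of its preimages under the twists, each of which is open.\<close>

lemma open_map_BS_class: "open_map tuples variety (BS_class K n)"
  unfolding open_map_def
proof (intro allI impI)
  fix U assume U: "openin tuples U"
  then have U_sub: "U \<subseteq> topspace tuples" by (rule openin_subset)
  have "{g \<in> topspace tuples. BS_class K n g \<in> BS_class K n ` U} =
      (\<Union>\<kappa>\<in>{..<n} \<rightarrow> K. {g \<in> topspace tuples. bs_twist n \<kappa> g \<in> U})"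
  proof (intro equalityI subsetI)
    fix g assume "g \<in> {g \<in> topspace tuples. BS_class K n g \<in> BS_class K n ` U}"
    then obtain u where u: "g \<in> topspace tuples" "u \<in> U" "BS_class K n g = BS_class K n u" by blast
    then have "u \<in> BS_class K n g" using BS_class_self U_sub by blast
    then show "g \<in> (\<Union>\<kappa>\<in>{..<n} \<rightarrow> K. {g \<in> topspace tuples. bs_twist n \<kappa> g \<in> U})"
      using u by (auto simp: BS_class_eq)
  next
    fix g assume "g \<in> (\<Union>\<kappa>\<in>{..<n} \<rightarrow> K. {g \<in> topspace tuples. bs_twist n \<kappa> g \<in> U})"
    then obtain \<kappa> where "\<kappa> \<in> {..<n} \<rightarrow> K" "g \<in> topspace tuples" "bs_twist n \<kappa> g \<in> U" by blast
    then show "g \<in> {g \<in> topspace tuples. BS_class K n g \<in> BS_class K n ` U}"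
      using BS_class_bs_twist by (metis (mono_tags, lifting) image_eqI mem_Collect_eq)
  qed
  moreover have "openin tuples {g \<in> topspace tuples. bs_twist n \<kappa> g \<in> U}" if "\<kappa> \<in> {..<n} \<rightarrow> K" for \<kappa>
    using openin_continuous_map_preimage[OF continuous_map_bs_twist[OF that] U] .
  ultimately show "openin variety (BS_class K n ` U)"
    unfolding openin_quot_topology using U_sub by (auto intro: openin_clauses)
qed

lemma prefix_prod_unitary:
  "g \<in> topspace tuples \<Longrightarrow> i \<le> n \<Longrightarrow> prefix_prod i g \<in> unitary_matrices"
proof (induction i)
  case (Suc i)
  then show ?case
    unfolding prefix_prod_Suc by (intro unitary_matrices_mult tuples_unitary[of g]) simp_all
qed (simp add: unitary_matrices_one)

text \<open>The product telescopes. The one surviving factor stands on the right and lies in K, so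
  after inversion it stands on the left and disappears in the K-orbit.\<close>

lemma prefix_prod_bs_twist:
  assumes \<kappa>: "\<kappa> \<in> {..<n} \<rightarrow> K" and "i \<le> n"
  shows "prefix_prod i (bs_twist n \<kappa> g) = prefix_prod i g ** (if i = 0 then mat 1 else \<kappa> (i - 1))"
  using assms(2)
proof (induction i)
  case (Suc i)
  then have "i = 0 \<or> \<kappa> (i - 1) \<in> unitary_matrices"
    using \<kappa> K_unitary by (auto simp: Pi_iff)
  then show ?case
    using Suc by (auto simp: bs_twist_def matrix_mul_assoc unitary_inv_cancel)
qed simp

definition left_mult :: "'n cmat \<Rightarrow> (nat \<Rightarrow> 'n cmat) \<Rightarrow> nat \<Rightarrow> 'n cmat" where
  "left_mult k g = (\<lambda>i\<in>{..<n}. if i = 0 then k ** g i else g i)"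

text \<open>The action multiplies the first entry on the left, where a twist contributes only
  \<open>mat 1\<close>; hence the two operations commute.\<close>

lemma BS_act_BS_class: "BS_act n k (BS_class K n g) = BS_class K n (left_mult k g)"
proof -
  have "left_mult k (bs_twist n \<kappa> g) = bs_twist n \<kappa> (left_mult k g)" for \<kappa>
    by (auto simp: left_mult_def bs_twist_def matrix_mul_assoc)
  then show ?thesis
    unfolding BS_act_def BS_class_eq left_mult_def[symmetric] Setcompr_eq_image image_image by simp
qed

lemma left_mult_in_tuples:
  "k \<in> K \<Longrightarrow> g \<in> topspace tuples \<Longrightarrow> left_mult k g \<in> topspace tuples"
  using subsetD[OF K_sub] unitary_subgroupD(3)[OF H] by (auto simp: left_mult_def PiE_iff)

lemma prefix_prod_left_mult:
  "i \<le> n \<Longrightarrow> prefix_prod i (left_mult k g) = (if i = 0 then mat 1 else k ** prefix_prod i g)"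
  by (induction i) (auto simp: left_mult_def matrix_mul_assoc)

text \<open>All representatives give the same component. If p = g_1...g_i with i > 0, another
  representative has product k p \<kappa> and point k e, and (k p \<kappa>)^-1 k e = \<kappa>^-1
  p^-1 e lies in the K-orbit of p^-1 e. For i = 0 the product is 1, and k e lies in the orbit of
  e.\<close>

lemma phi_borel_orbit:
  assumes g: "g \<in> topspace tuples"
  shows "phi K n (borel_orbit K (BS_act n) (BS_class K n g, e)) =
    (\<lambda>i\<in>{..n}. E_orbit K (E_act (matrix_inv (prefix_prod i g)) e))"
proof -
  have "E_orbit K (E_act (matrix_inv (prefix_prod i h)) (E_act k e)) =
      E_orbit K (E_act (matrix_inv (prefix_prod i g)) e)"
    if i: "i \<le> n" and k: "k \<in> K" and h: "h \<in> BS_act n k (BS_class K n g)" for i k h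
  proof (cases "i = 0")
    case True
    have "matrix_inv (mat 1) = (mat 1 :: 'n cmat)" by (rule matrix_inv_eqI) simp
    with True show ?thesis using E_orbit_E_act[OF K k] by simp
  next
    case False
    obtain \<kappa> where \<kappa>: "\<kappa> \<in> {..<n} \<rightarrow> K" "h = bs_twist n \<kappa> (left_mult k g)"
      using h unfolding BS_act_BS_class by (auto simp: BS_class_eq)
    have l: "\<kappa> (i - 1) \<in> K" using \<kappa>(1) False i by (auto simp: Pi_iff)
    have p: "prefix_prod i g \<in> unitary_matrices" using prefix_prod_unitary[OF g i] .
    have ku: "k \<in> unitary_matrices" using k K_unitary by blast
    have "prefix_prod i h = k ** prefix_prod i g ** \<kappa> (i - 1)"
      using prefix_prod_bs_twist[OF \<kappa>(1) i, of "left_mult k g"] prefix_prod_left_mult[OF i] False \<kappa>(2)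
      by simp
    then have "matrix_inv (prefix_prod i h) =
        matrix_inv (\<kappa> (i - 1)) ** (matrix_inv (prefix_prod i g) ** matrix_inv k)"
      using l p ku K_unitary by (simp add: matrix_inv_mult unitary_matrices_mult)
    then have "E_act (matrix_inv (prefix_prod i h)) (E_act k e) =
        E_act (matrix_inv (\<kappa> (i - 1))) (E_act (matrix_inv (prefix_prod i g)) e)"
      using unitary_inv_cancel[OF ku] by (simp add: matrix_mul_assoc flip: E_act_mult)
    then show ?thesis
      using E_orbit_E_act[OF K] unitary_subgroupD(4)[OF K l] by simp
  qed
  then have *: "\<And>i k h. i \<le> n \<Longrightarrow> k \<in> K \<Longrightarrow> h \<in> BS_act n k (BS_class K n g) \<Longrightarrow>
      E_orbit K (E_act (matrix_inv (prefix_prod i h)) (E_act k e)) =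
      E_orbit K (E_act (matrix_inv (prefix_prod i g)) e)" .
  \<comment> \<open>The index sets are nonempty, so the union of a constant family is its value and
    not the empty set.\<close>
  have ne: "mat 1 \<in> K" "left_mult k g \<in> BS_act n k (BS_class K n g)" if "k \<in> K" for k
    using unitary_subgroupD(2)[OF K] BS_class_self[OF left_mult_in_tuples[OF that g]]
    by (simp_all add: BS_act_BS_class)
  have "(\<Union>(X, e')\<in>borel_orbit K (BS_act n) (BS_class K n g, e). \<Union>h\<in>X.
      E_orbit K (E_act (matrix_inv (prefix_prod i h)) e')) =
      E_orbit K (E_act (matrix_inv (prefix_prod i g)) e)" if i: "i \<le> n" for i
  proof -
    have "(\<Union>(X, e')\<in>borel_orbit K (BS_act n) (BS_class K n g, e). \<Union>h\<in>X.
        E_orbit K (E_act (matrix_inv (prefix_prod i h)) e')) =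
        (\<Union>k\<in>K. \<Union>h\<in>BS_act n k (BS_class K n g).
          E_orbit K (E_act (matrix_inv (prefix_prod i h)) (E_act k e)))"
      unfolding borel_orbit_def by auto
    also have "\<dots> = (\<Union>k\<in>K. \<Union>h\<in>BS_act n k (BS_class K n g).
          E_orbit K (E_act (matrix_inv (prefix_prod i g)) e))"
      using *[OF i] by simp
    also have "\<dots> = E_orbit K (E_act (matrix_inv (prefix_prod i g)) e)"
      using ne unitary_subgroupD(2)[OF K] by blast
    finally show ?thesis .
  qed
  then show ?thesis
    unfolding phi_def prefix_prod_def[symmetric] by (intro restrict_ext) simp
qed

lemma continuous_map_prefix_prod:
  "i \<le> n \<Longrightarrow> continuous_map tuples (top_of_set unitary_matrices) (prefix_prod i)"
proof -
  assume i: "i \<le> n"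
  then have "continuous_map tuples euclidean (prefix_prod i)"
  proof (induction i)
    case 0
    then show ?case by (simp add: prefix_prod_def)
  next
    case (Suc i)
    have "continuous_map tuples (top_of_set (H i)) (\<lambda>g. g i)"
      using Suc.prems by (intro continuous_map_product_projection) auto
    then have gi: "continuous_map tuples euclidean (\<lambda>g. g i)"
      by (rule continuous_map_into_fulltopology)
    have "continuous_map (prod_topology euclidean euclidean) euclidean (\<lambda>(A :: 'n cmat, B :: 'n cmat). A ** B)"
      by (auto simp: case_prod_unfold intro!: continuous_intros)
    from continuous_map_compose[OF continuous_map_pairedI[OF Suc.IH gi] this] Suc.prems
    show ?case by (simp add: o_def)
  qed
  then show ?thesis
    using prefix_prod_unitary[OF _ i] by (auto simp: continuous_map_in_subtopology
        simp del: topspace_product_topology)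
qed

lemma continuous_map_prefix_inv_act:
  assumes "i \<le> n"
  shows "continuous_map (prod_topology tuples E_top) (KE K)
    (\<lambda>(g, e). E_orbit K (E_act (matrix_inv (prefix_prod i g)) e))"
proof -
  have inv: "continuous_map (top_of_set unitary_matrices) (top_of_set unitary_matrices)
      (matrix_inv :: 'n cmat \<Rightarrow> _)"
    using continuous_on_matrix_inv_unitary unitary_matrices_inv(4) by auto
  have "continuous_map (prod_topology tuples E_top) (top_of_set unitary_matrices)
      (\<lambda>p. matrix_inv (prefix_prod i (fst p)))"
    using continuous_map_compose[OF continuous_map_compose[OF continuous_map_fst
          continuous_map_prefix_prod[OF assms]] inv]
    by (simp add: o_def)
  from continuous_map_E_act_compose[OF this continuous_map_snd]
  have "continuous_map (prod_topology tuples E_top) E_top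
      (\<lambda>p. E_act (matrix_inv (prefix_prod i (fst p))) (snd p))" .
  from continuous_map_compose[OF this continuous_map_quot_topology[of _ "E_orbit K"]]
  show ?thesis
    by (simp add: o_def KE_def case_prod_unfold)
qed

text \<open>Tuples times E map onto the Borel construction by a composite of two quotient maps, the
  product of \<open>BS_class\<close> with the identity and the K-orbit map. Continuity is therefore
  tested on the explicit formula upstairs.\<close>

lemma continuous_map_phi:
  "continuous_map (borel_space K variety (BS_act n)) (product_topology (\<lambda>_. KE K) {..n}) (phi K n)"
proof -
  have "quotient_map (prod_topology tuples E_top) (prod_topology variety E_top)
      (\<lambda>(g, e). (BS_class K n g, e))"
    by (rule quotient_map_prod_id)
      (simp_all only: continuous_map_quot_topology open_map_BS_class topspace_quot_topology)
  from quotient_map_compose[OF this quotient_map_quot_topology]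
  have q: "quotient_map (prod_topology tuples E_top) (borel_space K variety (BS_act n))
      (borel_orbit K (BS_act n) \<circ> (\<lambda>(g, e). (BS_class K n g, e)))"
    by (simp add: borel_space_def)
  show ?thesis
  proof (rule continuous_compose_quotient_map[OF q], rule continuous_map_eq)
    show "continuous_map (prod_topology tuples E_top) (product_topology (\<lambda>_. KE K) {..n})
        (\<lambda>(g, e). \<lambda>i\<in>{..n}. E_orbit K (E_act (matrix_inv (prefix_prod i g)) e))"
      using continuous_map_prefix_inv_act
      by (auto simp: continuous_map_componentwise case_prod_unfold)
    fix p :: "(nat \<Rightarrow> 'n cmat) \<times> (nat \<Rightarrow> complex^'n)"
    assume "p \<in> topspace (prod_topology tuples E_top)"
    then show "(case p of (g, e) \<Rightarrow> \<lambda>i\<in>{..n}. E_orbit K (E_act (matrix_inv (prefix_prod i g)) e)) =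
        (phi K n \<circ> (borel_orbit K (BS_act n) \<circ> (\<lambda>(g, e). (BS_class K n g, e)))) p"
      using phi_borel_orbit by (auto simp del: topspace_product_topology)
  qed
qed

end

section \<open>The Weyl group and fixed points\<close>

lemma group_circle_group: "group circle_group"
proof (rule groupI)
  fix x assume "x \<in> carrier circle_group"
  then show "\<exists>y\<in>carrier circle_group. y \<otimes>\<^bsub>circle_group\<^esub> x = \<one>\<^bsub>circle_group\<^esub>"
    by (intro bexI[where x="inverse x"]) (auto simp: circle_group_def norm_inverse intro!: left_inverse)
qed (auto simp: circle_group_def norm_mult)

text \<open>The definition of \<open>torus\<close> supplies a bijective homomorphism from a product
  of circles onto the set K; the unit, products and inverses in K are read off from its
  values.\<close>

lemma unitary_subgroup_torus:
  assumes "torus K" and KU: "K \<subseteq> unitary_matrices"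
  shows "unitary_subgroup K"
proof -
  obtain r :: nat and f where f: "f \<in> iso (product_group {..<r} (\<lambda>_. circle_group)) (mat_group K)"
    using assms(1) by (auto simp: torus_def)
  define T where "T = product_group {..<r} (\<lambda>_. circle_group)"
  interpret T: group T
    unfolding T_def by (rule product_group) (rule group_circle_group)
  have f_K: "f x \<in> K" if "x \<in> carrier T" for x
    using f that by (auto simp: iso_def hom_def T_def[symmetric])
  have f_hom: "f (x \<otimes>\<^bsub>T\<^esub> y) = f x ** f y" if "x \<in> carrier T" "y \<in> carrier T" for x y
    using f that by (auto simp: iso_def hom_def T_def[symmetric])
  have f_surj: "\<exists>x\<in>carrier T. y = f x" if "y \<in> K" for y
    using f that by (auto simp: iso_def bij_betw_def T_def[symmetric])
  have f_one: "f \<one>\<^bsub>T\<^esub> = mat 1"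
  proof -
    have "f \<one>\<^bsub>T\<^esub> \<in> unitary_matrices" using f_K KU by blast
    \<comment> \<open>An idempotent unitary matrix is the identity.\<close>
    moreover have "f \<one>\<^bsub>T\<^esub> = f \<one>\<^bsub>T\<^esub> ** f \<one>\<^bsub>T\<^esub>" using f_hom[of "\<one>\<^bsub>T\<^esub>" "\<one>\<^bsub>T\<^esub>"] by simp
    ultimately show ?thesis
      using unitary_inv_cancel(1)[of "f \<one>\<^bsub>T\<^esub>" "f \<one>\<^bsub>T\<^esub>"] unitary_matrices_inv(3) by metis
  qed
  show ?thesis
  proof (rule unitary_subgroupI)
    show "mat 1 \<in> K" using f_one f_K[of "\<one>\<^bsub>T\<^esub>"] by simp
    show "x ** y \<in> K" if xy: "x \<in> K" "y \<in> K" for x y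
    proof -
      obtain a b where ab: "a \<in> carrier T" "b \<in> carrier T" "x = f a" "y = f b"
        using xy f_surj by metis
      then have "x ** y = f (a \<otimes>\<^bsub>T\<^esub> b)" using f_hom by simp
      then show ?thesis using ab f_K[of "a \<otimes>\<^bsub>T\<^esub> b"] by simp
    qed
    show "matrix_inv x \<in> K" if x: "x \<in> K" for x
    proof -
      obtain a where a: "a \<in> carrier T" "x = f a"
        using x f_surj by metis
      then have "x ** f (inv\<^bsub>T\<^esub> a) = mat 1"
        using f_hom[of a "inv\<^bsub>T\<^esub> a"] f_one by simp
      then have "matrix_inv x = f (inv\<^bsub>T\<^esub> a)" by (rule matrix_inv_eqI)
      then show ?thesis using a f_K[of "inv\<^bsub>T\<^esub> a"] by simp
    qed
  qed (rule KU)
qed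

locale weyl_setting =
  fixes G K :: "'n::finite cmat set" and lift :: "'n cmat set \<Rightarrow> 'n cmat"
  assumes G: "unitary_subgroup G" and K: "unitary_subgroup K" and K_sub_G: "K \<subseteq> G"
    and lift: "lifting G K lift"
begin

abbreviation "N \<equiv> normalizer (mat_group G) K"
abbreviation "NG \<equiv> (mat_group G)\<lparr>carrier := N\<rparr>"
abbreviation "W \<equiv> Weyl G K"

lemma group_G: "group (mat_group G)"
proof -
  have "mat_group G = (mat_group unitary_matrices)\<lparr>carrier := G\<rparr>"
    by (simp add: mat_group_def)
  then show ?thesis
    using subgroup.subgroup_is_group[OF G group_unitary_matrices] by simp
qed

lemma inv_G: "g \<in> G \<Longrightarrow> inv\<^bsub>mat_group G\<^esub> g = matrix_inv g"
  using unitary_subgroupD[OF G] by (intro group.inv_equality[OF group_G])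
    (auto simp: unitary_matrices_inv(3))

lemma subgroup_mat_groupI:
  assumes "unitary_subgroup H" "H \<subseteq> G"
  shows "subgroup H (mat_group G)"
  using unitary_subgroupD[OF assms(1)] assms(2)
  by (intro subgroup.intro) (auto simp: inv_G subset_iff)

lemma unitary_subgroup_of_subgroup:
  assumes "subgroup H (mat_group G)"
  shows "unitary_subgroup H"
proof (rule unitary_subgroupI)
  have HG: "H \<subseteq> G" using subgroup.subset[OF assms] by simp
  then show "H \<subseteq> unitary_matrices" using unitary_subgroupD(1)[OF G] by blast
  show "mat 1 \<in> H" using subgroup.one_closed[OF assms] by simp
  show "x ** y \<in> H" if "x \<in> H" "y \<in> H" for x y
    using subgroup.m_closed[OF assms that] by simp
  show "matrix_inv x \<in> H" if "x \<in> H" for x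
    using subgroup.m_inv_closed[OF assms that] HG that by (auto simp: inv_G)
qed

lemma normal_K: "K \<lhd> NG"
  by (rule group.subgroup_in_normalizer[OF group_G subgroup_mat_groupI[OF K K_sub_G]])

lemma group_W: "group W"
  unfolding Weyl_def by (rule normal.factorgroup_is_group[OF normal_K])

lemma subgroup_N: "subgroup N (mat_group G)"
  by (rule group.normalizer_imp_subgroup[OF group_G]) (use K_sub_G in simp)

lemma N_sub_G: "N \<subseteq> G"
  using subgroup.subset[OF subgroup_N] by simp

lemma N_unitary: "g \<in> N \<Longrightarrow> g \<in> unitary_matrices"
  using N_sub_G unitary_subgroupD(1)[OF G] by blast

lemma inv_NG: "g \<in> N \<Longrightarrow> inv\<^bsub>NG\<^esub> g = matrix_inv g"
  using group.m_inv_consistent[OF group_G subgroup_N] N_sub_G by (auto simp: inv_G)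

lemma N_conj:
  assumes "g \<in> N" "k \<in> K"
  shows "g ** k ** matrix_inv g \<in> K" "matrix_inv g ** k ** g \<in> K"
  using normal.inv_op_closed2[OF normal_K, of g k] normal.inv_op_closed1[OF normal_K, of g k] assms
  by (simp_all add: inv_NG)

lemma W_carrierE:
  assumes "w \<in> carrier W"
  obtains g where "g \<in> N" "w = {k ** g |k. k \<in> K}"
  using assms that by (auto simp: Weyl_def FactGroup_def RCOSETS_def r_coset_def)

lemma W_mem_N: "w \<in> carrier W \<Longrightarrow> g \<in> w \<Longrightarrow> g \<in> N"
proof (elim W_carrierE)
  fix h assume "g \<in> w" "h \<in> N" "w = {k ** h |k. k \<in> K}"
  moreover have "K \<subseteq> N"
    using subgroup.subset[OF normal_imp_subgroup[OF normal_K]] by simp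
  ultimately show "g \<in> N"
    using subgroup.m_closed[OF subgroup_N] by auto
qed

lemma W_same_coset:
  assumes "w \<in> carrier W" "g \<in> w" "h \<in> w"
  shows "\<exists>k\<in>K. h = k ** g"
proof -
  obtain f where f: "f \<in> N" "w = {k ** f |k. k \<in> K}" using assms(1) by (rule W_carrierE)
  obtain a b where ab: "a \<in> K" "b \<in> K" "g = a ** f" "h = b ** f" using assms f(2) by auto
  have "h = (b ** matrix_inv a) ** g"
    using unitary_inv_cancel(1)[of a f] unitary_subgroupD(1)[OF K] ab
    by (auto simp flip: matrix_mul_assoc)
  then show ?thesis using ab unitary_subgroupD(3,4)[OF K] by blast
qed

lemma W_mult_mem: "g \<in> w \<Longrightarrow> h \<in> w' \<Longrightarrow> g ** h \<in> w \<otimes>\<^bsub>W\<^esub> w'"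
  by (auto simp: Weyl_def FactGroup_def set_mult_def)

lemma W_one_mem: "mat 1 \<in> \<one>\<^bsub>W\<^esub>"
  using unitary_subgroupD(2)[OF K] by (simp add: Weyl_def FactGroup_def)

lemma W_inv_mem:
  assumes "w \<in> carrier W" "g \<in> w"
  shows "matrix_inv g \<in> inv\<^bsub>W\<^esub> w"
proof -
  have "inv\<^bsub>W\<^esub> w = set_inv\<^bsub>NG\<^esub> w"
    using normal.inv_FactGroup[OF normal_K] assms(1) by (simp add: Weyl_def)
  then show ?thesis
    using assms(2) inv_NG[OF W_mem_N[OF assms]] by (auto simp: SET_INV_def intro!: bexI[of _ g])
qed

lemma lift_mem: "w \<in> carrier W \<Longrightarrow> lift w \<in> w"
  using lift by (simp add: lifting_def)

lemma E_orbit_rep: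
  assumes "w \<in> carrier W" "g \<in> w" "h \<in> w"
  shows "E_orbit K (E_act g e) = E_orbit K (E_act h e)"
  using W_same_coset[OF assms] E_orbit_E_act[OF K] by (auto simp: E_act_mult)

text \<open>Members of one class differ by a left factor from K, which the K-orbit absorbs. So any g
  in w may replace the chosen lifting, in particular a product or an inverse of other
  liftings.\<close>

lemma rho_E_orbit:
  assumes "w \<in> carrier W" "g \<in> w"
  shows "rho K lift w (E_orbit K e) = E_orbit K (E_act g e)"
proof -
  have "lift w \<in> N" using W_mem_N lift_mem assms(1) by blast
  then have "rho K lift w (E_orbit K e) = E_orbit K (E_act (lift w) e)"
    unfolding rho_def by (intro Union_E_orbit[OF K] N_unitary N_conj)
  then show ?thesis using E_orbit_rep[OF assms(1) lift_mem[OF assms(1)] assms(2)] by simp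
qed

lemma topspace_KE: "topspace (KE K) = E_orbit K ` topspace E_top"
  by (simp add: KE_def topspace_quot_topology)

lemma continuous_map_rho:
  assumes w: "w \<in> carrier W"
  shows "continuous_map (KE K) (KE K) (rho K lift w)"
proof -
  have "continuous_map E_top (KE K) (rho K lift w \<circ> E_orbit K)"
  proof -
    have "continuous_map E_top E_top (\<lambda>e. E_act (lift w) e)"
      using N_unitary[OF W_mem_N[OF w lift_mem[OF w]]]
      by (intro continuous_map_E_act_compose) (auto simp: id_def[symmetric])
    from continuous_map_compose[OF this continuous_map_quot_topology[of _ "E_orbit K"]]
    show ?thesis
      using rho_E_orbit[OF w lift_mem[OF w]] by (simp add: o_def KE_def)
  qed
  then have "continuous_map (quot_topology E_top (E_orbit K)) (KE K) (rho K lift w)"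
    by (rule continuous_compose_quotient_map[OF quotient_map_quot_topology])
  then show ?thesis by (simp add: KE_def)
qed

lemma Weyl_act_ring_hom:
  assumes "w \<in> carrier W"
  shows "(Weyl_act G K lift w :: ('n, 'k::comm_ring_1) Rclass \<Rightarrow> _) \<in> ring_hom (Rring K) (Rring K)"
  unfolding Weyl_act_def Rring_def
  by (intro ring_hom_pullback continuous_map_rho group.inv_closed[OF group_W] assms)

text \<open>Pull-back reverses composition and \<open>Weyl_act\<close> pulls back along the inverse;
  the two reversals cancel and leave a left action.\<close>

lemma Weyl_act_mult:
  assumes w: "w \<in> carrier W" "w' \<in> carrier W" and r: "r \<in> carrier (Rring K)"
  shows "Weyl_act G K lift (w \<otimes>\<^bsub>W\<^esub> w') r = Weyl_act G K lift w (Weyl_act G K lift w' r)"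
proof -
  interpret W: group W by (rule group_W)
  let ?u = "inv\<^bsub>W\<^esub> w" and ?v = "inv\<^bsub>W\<^esub> w'"
  have "Weyl_act G K lift w (Weyl_act G K lift w' r) =
      pullback (KE K) (rho K lift ?v \<circ> rho K lift ?u) r"
    using r w unfolding Weyl_act_def Rring_def
    by (intro pullback_compose[where Z="KE K"] continuous_map_rho) auto
  also have "\<dots> = pullback (KE K) (rho K lift (inv\<^bsub>W\<^esub> (w \<otimes>\<^bsub>W\<^esub> w'))) r"
  proof (rule pullback_cong)
    fix Q assume "Q \<in> topspace (KE K)"
    then obtain e where Q: "Q = E_orbit K e" by (auto simp: topspace_KE)
    have uv: "?u \<in> carrier W" "?v \<in> carrier W" using w by simp_all
    \<comment> \<open>The product of the liftings need not be the lifting of the product, but it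
      lies in the right class, which \<open>rho_E_orbit\<close> accepts.\<close>
    have "lift ?v ** lift ?u \<in> inv\<^bsub>W\<^esub> (w \<otimes>\<^bsub>W\<^esub> w')"
      using W_mult_mem[OF lift_mem[OF uv(2)] lift_mem[OF uv(1)]] w by (simp add: W.inv_mult_group)
    then show "(rho K lift ?v \<circ> rho K lift ?u) Q = rho K lift (inv\<^bsub>W\<^esub> (w \<otimes>\<^bsub>W\<^esub> w')) Q"
      using rho_E_orbit[OF uv(1) lift_mem[OF uv(1)]] rho_E_orbit[OF uv(2) lift_mem[OF uv(2)]]
        rho_E_orbit[of "inv\<^bsub>W\<^esub> (w \<otimes>\<^bsub>W\<^esub> w')" "lift ?v ** lift ?u"] w
      by (simp add: Q E_act_mult)
  qed
  finally show ?thesis by (simp add: Weyl_act_def)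
qed

lemma Weyl_act_one:
  assumes r: "r \<in> carrier (Rring K)"
  shows "Weyl_act G K lift \<one>\<^bsub>W\<^esub> r = r"
proof -
  interpret W: group W by (rule group_W)
  have "rho K lift \<one>\<^bsub>W\<^esub> Q = Q" if "Q \<in> topspace (KE K)" for Q
    using that rho_E_orbit[OF W.one_closed W_one_mem] by (auto simp: topspace_KE)
  then show ?thesis
    using r unfolding Weyl_act_def Rring_def by (simp add: pullback_ident)
qed

lemma reflections_sub: "reflections G K \<subseteq> carrier W"
  by (auto simp: reflections_def reflection_of_def)

text \<open>Whatever root the choice in \<open>reflection_subgroup\<close> returns, the generators
  come from K and from images of homomorphisms into G.\<close>

lemma subgroup_reflection_subgroup: "subgroup (reflection_subgroup G K t) (mat_group G)"
proof -
  have "\<phi> ` SU2 \<subseteq> G" if "root_homomorphism G K \<alpha> \<phi>" for \<alpha> \<phi>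
    using that by (auto simp: root_homomorphism_def hom_def)
  then show ?thesis
    unfolding reflection_subgroup_def root_subgroup_def using K_sub_G
    by (intro group.generate_is_subgroup[OF group_G]) auto
qed

lemma unitary_subgroup_reflection_subgroup: "unitary_subgroup (reflection_subgroup G K t)"
  by (rule unitary_subgroup_of_subgroup[OF subgroup_reflection_subgroup])

lemma K_sub_reflection_subgroup: "K \<subseteq> reflection_subgroup G K t"
  unfolding reflection_subgroup_def root_subgroup_def by (auto intro: generate.incl)

end

text \<open>With m_i = g_1...g_i, the factor k is pushed through the tuple by k m_i = m_i (m_i^-1 k
  m_i), and these conjugates lie in K. Twisting by them multiplies the first entry by k on the left
  and cancels at all other entries.\<close>

lemma (in bott_samelson) BS_act_fixed_point:
  assumes g: "g \<in> topspace tuples" and k: "k \<in> K"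
    and norm: "\<And>i. i \<le> n \<Longrightarrow> matrix_inv (prefix_prod i g) ** k ** prefix_prod i g \<in> K"
  shows "BS_act n k (BS_class K n g) = BS_class K n g"
proof -
  let ?m = "\<lambda>i. prefix_prod i g"
  \<comment> \<open>Entry i, counted from 0, has its twisting factor on the right, so the
    conjugating product already contains that entry; hence \<open>Suc i\<close>.\<close>
  define \<kappa> where "\<kappa> i = matrix_inv (?m (Suc i)) ** k ** ?m (Suc i)" for i
  have \<kappa>: "\<kappa> \<in> {..<n} \<rightarrow> K" using norm by (simp add: \<kappa>_def Suc_le_eq del: prefix_prod_Suc)
  have ku: "k \<in> unitary_matrices" using k K_unitary by blast
  have "bs_twist n \<kappa> g = left_mult k g"
  proof (rule ext)
    fix i
    show "bs_twist n \<kappa> g i = left_mult k g i"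
    proof (cases "i < n")
      case True
      have gi: "g i \<in> unitary_matrices" using tuples_unitary[OF g True] .
      have mi: "?m i \<in> unitary_matrices" using prefix_prod_unitary[OF g] True by simp
      have inv_m: "matrix_inv (?m (Suc i)) = matrix_inv (g i) ** matrix_inv (?m i)"
        using mi gi by (simp add: matrix_inv_mult)
      have g\<kappa>: "g i ** \<kappa> i = matrix_inv (?m i) ** k ** ?m i ** g i"
        unfolding \<kappa>_def inv_m using unitary_inv_cancel(2)[OF gi]
        by (simp flip: matrix_mul_assoc)
      show ?thesis
      proof (cases i)
        case 0
        have "matrix_inv (mat 1) = (mat 1 :: 'n cmat)" by (rule matrix_inv_eqI) simp
        then show ?thesis using g\<kappa> 0 True by (simp add: bs_twist_def left_mult_def)
      next
        case (Suc j)
        have "matrix_inv (\<kappa> j) = matrix_inv (?m i) ** matrix_inv k ** ?m i"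
        proof (rule matrix_inv_eqI)
          show "\<kappa> j ** (matrix_inv (?m i) ** matrix_inv k ** ?m i) = mat 1"
            unfolding \<kappa>_def Suc[symmetric]
            using unitary_inv_cancel[OF mi] unitary_inv_cancel[OF ku] unitary_matrices_inv(3)[OF mi]
            by (simp flip: matrix_mul_assoc)
        qed
        then have "matrix_inv (\<kappa> j) ** (g i ** \<kappa> i) = g i"
          unfolding g\<kappa> using unitary_inv_cancel[OF mi] unitary_inv_cancel[OF ku]
          by (simp flip: matrix_mul_assoc)
        then show ?thesis
          using Suc True by (simp add: bs_twist_def left_mult_def matrix_mul_assoc)
      qed
    qed (simp add: bs_twist_def left_mult_def)
  qed
  then show ?thesis
    using BS_act_BS_class BS_class_bs_twist[OF \<kappa>] by metis
qed

section \<open>The Borel construction of a point and the map to a fixed point\<close>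

lemma pt_orbit:
  assumes "unitary_subgroup K"
  shows "(\<Union>e'\<in>E_orbit K e. borel_orbit K pt_act ((), e')) = borel_orbit K pt_act ((), e)"
proof -
  have "borel_orbit K pt_act ((), E_act k e) = borel_orbit K pt_act ((), e)" if "k \<in> K" for k
    using borel_orbit_act[OF assms that, of pt_act "()" e] by (simp add: pt_act_def)
  then have "\<forall>e'\<in>E_orbit K e. borel_orbit K pt_act ((), e') = borel_orbit K pt_act ((), e)"
    unfolding E_orbit_def[of K e] by blast
  then show ?thesis using E_orbit_self[OF assms, of e] by blast
qed

lemma continuous_map_borel_orbit:
  assumes "x \<in> topspace S"
  shows "continuous_map E_top (borel_space K S act) (\<lambda>e. borel_orbit K act (x, e))"
proof -
  have "continuous_map E_top (prod_topology S E_top) (\<lambda>e. (x, e))"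
    using assms by (intro continuous_map_pairedI) (auto simp: id_def[symmetric])
  from continuous_map_compose[OF this continuous_map_quot_topology]
  show ?thesis by (simp add: o_def borel_space_def)
qed

lemma continuous_map_pt_identification:
  assumes "unitary_subgroup K"
  shows "continuous_map (KE K) (borel_space K pt_top pt_act)
    (\<lambda>Q. \<Union>e\<in>Q. borel_orbit K pt_act ((), e))"
proof -
  have "continuous_map E_top (borel_space K pt_top pt_act)
      ((\<lambda>Q. \<Union>e\<in>Q. borel_orbit K pt_act ((), e)) \<circ> E_orbit K)"
    using continuous_map_borel_orbit[of "()" pt_top K pt_act] pt_orbit[OF assms]
    by (simp add: o_def pt_top_def)
  then show ?thesis
    unfolding KE_def by (rule continuous_compose_quotient_map[OF quotient_map_quot_topology])
qed

text \<open>At a fixed point x the Borel orbit of (x, e) depends only on the K-orbit of e, so the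
  union over representatives is constant.\<close>

lemma borel_map_fixed_point:
  assumes K: "unitary_subgroup K" and fixed: "\<And>k. k \<in> K \<Longrightarrow> act k x = x"
  shows "borel_map K act (\<lambda>_. x) (borel_orbit K pt_act ((), e)) = borel_orbit K act (x, e)"
proof -
  have "borel_orbit K act (x, E_act k e) = borel_orbit K act (x, e)" if "k \<in> K" for k
    using borel_orbit_act[OF K that, of act x e] fixed that unitary_subgroupD(3)[OF K] by simp
  moreover have "mat 1 \<in> K" using unitary_subgroupD(2)[OF K] .
  ultimately show ?thesis
    unfolding borel_map_def borel_orbit_def[of K pt_act] by auto
qed

lemma continuous_map_borel_map_fixed_point:
  assumes K: "unitary_subgroup K" and fixed: "\<And>k. k \<in> K \<Longrightarrow> act k x = x" and x: "x \<in> topspace S"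
  shows "continuous_map (borel_space K pt_top pt_act) (borel_space K S act) (borel_map K act (\<lambda>_. x))"
proof -
  have "continuous_map (prod_topology pt_top E_top) (borel_space K S act)
      (borel_map K act (\<lambda>_. x) \<circ> borel_orbit K pt_act)"
  proof -
    have "borel_map K act (\<lambda>_. x) \<circ> borel_orbit K pt_act =
        (\<lambda>e. borel_orbit K act (x, e)) \<circ> snd"
      using borel_map_fixed_point[where act=act and x=x, OF K fixed] by (auto simp: fun_eq_iff)
    then show ?thesis
      using continuous_map_compose[OF continuous_map_snd continuous_map_borel_orbit[OF x]] by simp
  qed
  then show ?thesis
    unfolding borel_space_def[of K pt_top]
    by (rule continuous_compose_quotient_map[OF quotient_map_quot_topology])
qed

section \<open>Ordered products in rings\<close>

lemma ring_hom_mprod: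
  assumes h: "h \<in> ring_hom R S" and R: "ring R"
  shows "set xs \<subseteq> carrier R \<Longrightarrow> h (mprod R xs) = mprod S (map h xs)"
proof (induction xs)
  case Nil
  then show ?case using ring_hom_one[OF h] by simp
next
  case (Cons x xs)
  interpret ring R by fact
  show ?case using Cons ring_hom_mult[OF h] mprod_closed by simp
qed

text \<open>Isolates the slot in which a tensor relation acts, with the outer factors left on their
  own sides.\<close>

lemma (in ring) mprod_map_split:
  assumes "j \<le> m" "f \<in> {..m} \<rightarrow> carrier R"
  shows "mprod R (map f [0..<Suc m]) =
    mprod R (map f [0..<j]) \<otimes> f j \<otimes> mprod R (map f [Suc j..<Suc m])"
proof -
  have "[0..<Suc m] = [0..<j] @ j # [Suc j..<Suc m]"
    using assms(1) upt_add_eq_append[of 0 j "Suc m - j"] upt_conv_Cons[of j "Suc m"] by simp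
  then have "mprod R (map f [0..<Suc m]) = mprod R (map f [0..<j] @ f j # map f [Suc j..<Suc m])"
    by simp
  also have "\<dots> = mprod R (map f [0..<j]) \<otimes> mprod R (f j # map f [Suc j..<Suc m])"
    using assms by (intro mprod_append) (auto simp: Pi_iff)
  also have "\<dots> = mprod R (map f [0..<j]) \<otimes> f j \<otimes> mprod R (map f [Suc j..<Suc m])"
    using assms by (subst m_assoc) (auto simp: Pi_iff intro!: mprod_closed)
  finally show ?thesis .
qed

section \<open>Localization of pure tensors\<close>

text \<open>The universal property of the free abelian group, with the extension given by the
  formula of \<open>theta_free\<close> in multiplicative notation.\<close>

lemma (in comm_group) hom_free_extension:
  fixes f :: "'c \<Rightarrow> 'a"
  assumes f: "f \<in> S \<rightarrow> carrier G"
  shows "(\<lambda>u. finprod G (\<lambda>a. f a [^] Poly_Mapping.lookup u a) (Poly_Mapping.keys u))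
      \<in> hom (free_Abelian_group S) G"
proof (rule homI)
  let ?F = "\<lambda>u. finprod G (\<lambda>a. f a [^] Poly_Mapping.lookup u a) (Poly_Mapping.keys u)"
  show "?F u \<in> carrier G" if "u \<in> carrier (free_Abelian_group S)" for u
    using that f by (intro finprod_closed) (auto simp: Pi_iff)
  fix u v assume uv: "u \<in> carrier (free_Abelian_group S)" "v \<in> carrier (free_Abelian_group S)"
  let ?T = "Poly_Mapping.keys u \<union> Poly_Mapping.keys v"
  have T: "finite ?T" "?T \<subseteq> S" using uv by auto
  have fT: "f a \<in> carrier G" if "a \<in> ?T" for a
    using that T(2) f by blast
  \<comment> \<open>All products are moved to the common finite set \<open>?T\<close>, where extra
    factors have exponent 0. Cancellation can make the keys of the sum smaller than
    \<open>?T\<close>.\<close>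
  have extend: "?F x = finprod G (\<lambda>a. f a [^] Poly_Mapping.lookup x a) ?T"
    if "Poly_Mapping.keys x \<subseteq> ?T" for x :: "'c \<Rightarrow>\<^sub>0 int"
  proof (rule finprod_mono_neutral_cong_left[OF T(1) that])
    show "f a [^] Poly_Mapping.lookup x a = \<one>" if "a \<in> ?T - Poly_Mapping.keys x" for a
      using that by (simp add: in_keys_iff)
    show "(\<lambda>a. f a [^] Poly_Mapping.lookup x a) \<in> ?T \<rightarrow> carrier G"
      using fT by (intro funcsetI int_pow_closed)
  qed simp
  have "?F (u + v) = finprod G (\<lambda>a. f a [^] Poly_Mapping.lookup (u + v) a) ?T"
    by (rule extend) (rule keys_add)
  also have "\<dots> = finprod G (\<lambda>a. f a [^] Poly_Mapping.lookup u a \<otimes> f a [^] Poly_Mapping.lookup v a) ?T"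
    using fT by (intro finprod_cong') (simp_all only: lookup_add int_pow_mult, simp)
  also have "\<dots> = ?F u \<otimes> ?F v"
    using fT by (subst finprod_multf) (auto simp: extend)
  finally show "?F (u \<otimes>\<^bsub>free_Abelian_group S\<^esub> v) = ?F u \<otimes> ?F v"
    by simp
qed

lemma (in comm_group) free_extension_frag_of:
  assumes "f a \<in> carrier G"
  shows "finprod G (\<lambda>b. f b [^] Poly_Mapping.lookup (frag_of a) b) (Poly_Mapping.keys (frag_of a)) = f a"
  using assms by (simp add: finprod_singleton)

lemma hom_free_Abelian_group_diff:
  assumes h: "h \<in> hom (free_Abelian_group S) A" and A: "group A"
    and uv: "u \<in> carrier (free_Abelian_group S)" "v \<in> carrier (free_Abelian_group S)"
  shows "h (u - v) = h u \<otimes>\<^bsub>A\<^esub> inv\<^bsub>A\<^esub> h v"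
proof -
  interpret group_hom "free_Abelian_group S" A h
    using h A by (simp add: group_hom_def group_hom_axioms_def)
  have "u - v = u \<otimes>\<^bsub>free_Abelian_group S\<^esub> inv\<^bsub>free_Abelian_group S\<^esub> v"
    using uv by simp
  then show ?thesis
    using uv by (metis G.inv_closed hom_inv hom_mult)
qed

lemma hom_zero_on_generate:
  assumes h: "h \<in> hom F A" and F: "group F" and A: "group A"
    and R: "\<And>r. r \<in> R \<Longrightarrow> r \<in> carrier F \<and> h r = \<one>\<^bsub>A\<^esub>"
    and x: "x \<in> generate F R"
  shows "x \<in> carrier F" "h x = \<one>\<^bsub>A\<^esub>"
proof -
  interpret group_hom F A h
    using h F A by (simp add: group_hom_def group_hom_axioms_def)
  have "generate F R \<subseteq> kernel F A h"
    using R by (intro G.generate_subgroup_incl subgroup_kernel) (auto simp: kernel_def)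
  then show "x \<in> carrier F" "h x = \<one>\<^bsub>A\<^esub>" using x by (auto simp: kernel_def)
qed

lemma (in ring) mprod_map_closed:
  "f \<in> A \<rightarrow> carrier R \<Longrightarrow> set xs \<subseteq> A \<Longrightarrow> mprod R (map f xs) \<in> carrier R"
  by (rule mprod_closed) auto

locale fixed_point_setting = weyl_setting G K lift
  for G K :: "'n::finite cmat set" and lift +
  fixes s \<gamma> :: "'n cmat set list"
  assumes s: "set s \<subseteq> reflections G K" and \<gamma>: "\<gamma> \<in> Gamma_seqs G K s"
begin

lemma length_\<gamma>: "length \<gamma> = length s"
  using \<gamma> by (simp add: Gamma_seqs_def)

lemma \<gamma>_nth: "i < length s \<Longrightarrow> \<gamma> ! i = s ! i \<or> \<gamma> ! i = \<one>\<^bsub>W\<^esub>"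
  using \<gamma> by (simp add: Gamma_seqs_def)

lemma \<gamma>_carrier: "i < length s \<Longrightarrow> \<gamma> ! i \<in> carrier W"
proof -
  assume i: "i < length s"
  interpret W: group W by (rule group_W)
  have "s ! i \<in> carrier W" using s reflections_sub i by (meson nth_mem subsetD)
  then show ?thesis using \<gamma>_nth[OF i] W.one_closed by fastforce
qed

lemma set_take_\<gamma>: "set (take i \<gamma>) \<subseteq> carrier W"
proof -
  have "set \<gamma> \<subseteq> carrier W" using \<gamma>_carrier length_\<gamma> by (auto simp: in_set_conv_nth)
  then show ?thesis using set_take_subset[of i \<gamma>] by blast
qed

abbreviation "H i \<equiv> reflection_subgroup G K (s ! i)"

sublocale BS: bott_samelson K "\<lambda>i. H i" "length s"
  by (rule bott_samelson.intro)
    (rule K unitary_subgroup_reflection_subgroup K_sub_reflection_subgroup)+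

definition point :: "nat \<Rightarrow> 'n cmat" where
  "point = (\<lambda>i\<in>{..<length s}. lift (\<gamma> ! i))"

text \<open>Slots are counted from 0: slot i holds \<open>a\<^sub>i\<^sub>+\<^sub>1\<close>, and
  this is the element that twists it.\<close>

definition partial :: "nat \<Rightarrow> 'n cmat set" where
  "partial i = mprod W (take i \<gamma>)"

lemma partial_carrier: "i \<le> length s \<Longrightarrow> partial i \<in> carrier W"
proof -
  interpret W: group W by (rule group_W)
  show "partial i \<in> carrier W"
    unfolding partial_def by (rule W.mprod_closed[OF set_take_\<gamma>])
qed

lemma partial_Suc: "i < length s \<Longrightarrow> partial (Suc i) = partial i \<otimes>\<^bsub>W\<^esub> \<gamma> ! i"
proof -
  interpret W: group W by (rule group_W)
  assume i: "i < length s"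
  show ?thesis
    unfolding partial_def using set_take_\<gamma>[of i] i \<gamma>_carrier[OF i] length_\<gamma>
    by (simp add: take_Suc_conv_app_nth W.mprod_append)
qed

lemma point_in_tuples: "point \<in> topspace BS.tuples"
proof -
  have "lift (\<gamma> ! i) \<in> H i" if i: "i < length s" for i
  proof (cases "\<gamma> ! i = s ! i")
    case True
    then show ?thesis using lift s i by (auto simp: lifting_def subset_iff)
  next
    case False
    then have "lift (\<gamma> ! i) = mat 1" using \<gamma>_nth[OF i] lift by (auto simp: lifting_def)
    then show ?thesis using unitary_subgroupD(2)[OF unitary_subgroup_reflection_subgroup] by simp
  qed
  then show ?thesis by (auto simp: point_def)
qed

text \<open>Liftings multiply correctly up to K, which is all that membership in the class
  records.\<close>

lemma prefix_prod_point: "i \<le> length s \<Longrightarrow> prefix_prod i point \<in> partial i"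
proof (induction i)
  case 0
  then show ?case using W_one_mem by (simp add: partial_def)
next
  case (Suc i)
  then have i: "i < length s" by simp
  then show ?case
    using W_mult_mem[OF Suc.IH lift_mem[OF \<gamma>_carrier[OF i]]] by (simp add: partial_Suc point_def)
qed

lemma BS_point_eq: "BS_point K lift \<gamma> = BS_class K (length s) point"
  by (simp add: BS_point_def length_\<gamma> point_def)

text \<open>The partial products of the point represent elements of W, hence normalize K, as
  \<open>BS_act_fixed_point\<close> requires.\<close>

lemma BS_point_fixed: "k \<in> K \<Longrightarrow> BS_act (length s) k (BS_point K lift \<gamma>) = BS_point K lift \<gamma>"
  unfolding BS_point_eq
  using W_mem_N[OF partial_carrier prefix_prod_point] N_conj(2)
  by (intro BS.BS_act_fixed_point point_in_tuples) auto

lemma BS_point_topspace: "BS_point K lift \<gamma> \<in> topspace BS.variety"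
  unfolding BS_point_eq topspace_quot_topology by (rule imageI[OF point_in_tuples])

abbreviation "BSK \<equiv> borel_space K BS.variety (BS_act (length s))"

abbreviation "to_pt \<equiv> (\<lambda>Q. \<Union>e\<in>Q. borel_orbit K pt_act ((), e))"

abbreviation "from_pt \<equiv> borel_map K (BS_act (length s)) (\<lambda>_. BS_point K lift \<gamma>)"

lemma BSK_eq: "borel_space K (BS_top G K s) (BS_act (length s)) = BSK"
  by (simp add: BS_top_def)

lemma continuous_map_to_pt: "continuous_map (KE K) (borel_space K pt_top pt_act) to_pt"
  by (rule continuous_map_pt_identification[OF K])

lemma continuous_map_from_pt: "continuous_map (borel_space K pt_top pt_act) BSK from_pt"
proof (rule continuous_map_borel_map_fixed_point[OF K])
  show "BS_act (length s) k (BS_point K lift \<gamma>) = BS_point K lift \<gamma>" if "k \<in> K" for k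
    using that by (rule BS_point_fixed)
qed (rule BS_point_topspace)

lemma fixed_point_pullback_eq:
  "fixed_point_pullback K lift \<gamma> h = pullback (KE K) to_pt (pullback (borel_space K pt_top pt_act) from_pt h)"
  by (simp add: fixed_point_pullback_def pt_identification_def eq_pullback_def length_\<gamma>)

lemma ring_hom_fixed_point_pullback:
  "(fixed_point_pullback K lift \<gamma> :: ('n, 'k::comm_ring_1) Hclass \<Rightarrow> _) \<in> ring_hom (Hring G K s) (Rring K)"
proof -
  have "(fixed_point_pullback K lift \<gamma> :: ('n, 'k) Hclass \<Rightarrow> _) =
      pullback (KE K) to_pt \<circ> pullback (borel_space K pt_top pt_act) from_pt"
    by (auto simp: fixed_point_pullback_eq)
  then show ?thesis
    unfolding Hring_def eq_cohomology_def BSK_eq Rring_def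
    using ring_hom_trans[OF ring_hom_pullback[OF continuous_map_from_pt]
        ring_hom_pullback[OF continuous_map_to_pt]] by simp
qed

lemma phi_fixed_point:
  assumes "Q \<in> topspace (KE K)" "i \<le> length s"
  shows "phi K (length s) (from_pt (to_pt Q)) i = rho K lift (inv\<^bsub>W\<^esub> partial i) Q"
proof -
  obtain e where Q: "Q = E_orbit K e" using assms(1) by (auto simp: topspace_KE)
  have "from_pt (to_pt Q) = borel_orbit K (BS_act (length s)) (BS_class K (length s) point, e)"
    unfolding Q pt_orbit[OF K]
    using borel_map_fixed_point[where act="BS_act (length s)", OF K BS_point_fixed]
    by (simp add: BS_point_eq)
  then have "phi K (length s) (from_pt (to_pt Q)) i =
      E_orbit K (E_act (matrix_inv (prefix_prod i point)) e)"
    using assms(2) by (simp only: BS.phi_borel_orbit[OF point_in_tuples]) simp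
  also have "\<dots> = rho K lift (inv\<^bsub>W\<^esub> partial i) Q"
    unfolding Q
    using rho_E_orbit[OF group.inv_closed[OF group_W partial_carrier[OF assms(2)]]
        W_inv_mem[OF partial_carrier[OF assms(2)] prefix_prod_point[OF assms(2)]]] by simp
  finally show ?thesis .
qed

abbreviation "P \<equiv> product_topology (\<lambda>_. KE K) {..length s}"

text \<open>The right-hand side of the formula as a function of tuples, so that its compatibility
  with the tensor relations can be examined slot by slot before any quotient is taken.\<close>

definition localized :: "('n, 'k::comm_ring_1) Rclass list \<Rightarrow> ('n, 'k) Rclass" where
  "localized b = mprod (Rring K) (map (\<lambda>i. Weyl_act G K lift (partial i) (b ! i)) [0..<Suc (length s)])"

lemma Rtuples_nth: "b \<in> Rtuples K (Suc (length s)) \<Longrightarrow> i \<le> length s \<Longrightarrow> b ! i \<in> carrier (Rring K)"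
  by (auto simp: Rtuples_def subset_iff)

lemma pullback_projection_closed:
  assumes "b \<in> Rtuples K (Suc (length s))" "i \<le> length s"
  shows "pullback P (\<lambda>x. x i) (b ! i :: ('n, 'k::comm_ring_1) Rclass) \<in> carrier (cohomology P)"
proof -
  have "continuous_map P (KE K) (\<lambda>x. x i)"
    using assms(2) by (intro continuous_map_product_projection) simp
  from ring_hom_closed[OF ring_hom_pullback[OF this]] Rtuples_nth[OF assms]
  show ?thesis by (simp add: Rring_def)
qed

lemma theta_tuple_closed:
  assumes "b \<in> Rtuples K (Suc (length s))"
  shows "(theta_tuple G K s b :: ('n, 'k::comm_ring_1) Hclass) \<in> carrier (Hring G K s)"
proof -
  interpret ring "cohomology P :: (nat \<Rightarrow> (nat \<Rightarrow> complex^'n) set, 'k) cochain set ring"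
    by (rule ring_cohomology)
  have "mprod (cohomology P) (map (\<lambda>i. pullback P (\<lambda>x. x i) (b ! i)) [0..<Suc (length s)])
      \<in> carrier (cohomology P)"
    using pullback_projection_closed[OF assms] by (intro mprod_closed) auto
  from ring_hom_closed[OF ring_hom_pullback[OF BS.continuous_map_phi] this]
  show ?thesis
    by (simp add: theta_tuple_def Hring_def eq_cohomology_def BSK_eq Let_def del: upt_Suc)
qed

lemma fixed_point_pullback_theta_tuple:
  assumes b: "b \<in> Rtuples K (Suc (length s))"
  shows "fixed_point_pullback K lift \<gamma> (theta_tuple G K s b) =
    (localized b :: ('n, 'k::comm_ring_1) Rclass)"
proof -
  let ?J = "phi K (length s) \<circ> from_pt \<circ> to_pt"
  let ?xs = "map (\<lambda>i. pullback P (\<lambda>x. x i) (b ! i)) [0..<Suc (length s)]"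
  have J: "continuous_map (KE K) P ?J"
    by (rule continuous_map_compose[OF continuous_map_to_pt
          continuous_map_compose[OF continuous_map_from_pt BS.continuous_map_phi, folded o_assoc]])
  interpret P: ring "cohomology P :: (nat \<Rightarrow> (nat \<Rightarrow> complex^'n) set, 'k) cochain set ring"
    by (rule ring_cohomology)
  have xs: "set ?xs \<subseteq> carrier (cohomology P)"
    using pullback_projection_closed[OF b] by auto
  then have m: "mprod (cohomology P) ?xs \<in> carrier (cohomology P)"
    by (rule P.mprod_closed)
  have "fixed_point_pullback K lift \<gamma> (theta_tuple G K s b) = pullback (KE K) to_pt
      (pullback (borel_space K pt_top pt_act) from_pt
        (pullback BSK (phi K (length s)) (mprod (cohomology P) ?xs)))"
    by (simp add: fixed_point_pullback_eq theta_tuple_def BSK_eq Let_def del: upt_Suc)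
  also have "\<dots> = pullback (KE K) ?J (mprod (cohomology P) ?xs)"
    using continuous_map_compose[OF continuous_map_from_pt BS.continuous_map_phi]
    by (simp only: pullback_compose[OF continuous_map_from_pt BS.continuous_map_phi m]
        pullback_compose[OF continuous_map_to_pt _ m])
  also have "\<dots> = mprod (cohomology (KE K)) (map (pullback (KE K) ?J) ?xs)"
    by (rule ring_hom_mprod[OF ring_hom_pullback[OF J] ring_cohomology xs])
  also have "map (pullback (KE K) ?J) ?xs =
      map (\<lambda>i. Weyl_act G K lift (partial i) (b ! i)) [0..<Suc (length s)]"
    unfolding map_map
  proof (rule map_cong[OF refl])
    fix i assume "i \<in> set [0..<Suc (length s)]"
    then have i: "i \<le> length s" by auto
    have pr: "continuous_map P (KE K) (\<lambda>x. x i)"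
      using i by (intro continuous_map_product_projection) simp
    have bi: "b ! i \<in> carrier (cohomology (KE K))"
      using Rtuples_nth[OF b i] by (simp add: Rring_def)
    have "pullback (KE K) ?J (pullback P (\<lambda>x. x i) (b ! i)) = pullback (KE K) ((\<lambda>x. x i) \<circ> ?J) (b ! i)"
      by (rule pullback_compose[OF J pr bi])
    also have "\<dots> = Weyl_act G K lift (partial i) (b ! i)"
      unfolding Weyl_act_def by (rule pullback_cong) (simp add: phi_fixed_point i)
    finally show "(pullback (KE K) ?J \<circ> (\<lambda>i. pullback P (\<lambda>x. x i) (b ! i))) i =
        Weyl_act G K lift (partial i) (b ! i)" by simp
  qed
  finally show ?thesis by (simp only: localized_def Rring_def)
qed

lemma Weyl_act_closed:
  "w \<in> carrier W \<Longrightarrow> r \<in> carrier (Rring K) \<Longrightarrow>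
    Weyl_act G K lift w (r :: ('n, 'k::comm_ring_1) Rclass) \<in> carrier (Rring K)"
  by (rule ring_hom_closed[OF Weyl_act_ring_hom])

lemma localized_closed:
  assumes "b \<in> Rtuples K (Suc (length s))"
  shows "(localized b :: ('n, 'k::comm_ring_1) Rclass) \<in> carrier (Rring K)"
proof -
  interpret ring "Rring K :: ('n, 'k) Rclass ring" unfolding Rring_def by (rule ring_cohomology)
  show ?thesis
    unfolding localized_def using Rtuples_nth[OF assms]
    by (intro mprod_closed) (auto intro!: Weyl_act_closed partial_carrier)
qed

lemma Rtuples_update:
  "b \<in> Rtuples K m \<Longrightarrow> r \<in> carrier (Rring K) \<Longrightarrow> b[i := r] \<in> Rtuples K m"
  using set_update_subset_insert[of b i r] by (auto simp: Rtuples_def)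

lemma localized_add:
  assumes a: "a \<in> Rtuples K (Suc (length s))" and i: "i < Suc (length s)"
    and bc: "b \<in> carrier (Rring K)" "c \<in> carrier (Rring K)"
  shows "localized (a[i := b \<oplus>\<^bsub>Rring K\<^esub> c]) =
    localized (a[i := b]) \<oplus>\<^bsub>Rring K\<^esub> (localized (a[i := c]) :: ('n, 'k::comm_ring_1) Rclass)"
proof -
  interpret ring "Rring K :: ('n, 'k) Rclass ring" unfolding Rring_def by (rule ring_cohomology)
  let ?f = "\<lambda>r j. Weyl_act G K lift (partial j) (a[i := r] ! j)"
  have len: "length a = Suc (length s)" using a by (simp add: Rtuples_def)
  have f: "?f r \<in> {..length s} \<rightarrow> carrier (Rring K)" if "r \<in> carrier (Rring K)" for r
    using Rtuples_nth[OF Rtuples_update[OF a that]] by (auto intro!: Weyl_act_closed partial_carrier)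
  \<comment> \<open>The outer factors are formed with b in slot i but never read that slot, so they
    serve equally for c and for the sum.\<close>
  define x where "x = mprod (Rring K) (map (?f b) [0..<i])"
  define y where "y = mprod (Rring K) (map (?f b) [Suc i..<Suc (length s)])"
  have xy: "x \<in> carrier (Rring K)" "y \<in> carrier (Rring K)"
    unfolding x_def y_def using i by (auto intro!: mprod_map_closed[OF f[OF bc(1)]] simp del: upt_Suc)
  have split: "localized (a[i := r]) = x \<otimes>\<^bsub>Rring K\<^esub> Weyl_act G K lift (partial i) r \<otimes>\<^bsub>Rring K\<^esub> y"
    if r: "r \<in> carrier (Rring K)" for r
  proof -
    have "localized (a[i := r]) = mprod (Rring K) (map (?f r) [0..<i]) \<otimes>\<^bsub>Rring K\<^esub> ?f r i
        \<otimes>\<^bsub>Rring K\<^esub> mprod (Rring K) (map (?f r) [Suc i..<Suc (length s)])"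
      unfolding localized_def using i by (intro mprod_map_split f r) simp
    moreover have "map (?f r) [0..<i] = map (?f b) [0..<i]"
      "map (?f r) [Suc i..<Suc (length s)] = map (?f b) [Suc i..<Suc (length s)]"
      by (auto simp del: upt_Suc)
    ultimately show ?thesis
      using i len by (simp add: x_def y_def del: upt_Suc)
  qed
  show ?thesis
    using xy bc i
    by (simp add: split ring_hom_add[OF Weyl_act_ring_hom] partial_carrier Weyl_act_closed l_distr r_distr)
qed

text \<open>This is where \<open>\<gamma>\<^sub>i \<in> {s\<^sub>i, 1}\<close> enters: both elements fix the \<open>s\<^sub>i\<close>-invariants.\<close>

lemma Weyl_act_partial_invariant:
  assumes i: "i < length s" and r: "r \<in> Weyl_invariants G K lift (s ! i)"
  shows "Weyl_act G K lift (partial (Suc i)) r = Weyl_act G K lift (partial i) r"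
proof -
  have r': "r \<in> carrier (Rring K)" "Weyl_act G K lift (s ! i) r = r"
    using r by (auto simp: Weyl_invariants_def)
  have "Weyl_act G K lift (\<gamma> ! i) r = r"
  proof (cases "\<gamma> ! i = s ! i")
    case False
    then have "\<gamma> ! i = \<one>\<^bsub>W\<^esub>" using \<gamma>_nth[OF i] by simp
    then show ?thesis using Weyl_act_one[OF r'(1)] by simp
  qed (simp add: r'(2))
  then show ?thesis
    using i r'(1) by (simp add: partial_Suc Weyl_act_mult partial_carrier \<gamma>_carrier)
qed

text \<open>On the left r is the right factor of slot i, twisted by \<open>partial i\<close>; on the
  right it is the left factor of the next slot, twisted by \<open>partial (Suc i)\<close>. Both
  twists agree on r, and the two places are adjacent, so only brackets move.\<close>

lemma localized_balanced:
  assumes a: "a \<in> Rtuples K (Suc (length s))" and i: "i < length s"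
    and r: "r \<in> Weyl_invariants G K lift (s ! i)"
  shows "localized (a[i := a ! i \<otimes>\<^bsub>Rring K\<^esub> r]) =
    (localized (a[Suc i := r \<otimes>\<^bsub>Rring K\<^esub> a ! Suc i]) :: ('n, 'k::comm_ring_1) Rclass)"
proof -
  interpret ring "Rring K :: ('n, 'k) Rclass ring" unfolding Rring_def by (rule ring_cohomology)
  have r': "r \<in> carrier (Rring K)" using r by (simp add: Weyl_invariants_def)
  have len: "length a = Suc (length s)" using a by (simp add: Rtuples_def)
  have ai: "a ! i \<in> carrier (Rring K)" "a ! Suc i \<in> carrier (Rring K)"
    using Rtuples_nth[OF a] i by simp_all
  let ?b = "a[i := a ! i \<otimes>\<^bsub>Rring K\<^esub> r]" and ?c = "a[Suc i := r \<otimes>\<^bsub>Rring K\<^esub> a ! Suc i]"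
  have bc: "?b \<in> Rtuples K (Suc (length s))" "?c \<in> Rtuples K (Suc (length s))"
    using ai r' by (auto intro!: Rtuples_update a)
  let ?f = "\<lambda>b j. Weyl_act G K lift (partial j) (b ! j)"
  have f: "?f b \<in> {..length s} \<rightarrow> carrier (Rring K)" if "b \<in> Rtuples K (Suc (length s))"
    for b :: "('n, 'k) Rclass list"
    using Rtuples_nth[OF that] by (auto intro!: Weyl_act_closed partial_carrier)
  have split: "localized b = mprod (Rring K) (map (?f b) [0..<i]) \<otimes>\<^bsub>Rring K\<^esub> ?f b i \<otimes>\<^bsub>Rring K\<^esub>
      (?f b (Suc i) \<otimes>\<^bsub>Rring K\<^esub> mprod (Rring K) (map (?f b) [Suc (Suc i)..<Suc (length s)]))"
    if b: "b \<in> Rtuples K (Suc (length s))" for b :: "('n, 'k) Rclass list"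
  proof -
    have "localized b = mprod (Rring K) (map (?f b) [0..<i]) \<otimes>\<^bsub>Rring K\<^esub> ?f b i
        \<otimes>\<^bsub>Rring K\<^esub> mprod (Rring K) (map (?f b) [Suc i..<Suc (length s)])"
      unfolding localized_def using i by (intro mprod_map_split f b) simp
    then show ?thesis
      using i by (simp add: upt_conv_Cons[of "Suc i"] del: upt_Suc)
  qed
  define x where "x = mprod (Rring K) (map (?f a) [0..<i])"
  define y where "y = mprod (Rring K) (map (?f a) [Suc (Suc i)..<Suc (length s)])"
  have xy: "x \<in> carrier (Rring K)" "y \<in> carrier (Rring K)"
    unfolding x_def y_def using i by (auto intro!: mprod_map_closed[OF f[OF a]] simp del: upt_Suc)
  have eqs: "map (?f ?b) [0..<i] = map (?f a) [0..<i]" "map (?f ?c) [0..<i] = map (?f a) [0..<i]"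
    "map (?f ?b) [Suc (Suc i)..<Suc (length s)] = map (?f a) [Suc (Suc i)..<Suc (length s)]"
    "map (?f ?c) [Suc (Suc i)..<Suc (length s)] = map (?f a) [Suc (Suc i)..<Suc (length s)]"
    by (auto simp del: upt_Suc)
  let ?p = "Weyl_act G K lift (partial i)" and ?q = "Weyl_act G K lift (partial (Suc i))"
  have pq: "?p \<in> ring_hom (Rring K) (Rring K :: ('n, 'k) Rclass ring)"
    "?q \<in> ring_hom (Rring K) (Rring K :: ('n, 'k) Rclass ring)"
    using i by (auto intro!: Weyl_act_ring_hom partial_carrier)
  have "localized ?b = x \<otimes>\<^bsub>Rring K\<^esub> (?p (a ! i) \<otimes>\<^bsub>Rring K\<^esub> ?p r) \<otimes>\<^bsub>Rring K\<^esub> (?q (a ! Suc i) \<otimes>\<^bsub>Rring K\<^esub> y)"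
    unfolding split[OF bc(1)] eqs x_def[symmetric] y_def[symmetric]
    using i len ai r' by (simp add: ring_hom_mult[OF pq(1)])
  also have "\<dots> = x \<otimes>\<^bsub>Rring K\<^esub> ?p (a ! i) \<otimes>\<^bsub>Rring K\<^esub> ((?q r \<otimes>\<^bsub>Rring K\<^esub> ?q (a ! Suc i)) \<otimes>\<^bsub>Rring K\<^esub> y)"
    using xy ai r' pq by (simp add: Weyl_act_partial_invariant[OF i r] m_assoc ring_hom_closed)
  also have "\<dots> = localized ?c"
    unfolding split[OF bc(2)] eqs x_def[symmetric] y_def[symmetric]
    using i len ai r' by (simp add: ring_hom_mult[OF pq(2)])
  finally show ?thesis .
qed

text \<open>Additivity and the values on single tuples together determine the composite on formal
  sums, before any relation is imposed.\<close>

lemma fixed_point_pullback_theta_free: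
  "(\<lambda>u. fixed_point_pullback K lift \<gamma> (theta_free G K s u :: ('n, 'k::comm_ring_1) Hclass))
      \<in> hom (free_Abelian_group (Rtuples K (Suc (length s)))) (add_monoid (Rring K))"
  "b \<in> Rtuples K (Suc (length s)) \<Longrightarrow>
    fixed_point_pullback K lift \<gamma> (theta_free G K s (frag_of b)) =
      (localized b :: ('n, 'k) Rclass)"
proof -
  interpret ring "Hring G K s :: ('n, 'k) Hclass ring"
    unfolding Hring_def eq_cohomology_def by (rule ring_cohomology)
  have theta: "theta_tuple G K s \<in> Rtuples K (Suc (length s)) \<rightarrow>
      carrier (add_monoid (Hring G K s :: ('n, 'k) Hclass ring))"
    by (intro funcsetI) (simp add: theta_tuple_closed)
  have theta_free: "theta_free G K s = (\<lambda>u. finprod (add_monoid (Hring G K s :: ('n, 'k) Hclass ring))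
      (\<lambda>a. theta_tuple G K s a [^]\<^bsub>add_monoid (Hring G K s)\<^esub> Poly_Mapping.lookup u a)
      (Poly_Mapping.keys u))"
    by (rule ext) (simp add: theta_free_def finsum_def add_pow_def)
  have "fixed_point_pullback K lift \<gamma> \<in>
      hom (add_monoid (Hring G K s)) (add_monoid (Rring K :: ('n, 'k) Rclass ring))"
    using ring_hom_fixed_point_pullback by (auto simp: ring_hom_def hom_def)
  from hom_compose[OF comm_group.hom_free_extension[OF a_comm_group theta] this]
  show "(\<lambda>u. fixed_point_pullback K lift \<gamma> (theta_free G K s u :: ('n, 'k) Hclass))
      \<in> hom (free_Abelian_group (Rtuples K (Suc (length s)))) (add_monoid (Rring K))"
    by (simp add: theta_free o_def)
  show "fixed_point_pullback K lift \<gamma> (theta_free G K s (frag_of b)) =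
      (localized b :: ('n, 'k) Rclass)" if b: "b \<in> Rtuples K (Suc (length s))"
    using comm_group.free_extension_frag_of[OF a_comm_group, of "theta_tuple G K s" b] theta_tuple_closed[OF b]
    by (simp only: theta_free fixed_point_pullback_theta_tuple[OF b] monoid_record_simps)
qed

lemma tensor_relations_vanish:
  assumes "u \<in> (tensor_relations G K lift s :: (('n, 'k::comm_ring_1) Rclass list \<Rightarrow>\<^sub>0 int) set)"
  shows "u \<in> carrier (free_Abelian_group (Rtuples K (Suc (length s)))) \<and>
    fixed_point_pullback K lift \<gamma> (theta_free G K s u) = \<one>\<^bsub>add_monoid (Rring K)\<^esub>"
proof -
  interpret ring "Rring K :: ('n, 'k) Rclass ring" unfolding Rring_def by (rule ring_cohomology)
  let ?T = "Rtuples K (Suc (length s)) :: ('n, 'k) Rclass list set"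
  let ?h = "\<lambda>u. fixed_point_pullback K lift \<gamma> (theta_free G K s u :: ('n, 'k) Hclass)"
  let ?A = "free_Abelian_group ?T"
  note h = fixed_point_pullback_theta_free(1)[where 'k='k]
  note h_of = fixed_point_pullback_theta_free(2)[where 'k='k]
  have diff: "u - v \<in> carrier ?A \<and> ?h (u - v) = ?h u \<ominus>\<^bsub>Rring K\<^esub> ?h v"
    if "u \<in> carrier ?A" "v \<in> carrier ?A" for u v
    using hom_free_Abelian_group_diff[OF h a_group that] that keys_diff[of u v]
    by (auto simp: a_minus_def a_inv_def)
  consider (add) a i b c where
      "u = frag_of (a[i := b \<oplus>\<^bsub>Rring K\<^esub> c]) - frag_of (a[i := b]) - frag_of (a[i := c])"
      "a \<in> ?T" "i < Suc (length s)" "b \<in> carrier (Rring K)" "c \<in> carrier (Rring K)"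
    | (bal) a i r where
      "u = frag_of (a[i := a ! i \<otimes>\<^bsub>Rring K\<^esub> r]) - frag_of (a[Suc i := r \<otimes>\<^bsub>Rring K\<^esub> a ! Suc i])"
      "a \<in> ?T" "i < length s" "r \<in> Weyl_invariants G K lift (s ! i)"
    using assms unfolding tensor_relations_def by blast
  then show ?thesis
  proof cases
    case add
    let ?x = "a[i := b \<oplus>\<^bsub>Rring K\<^esub> c]" and ?y = "a[i := b]" and ?z = "a[i := c]"
    have T: "?x \<in> ?T" "?y \<in> ?T" "?z \<in> ?T"
      using add by (auto intro!: Rtuples_update)
    then have of: "frag_of ?x \<in> carrier ?A" "frag_of ?y \<in> carrier ?A" "frag_of ?z \<in> carrier ?A"
      by simp_all
    have 1: "frag_of ?x - frag_of ?y \<in> carrier ?A" using diff[OF of(1,2)] by blast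
    have "?h u = localized ?x \<ominus>\<^bsub>Rring K\<^esub> localized ?y \<ominus>\<^bsub>Rring K\<^esub> localized ?z"
      using diff[OF 1 of(3)] diff[OF of(1,2)] by (simp only: add(1) h_of T)
    also have "\<dots> = \<zero>\<^bsub>Rring K\<^esub>"
      using localized_closed[OF T(2)] localized_closed[OF T(3)]
      by (simp add: localized_add[OF add(2-5)] a_minus_def a_comm[of "localized ?y"] a_assoc r_neg)
    finally show ?thesis using diff[OF 1 of(3)] add(1) by simp
  next
    case bal
    let ?x = "a[i := a ! i \<otimes>\<^bsub>Rring K\<^esub> r]" and ?y = "a[Suc i := r \<otimes>\<^bsub>Rring K\<^esub> a ! Suc i]"
    have r: "r \<in> carrier (Rring K)" using bal by (simp add: Weyl_invariants_def)
    have T: "?x \<in> ?T" "?y \<in> ?T"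
      using bal r Rtuples_nth[OF bal(2)] by (auto intro!: Rtuples_update)
    then have of: "frag_of ?x \<in> carrier ?A" "frag_of ?y \<in> carrier ?A"
      by simp_all
    have "?h u = localized ?x \<ominus>\<^bsub>Rring K\<^esub> localized ?y"
      using diff[OF of] by (simp only: bal(1) h_of T)
    also have "\<dots> = \<zero>\<^bsub>Rring K\<^esub>"
      using localized_closed[OF T(2)] by (simp add: localized_balanced[OF bal(2-4)] a_minus_def r_neg)
    finally show ?thesis using diff[OF of] bal(1) by simp
  qed
qed

lemma fixed_point_pullback_theta:
  assumes a: "a \<in> Rtuples K (Suc (length s))"
  shows "fixed_point_pullback K lift \<gamma> (theta G K s (pure_tensor G K lift s a)) =
    (localized a :: ('n, 'k::comm_ring_1) Rclass)"
proof -
  interpret ring "Rring K :: ('n, 'k) Rclass ring" unfolding Rring_def by (rule ring_cohomology)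
  let ?T = "Rtuples K (Suc (length s)) :: ('n, 'k) Rclass list set"
  let ?A = "free_Abelian_group ?T"
  let ?h = "\<lambda>u. fixed_point_pullback K lift \<gamma> (theta_free G K s u :: ('n, 'k) Hclass)"
  let ?\<xi> = "pure_tensor G K lift s a"
  note h = fixed_point_pullback_theta_free(1)[where 'k='k]
  have \<xi>: "?\<xi> = {z + frag_of a |z. z \<in> generate ?A (tensor_relations G K lift s)}"
    by (auto simp: pure_tensor_def tensor_kernel_def r_coset_def)
  have const: "?h u = localized a" if u: "u \<in> ?\<xi>" for u
  proof -
    obtain z where z: "z \<in> generate ?A (tensor_relations G K lift s)" "u = z + frag_of a"
      using u \<xi> by blast
    have z': "z \<in> carrier ?A" "?h z = \<zero>\<^bsub>Rring K\<^esub>"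
      using hom_zero_on_generate[OF h group_free_Abelian_group a_group tensor_relations_vanish z(1)]
      by simp_all
    have "frag_of a \<in> carrier ?A" using a by simp
    from hom_mult[OF h z'(1) this] show ?thesis
      using z(2) z'(2) localized_closed[OF a] fixed_point_pullback_theta_free(2)[OF a]
      by simp
  qed
  have "frag_of a \<in> ?\<xi>"
    unfolding \<xi> using generate.one[of ?A "tensor_relations G K lift s"] by force
  \<comment> \<open>Both pull-backs are unions over the elements of their argument, so they
    distribute over the union over representatives that defines \<open>theta\<close>; every
    representative then contributes the same class.\<close>
  moreover have "fixed_point_pullback K lift \<gamma> (theta G K s ?\<xi>) = (\<Union>u\<in>?\<xi>. ?h u)"
    by (simp add: fixed_point_pullback_eq theta_def pullback_def)
  ultimately show ?thesis using const by auto
qed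

end

theorem theorem37:
  fixes G K :: "'n::finite cmat set"
    and lift :: "'n cmat set \<Rightarrow> 'n cmat"
    and s \<gamma> :: "'n cmat set list"
    and x :: "'n cmat set"
    and a :: "('n, 'k::comm_ring_1) Rclass list"
  assumes "finite_global_dimension TYPE('k)"
    and "(2::'k) dvd 1"
    and "compact_matrix_group G"
    and "semisimple_group G"
    and "maximal_torus K G"
    and "lifting G K lift"
    and "set s \<subseteq> reflections G K"
    and "x \<in> carrier (Weyl G K)"
    and "\<gamma> \<in> Gamma_at G K s x"
    and "length a = Suc (length s)"
    and "set a \<subseteq> carrier (Rring K)"
  shows "(fixed_point_pullback K lift \<gamma> \<circ> theta G K s) (pure_tensor G K lift s a) =
    mprod (Rring K)
      (map (\<lambda>i. Weyl_act G K lift (mprod (Weyl G K) (take i \<gamma>)) (a ! i)) [0..<Suc (length s)])"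
proof -
  have G: "unitary_subgroup G" using assms(3) by (simp add: compact_matrix_group_def)
  have KG: "torus K" "K \<subseteq> G" using assms(5) by (simp_all add: maximal_torus_def)
  interpret fixed_point_setting G K lift s \<gamma>
  proof (intro fixed_point_setting.intro weyl_setting.intro fixed_point_setting_axioms.intro)
    show "unitary_subgroup K"
      using KG unitary_subgroupD(1)[OF G] by (intro unitary_subgroup_torus) auto
    show "\<gamma> \<in> Gamma_seqs G K s" using assms(9) by (simp add: Gamma_at_def)
  qed (fact G KG assms)+
  have "a \<in> Rtuples K (Suc (length s))" using assms(10,11) by (simp add: Rtuples_def)
  from fixed_point_pullback_theta[OF this] show ?thesis
    by (simp only: o_apply localized_def partial_def)
qed

end
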